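(* Let $K$ be a field and let $\mathfrak{M}$ be a homogeneous Schreier variety of $K$-algebras that satisfies the identity $x^2=0$ and does not satisfy the identity $x_1x_2=0$. Then $\mathfrak{M}$ is MLM. In particular, the variety $\mathcal{L}_K$ of Lie $K$-algebras and the variety $\mathcal{AC}_K$ of anticommutative $K$-algebras are MLM.
   Context: Algebras over a field are vector spaces with a bilinear product; they are not assumed to be associative or to have a unit. For a field $K$, $K\{X\}$ denotes the free nonassociative $K$-algebra on a countable set of symbols $X=\{x_1,x_2,\dots\}$. A variety $\mathfrak{M}$ of $K$-algebras with defining identities $I\subseteq K\{X\}$ is the class of all $K$-algebras satisfying all the identities $f=0$, $f\in I$. It is homogeneous if, whenever $f\in K\{X\}$ is an identity holding in all algebras of $\mathfrak{M}$, every homogeneous component of $f$ (with respect to the degrees in each variable) is also such an identity. For a field extension $K\subseteq F$, $\mathfrak{M}_F$ denotes the variety of $F$-algebras with the same defining identities $I$. The free $K$-algebra in $\mathfrak{M}$ with set of free generators $Y$ is the algebra in $\mathfrak{M}$ containing $Y$ such that every map from $Y$ to an algebra $A\in\mathfrak{M}$ extends uniquely to a $K$-algebra homomorphism into $A$. $\mathfrak{M}$ is a Schreier variety if every subalgebra of a free algebra in $\mathfrak{M}$ is a free algebra in $\mathfrak{M}$. $\mathcal{L}_K$ is the variety with defining relations $x_1^2$ and $(x_1x_2)x_3+(x_2x_3)x_1+(x_3x_1)x_2$; $\mathcal{AC}_K$ is the variety with defining relation $x_1x_2+x_2x_1$. MLM variety: a homogeneous variety $\mathfrak{M}$ of $K$-algebras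 is MLM if for every field extension $K\subseteq F$, every $A\in\mathfrak{M}_F$ and every finite subset $Y=\{y_1,\dots,y_n\}\subseteq A$ of at least two elements such that the $K$-subalgebra of $A$ generated by $Y$ is the free $K$-algebra in $\mathfrak{M}$ with set of free generators $Y$, the $F$-subalgebra of $A$ generated by $Y$ is the free $F$-algebra in $\mathfrak{M}_F$ with set of free generators $Y$. *)

theory Defs
  imports "HOL-Algebra.Module" "HOL-Library.Infinite_Typeclass"
begin

section \<open>Nonassociative algebras\<close>

text \<open>
  Algebras over a field are records of type \<open>('k, 'a) module\<close>. The record field
  \<open>one\<close>, inherited from \<open>monoid\<close>, carries no meaning and is ignored throughout: algebras
  need not be unital.
\<close>

locale nonassoc_algebra = Module.module K A + K?: field K
  for K :: "'k ring" and A :: "('k, 'a) module" (structure) +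
  assumes mult_closed [simp, intro]:
      "\<lbrakk>x \<in> carrier A; y \<in> carrier A\<rbrakk> \<Longrightarrow> x \<otimes> y \<in> carrier A"
    and mult_l_distr:
      "\<lbrakk>x \<in> carrier A; y \<in> carrier A; z \<in> carrier A\<rbrakk> \<Longrightarrow> (x \<oplus> y) \<otimes> z = x \<otimes> z \<oplus> y \<otimes> z"
    and mult_r_distr:
      "\<lbrakk>x \<in> carrier A; y \<in> carrier A; z \<in> carrier A\<rbrakk> \<Longrightarrow> z \<otimes> (x \<oplus> y) = z \<otimes> x \<oplus> z \<otimes> y"
    and smult_mult_l:
      "\<lbrakk>a \<in> carrier K; x \<in> carrier A; y \<in> carrier A\<rbrakk> \<Longrightarrow> (a \<odot> x) \<otimes> y = a \<odot> (x \<otimes> y)"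
    and smult_mult_r:
      "\<lbrakk>a \<in> carrier K; x \<in> carrier A; y \<in> carrier A\<rbrakk> \<Longrightarrow> x \<otimes> (a \<odot> y) = a \<odot> (x \<otimes> y)"

definition alg_hom :: "'k ring \<Rightarrow> ('k, 'a) module \<Rightarrow> ('k, 'b) module \<Rightarrow> ('a \<Rightarrow> 'b) set" where
  "alg_hom K A B = {h \<in> carrier A \<rightarrow> carrier B.
     (\<forall>x\<in>carrier A. \<forall>y\<in>carrier A. h (x \<oplus>\<^bsub>A\<^esub> y) = h x \<oplus>\<^bsub>B\<^esub> h y) \<and>
     (\<forall>x\<in>carrier A. \<forall>y\<in>carrier A. h (x \<otimes>\<^bsub>A\<^esub> y) = h x \<otimes>\<^bsub>B\<^esub> h y) \<and>
     (\<forall>a\<in>carrier K. \<forall>x\<in>carrier A. h (a \<odot>\<^bsub>A\<^esub> x) = a \<odot>\<^bsub>B\<^esub> h x)}"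

definition subalgebra :: "'k ring \<Rightarrow> ('k, 'a) module \<Rightarrow> 'a set \<Rightarrow> bool" where
  "subalgebra K A S \<longleftrightarrow> submodule S K A \<and> (\<forall>x\<in>S. \<forall>y\<in>S. x \<otimes>\<^bsub>A\<^esub> y \<in> S)"

definition gen_subalgebra :: "'k ring \<Rightarrow> ('k, 'a) module \<Rightarrow> 'a set \<Rightarrow> ('k, 'a) module" where
  "gen_subalgebra K A Y = A\<lparr>carrier := \<Inter>{S. subalgebra K A S \<and> Y \<subseteq> S}\<rparr>"


section \<open>The free nonassociative algebra and identities\<close>

text \<open>Nonassociative monomials in the symbols \<open>'x\<close>.\<close>

datatype 'x na_monomial = Sym 'x | Mul "'x na_monomial" "'x na_monomial"

text \<open>
  Elements are finitely supported families of coefficients. Every monomial that is not a symbol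
  splits in exactly one way as a product, so the bilinear extension of the product of monomials
  involves no sum.
\<close>

definition free_nalg :: "'k ring \<Rightarrow> ('k, 'x na_monomial \<Rightarrow> 'k) module" where
  "free_nalg K =
    \<lparr>carrier = {f. range f \<subseteq> carrier K \<and> finite {m. f m \<noteq> \<zero>\<^bsub>K\<^esub>}},
     mult = (\<lambda>f g m. case m of Sym x \<Rightarrow> \<zero>\<^bsub>K\<^esub> | Mul s t \<Rightarrow> f s \<otimes>\<^bsub>K\<^esub> g t),
     one = (\<lambda>m. \<zero>\<^bsub>K\<^esub>),
     zero = (\<lambda>m. \<zero>\<^bsub>K\<^esub>),
     add = (\<lambda>f g m. f m \<oplus>\<^bsub>K\<^esub> g m),
     smult = (\<lambda>a f m. a \<otimes>\<^bsub>K\<^esub> f m)\<rparr>"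

definition nvar :: "'k ring \<Rightarrow> 'x \<Rightarrow> 'x na_monomial \<Rightarrow> 'k" where
  "nvar K x = (\<lambda>m. if m = Sym x then \<one>\<^bsub>K\<^esub> else \<zero>\<^bsub>K\<^esub>)"

primrec eval_monomial :: "('k, 'a) module \<Rightarrow> ('x \<Rightarrow> 'a) \<Rightarrow> 'x na_monomial \<Rightarrow> 'a" where
  "eval_monomial A v (Sym x) = v x"
| "eval_monomial A v (Mul s t) = eval_monomial A v s \<otimes>\<^bsub>A\<^esub> eval_monomial A v t"

definition eval_na :: "'k ring \<Rightarrow> ('k, 'a) module \<Rightarrow> ('x \<Rightarrow> 'a) \<Rightarrow> ('x na_monomial \<Rightarrow> 'k) \<Rightarrow> 'a" where
  "eval_na K A v f = (\<Oplus>\<^bsub>A\<^esub>m \<in> {m. f m \<noteq> \<zero>\<^bsub>K\<^esub>}. f m \<odot>\<^bsub>A\<^esub> eval_monomial A v m)"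

definition satisfies :: "'k ring \<Rightarrow> ('k, 'a) module \<Rightarrow> ('x na_monomial \<Rightarrow> 'k) \<Rightarrow> bool" where
  "satisfies K A f \<longleftrightarrow> (\<forall>v. range v \<subseteq> carrier A \<longrightarrow> eval_na K A v f = \<zero>\<^bsub>A\<^esub>)"


section \<open>Varieties\<close>

text \<open>
  A variety of \<open>K\<close>-algebras is given by a set \<open>I\<close> of defining identities in the free nonassociative
  algebra on \<open>x\<^sub>0, x\<^sub>1, \<dots>\<close>.
\<close>

definition defining_identities :: "'k ring \<Rightarrow> (nat na_monomial \<Rightarrow> 'k) set \<Rightarrow> bool" where
  "defining_identities K I \<longleftrightarrow> I \<subseteq> carrier (free_nalg K)"

definition in_variety :: "'k ring \<Rightarrow> (nat na_monomial \<Rightarrow> 'k) set \<Rightarrow> ('k, 'a) module \<Rightarrow> bool" where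
  "in_variety K I A \<longleftrightarrow> nonassoc_algebra K A \<and> (\<forall>f\<in>I. satisfies K A f)"

text \<open>
  Statements about all algebras of a variety cannot quantify over types inside a formula. Both
  definitions below therefore quantify over the algebras carried by one type of sets of
  nonassociative polynomials. This type holds a copy of every algebra generated by a family
  indexed by the symbols (as residue classes of polynomials), hence nothing is lost: the lemmas
  \<open>variety_identity_all_types\<close>, \<open>free_alg_extension_all_types\<close> and
  \<open>free_alg_uniqueness_all_types\<close> below derive the same properties for algebras over an
  arbitrary type.
\<close>

definition variety_identity ::
    "'k ring \<Rightarrow> (nat na_monomial \<Rightarrow> 'k) set \<Rightarrow> (nat na_monomial \<Rightarrow> 'k) \<Rightarrow> bool" where
  "variety_identity K I f \<longleftrightarrow> f \<in> carrier (free_nalg K) \<and>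
     (\<forall>A :: ('k, (nat na_monomial \<Rightarrow> 'k) set) module. in_variety K I A \<longrightarrow> satisfies K A f)"

definition free_alg ::
    "'k ring \<Rightarrow> (nat na_monomial \<Rightarrow> 'k) set \<Rightarrow> ('k, 'a) module \<Rightarrow> 'a set \<Rightarrow> bool" where
  "free_alg K I A Y \<longleftrightarrow> in_variety K I A \<and> Y \<subseteq> carrier A \<and>
     (\<forall>B :: ('k, ('a na_monomial \<Rightarrow> 'k) set) module. in_variety K I B \<longrightarrow>
       (\<forall>g \<in> Y \<rightarrow> carrier B.
         \<exists>!h. h \<in> alg_hom K A B \<inter> extensional (carrier A) \<and> (\<forall>y\<in>Y. h y = g y)))"

primrec degree_in :: "'x \<Rightarrow> 'x na_monomial \<Rightarrow> nat" where
  "degree_in x (Sym y) = (if y = x then 1 else 0)"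
| "degree_in x (Mul s t) = degree_in x s + degree_in x t"

definition homogeneous_component ::
    "'k ring \<Rightarrow> ('x \<Rightarrow> nat) \<Rightarrow> ('x na_monomial \<Rightarrow> 'k) \<Rightarrow> ('x na_monomial \<Rightarrow> 'k)" where
  "homogeneous_component K d f = (\<lambda>m. if \<forall>x. degree_in x m = d x then f m else \<zero>\<^bsub>K\<^esub>)"

definition homogeneous_variety :: "'k ring \<Rightarrow> (nat na_monomial \<Rightarrow> 'k) set \<Rightarrow> bool" where
  "homogeneous_variety K I \<longleftrightarrow>
     (\<forall>f. variety_identity K I f \<longrightarrow> (\<forall>d. variety_identity K I (homogeneous_component K d f)))"

text \<open>
  The type argument \<open>'g\<close> controls how many free generators are covered at least: the type
  \<open>('g na_monomial \<Rightarrow> 'k) set\<close> holds a copy of every free algebra whose set of free generators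
  injects into \<open>'g\<close>; see the lemma \<open>schreier_variety_all_types\<close> below.
\<close>

definition schreier_variety ::
    "'g itself \<Rightarrow> 'k ring \<Rightarrow> (nat na_monomial \<Rightarrow> 'k) set \<Rightarrow> bool" where
  "schreier_variety _ K I \<longleftrightarrow>
     (\<forall>(A :: ('k, ('g na_monomial \<Rightarrow> 'k) set) module) Y S.
        free_alg K I A Y \<and> subalgebra K A S \<longrightarrow> (\<exists>Z. free_alg K I (A\<lparr>carrier := S\<rparr>) Z))"


section \<open>Extension of scalars\<close>

text \<open>A field extension is given by an embedding \<open>\<iota> \<in> ring_hom K F\<close> of fields.\<close>

definition restrict_scalars :: "('k \<Rightarrow> 'f) \<Rightarrow> ('f, 'a) module \<Rightarrow> ('k, 'a) module" where
  "restrict_scalars \<iota> A =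
    \<lparr>carrier = carrier A, mult = mult A, one = one A, zero = zero A, add = add A,
     smult = (\<lambda>a x. \<iota> a \<odot>\<^bsub>A\<^esub> x)\<rparr>"

definition extend_identities ::
    "('k \<Rightarrow> 'f) \<Rightarrow> ('x na_monomial \<Rightarrow> 'k) set \<Rightarrow> ('x na_monomial \<Rightarrow> 'f) set" where
  "extend_identities \<iota> I = (\<lambda>f. \<iota> \<circ> f) ` I"

text \<open>
  The type arguments are the types of the elements of the extension field and of the algebra.
\<close>

definition MLM_variety ::
    "'f itself \<Rightarrow> 'a itself \<Rightarrow> 'k ring \<Rightarrow> (nat na_monomial \<Rightarrow> 'k) set \<Rightarrow> bool" where
  "MLM_variety _ _ K I \<longleftrightarrow> homogeneous_variety K I \<and>
     (\<forall>(F :: 'f ring) \<iota> (A :: ('f, 'a) module) Y.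
        field F \<and> \<iota> \<in> ring_hom K F \<and> in_variety F (extend_identities \<iota> I) A \<and>
        Y \<subseteq> carrier A \<and> finite Y \<and> 2 \<le> card Y \<and>
        free_alg K I (gen_subalgebra K (restrict_scalars \<iota> A) Y) Y \<longrightarrow>
        free_alg F (extend_identities \<iota> I) (gen_subalgebra F A Y) Y)"


section \<open>Lie and anticommutative algebras\<close>

definition lie_identities :: "'k ring \<Rightarrow> (nat na_monomial \<Rightarrow> 'k) set" where
  "lie_identities K =
    (let P = free_nalg K; x\<^sub>1 = nvar K 1; x\<^sub>2 = nvar K 2; x\<^sub>3 = nvar K 3 in
     {x\<^sub>1 \<otimes>\<^bsub>P\<^esub> x\<^sub>1,
      (x\<^sub>1 \<otimes>\<^bsub>P\<^esub> x\<^sub>2) \<otimes>\<^bsub>P\<^esub> x\<^sub>3 \<oplus>\<^bsub>P\<^esub> (x\<^sub>2 \<otimes>\<^bsub>P\<^esub> x\<^sub>3) \<otimes>\<^bsub>P\<^esub> x\<^sub>1 \<oplus>\<^bsub>P\<^esub> (x\<^sub>3 \<otimes>\<^bsub>P\<^esub> x\<^sub>1) \<otimes>\<^bsub>P\<^esub> x\<^sub>2})"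

definition anticommutative_identities :: "'k ring \<Rightarrow> (nat na_monomial \<Rightarrow> 'k) set" where
  "anticommutative_identities K =
    (let P = free_nalg K; x\<^sub>1 = nvar K 1; x\<^sub>2 = nvar K 2 in
     {x\<^sub>1 \<otimes>\<^bsub>P\<^esub> x\<^sub>2 \<oplus>\<^bsub>P\<^esub> x\<^sub>2 \<otimes>\<^bsub>P\<^esub> x\<^sub>1})"


section \<open>Independence of the choice of types\<close>

subsection \<open>Evaluation and homomorphisms\<close>

lemma free_nalg_carrierD:
  assumes "f \<in> carrier (free_nalg K)"
  shows "f m \<in> carrier K" "finite {m. f m \<noteq> \<zero>\<^bsub>K\<^esub>}"
  using assms by (auto simp: free_nalg_def)

context nonassoc_algebra
begin

lemma eval_monomial_closed:
  assumes "range v \<subseteq> carrier A"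
  shows "eval_monomial A v m \<in> carrier A"
  using assms by (induction m) auto

lemma eval_na_superset:
  assumes f: "f \<in> carrier (free_nalg K)" and v: "range v \<subseteq> carrier A"
    and T: "finite T" "{m. f m \<noteq> \<zero>\<^bsub>K\<^esub>} \<subseteq> T"
  shows "eval_na K A v f = (\<Oplus>\<^bsub>A\<^esub>m \<in> T. f m \<odot>\<^bsub>A\<^esub> eval_monomial A v m)"
  unfolding eval_na_def
proof (rule M.add.finprod_mono_neutral_cong_left [OF T])
  show "f m \<odot>\<^bsub>A\<^esub> eval_monomial A v m = \<zero>\<^bsub>A\<^esub>" if "m \<in> T - {m. f m \<noteq> \<zero>\<^bsub>K\<^esub>}" for m
    using that eval_monomial_closed [OF v] by auto
qed (use free_nalg_carrierD(1) [OF f] eval_monomial_closed [OF v] in auto)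

lemma eval_na_closed:
  assumes f: "f \<in> carrier (free_nalg K)" and v: "range v \<subseteq> carrier A"
  shows "eval_na K A v f \<in> carrier A"
  unfolding eval_na_def
  by (rule M.finsum_closed) (use free_nalg_carrierD(1) [OF f] eval_monomial_closed [OF v] in auto)

lemma free_nalg_closed:
  shows "\<zero>\<^bsub>free_nalg K\<^esub> \<in> carrier (free_nalg K)"
    and "nvar K x \<in> carrier (free_nalg K)"
    and "\<lbrakk>f \<in> carrier (free_nalg K); g \<in> carrier (free_nalg K)\<rbrakk> \<Longrightarrow>
           f \<oplus>\<^bsub>free_nalg K\<^esub> g \<in> carrier (free_nalg K)"
    and "\<lbrakk>f \<in> carrier (free_nalg K); g \<in> carrier (free_nalg K)\<rbrakk> \<Longrightarrow>
           f \<otimes>\<^bsub>free_nalg K\<^esub> g \<in> carrier (free_nalg K)"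
    and "\<lbrakk>a \<in> carrier K; f \<in> carrier (free_nalg K)\<rbrakk> \<Longrightarrow>
           a \<odot>\<^bsub>free_nalg K\<^esub> f \<in> carrier (free_nalg K)"
proof -
  show "\<zero>\<^bsub>free_nalg K\<^esub> \<in> carrier (free_nalg K)"
    by (auto simp: free_nalg_def)
  show "nvar K x \<in> carrier (free_nalg K)"
    by (auto simp: free_nalg_def nvar_def)
next
  assume f: "f \<in> carrier (free_nalg K)" and g: "g \<in> carrier (free_nalg K)"
  note fg = free_nalg_carrierD [OF f] free_nalg_carrierD [OF g]
  have "finite {m. f m \<oplus>\<^bsub>K\<^esub> g m \<noteq> \<zero>\<^bsub>K\<^esub>}"
    by (rule finite_subset [of _ "{m. f m \<noteq> \<zero>\<^bsub>K\<^esub>} \<union> {m. g m \<noteq> \<zero>\<^bsub>K\<^esub>}"]) (use fg in auto)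
  then show "f \<oplus>\<^bsub>free_nalg K\<^esub> g \<in> carrier (free_nalg K)"
    using fg by (auto simp: free_nalg_def)
  have "finite {m. (case m of Sym x \<Rightarrow> \<zero>\<^bsub>K\<^esub> | Mul s t \<Rightarrow> f s \<otimes>\<^bsub>K\<^esub> g t) \<noteq> \<zero>\<^bsub>K\<^esub>}"
  proof (rule finite_subset)
    show "{m. (case m of Sym x \<Rightarrow> \<zero>\<^bsub>K\<^esub> | Mul s t \<Rightarrow> f s \<otimes>\<^bsub>K\<^esub> g t) \<noteq> \<zero>\<^bsub>K\<^esub>}
        \<subseteq> case_prod Mul ` ({m. f m \<noteq> \<zero>\<^bsub>K\<^esub>} \<times> {m. g m \<noteq> \<zero>\<^bsub>K\<^esub>})"
    proof
      fix m assume "m \<in> {m. (case m of Sym x \<Rightarrow> \<zero>\<^bsub>K\<^esub> | Mul s t \<Rightarrow> f s \<otimes>\<^bsub>K\<^esub> g t) \<noteq> \<zero>\<^bsub>K\<^esub>}"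
      with fg show "m \<in> case_prod Mul ` ({m. f m \<noteq> \<zero>\<^bsub>K\<^esub>} \<times> {m. g m \<noteq> \<zero>\<^bsub>K\<^esub>})"
        by (cases m) auto
    qed
  qed (use fg in auto)
  then show "f \<otimes>\<^bsub>free_nalg K\<^esub> g \<in> carrier (free_nalg K)"
    using fg by (auto simp: free_nalg_def split: na_monomial.splits)
next
  assume a: "a \<in> carrier K" and f: "f \<in> carrier (free_nalg K)"
  note f = free_nalg_carrierD [OF f]
  have "finite {m. a \<otimes>\<^bsub>K\<^esub> f m \<noteq> \<zero>\<^bsub>K\<^esub>}"
    by (rule finite_subset [OF _ f(2)]) (use a f in auto)
  then show "a \<odot>\<^bsub>free_nalg K\<^esub> f \<in> carrier (free_nalg K)"
    using a f by (auto simp: free_nalg_def)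
qed

lemma eval_na_zero: "eval_na K A v \<zero>\<^bsub>free_nalg K\<^esub> = \<zero>\<^bsub>A\<^esub>"
  by (simp add: eval_na_def free_nalg_def)

lemma eval_na_nvar:
  assumes v: "range v \<subseteq> carrier A"
  shows "eval_na K A v (nvar K x) = v x"
proof -
  have "eval_na K A v (nvar K x) = (\<Oplus>\<^bsub>A\<^esub>m \<in> {Sym x}. nvar K x m \<odot>\<^bsub>A\<^esub> eval_monomial A v m)"
    by (rule eval_na_superset [OF free_nalg_closed(2) v]) (auto simp: nvar_def)
  also have "\<dots> = v x"
    using rangeI [of v x, THEN subsetD [OF v]] by (simp add: nvar_def)
  finally show ?thesis .
qed

lemma eval_na_add:
  assumes f: "f \<in> carrier (free_nalg K)" and g: "g \<in> carrier (free_nalg K)"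
    and v: "range v \<subseteq> carrier A"
  shows "eval_na K A v (f \<oplus>\<^bsub>free_nalg K\<^esub> g) = eval_na K A v f \<oplus>\<^bsub>A\<^esub> eval_na K A v g"
proof -
  note fg = free_nalg_carrierD [OF f] free_nalg_carrierD [OF g]
  define T where "T = {m. f m \<noteq> \<zero>\<^bsub>K\<^esub>} \<union> {m. g m \<noteq> \<zero>\<^bsub>K\<^esub>}"
  have T: "finite T" using fg by (auto simp: T_def)
  have "eval_na K A v (f \<oplus>\<^bsub>free_nalg K\<^esub> g)
      = (\<Oplus>\<^bsub>A\<^esub>m \<in> T. (f \<oplus>\<^bsub>free_nalg K\<^esub> g) m \<odot>\<^bsub>A\<^esub> eval_monomial A v m)"
    by (rule eval_na_superset [OF free_nalg_closed(3) [OF f g] v T])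
      (use fg in \<open>auto simp: T_def free_nalg_def\<close>)
  also have "\<dots> = (\<Oplus>\<^bsub>A\<^esub>m \<in> T. f m \<odot>\<^bsub>A\<^esub> eval_monomial A v m \<oplus>\<^bsub>A\<^esub> g m \<odot>\<^bsub>A\<^esub> eval_monomial A v m)"
    by (rule M.finsum_cong')
      (use fg eval_monomial_closed [OF v] in \<open>auto simp: free_nalg_def smult_l_distr\<close>)
  also have "\<dots> = (\<Oplus>\<^bsub>A\<^esub>m \<in> T. f m \<odot>\<^bsub>A\<^esub> eval_monomial A v m) \<oplus>\<^bsub>A\<^esub>
                  (\<Oplus>\<^bsub>A\<^esub>m \<in> T. g m \<odot>\<^bsub>A\<^esub> eval_monomial A v m)"
    by (rule M.finsum_addf) (use fg eval_monomial_closed [OF v] in auto)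
  also have "\<dots> = eval_na K A v f \<oplus>\<^bsub>A\<^esub> eval_na K A v g"
    using eval_na_superset [OF f v T] eval_na_superset [OF g v T] by (auto simp: T_def)
  finally show ?thesis .
qed

lemma eval_na_smult:
  assumes a: "a \<in> carrier K" and f: "f \<in> carrier (free_nalg K)" and v: "range v \<subseteq> carrier A"
  shows "eval_na K A v (a \<odot>\<^bsub>free_nalg K\<^esub> f) = a \<odot>\<^bsub>A\<^esub> eval_na K A v f"
proof -
  note fc = free_nalg_carrierD [OF f]
  have "eval_na K A v (a \<odot>\<^bsub>free_nalg K\<^esub> f)
      = (\<Oplus>\<^bsub>A\<^esub>m \<in> {m. f m \<noteq> \<zero>\<^bsub>K\<^esub>}. (a \<odot>\<^bsub>free_nalg K\<^esub> f) m \<odot>\<^bsub>A\<^esub> eval_monomial A v m)"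
    by (rule eval_na_superset [OF free_nalg_closed(5) [OF a f] v fc(2)])
      (use a fc in \<open>auto simp: free_nalg_def\<close>)
  also have "\<dots> = (\<Oplus>\<^bsub>A\<^esub>m \<in> {m. f m \<noteq> \<zero>\<^bsub>K\<^esub>}. a \<odot>\<^bsub>A\<^esub> (f m \<odot>\<^bsub>A\<^esub> eval_monomial A v m))"
    by (rule M.finsum_cong')
      (use a fc eval_monomial_closed [OF v] in \<open>auto simp: free_nalg_def smult_assoc1\<close>)
  also have "\<dots> = a \<odot>\<^bsub>A\<^esub> eval_na K A v f"
    unfolding eval_na_def
    by (rule finsum_smult_ldistr [symmetric]) (use a fc eval_monomial_closed [OF v] in auto)
  finally show ?thesis .
qed

lemma zero_mult: "x \<in> carrier A \<Longrightarrow> \<zero>\<^bsub>A\<^esub> \<otimes>\<^bsub>A\<^esub> x = \<zero>\<^bsub>A\<^esub>"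
  using smult_mult_l [of "\<zero>\<^bsub>K\<^esub>" "\<zero>\<^bsub>A\<^esub>" x] by simp

lemma mult_zero: "x \<in> carrier A \<Longrightarrow> x \<otimes>\<^bsub>A\<^esub> \<zero>\<^bsub>A\<^esub> = \<zero>\<^bsub>A\<^esub>"
  using smult_mult_r [of "\<zero>\<^bsub>K\<^esub>" x "\<zero>\<^bsub>A\<^esub>"] by simp

lemma finsum_mult_left:
  assumes "finite S" "u \<in> S \<rightarrow> carrier A" "y \<in> carrier A"
  shows "(\<Oplus>\<^bsub>A\<^esub>s\<in>S. u s) \<otimes>\<^bsub>A\<^esub> y = (\<Oplus>\<^bsub>A\<^esub>s\<in>S. u s \<otimes>\<^bsub>A\<^esub> y)"
  using assms
proof (induction S rule: finite_induct)
  case empty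
  then show ?case by (simp add: zero_mult)
next
  case (insert s S)
  then have "u \<in> S \<rightarrow> carrier A" "u s \<in> carrier A" "(\<lambda>s. u s \<otimes>\<^bsub>A\<^esub> y) \<in> S \<rightarrow> carrier A"
    by auto
  with insert show ?case
    by (simp add: mult_l_distr)
qed

lemma finsum_mult_right:
  assumes "finite S" "u \<in> S \<rightarrow> carrier A" "y \<in> carrier A"
  shows "y \<otimes>\<^bsub>A\<^esub> (\<Oplus>\<^bsub>A\<^esub>s\<in>S. u s) = (\<Oplus>\<^bsub>A\<^esub>s\<in>S. y \<otimes>\<^bsub>A\<^esub> u s)"
  using assms
proof (induction S rule: finite_induct)
  case empty
  then show ?case by (simp add: mult_zero)
next
  case (insert s S)
  then have "u \<in> S \<rightarrow> carrier A" "u s \<in> carrier A" "(\<lambda>s. y \<otimes>\<^bsub>A\<^esub> u s) \<in> S \<rightarrow> carrier A"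
    by auto
  with insert show ?case
    by (simp add: mult_r_distr)
qed

lemma finsum_Times:
  assumes "finite S" "finite T" "w \<in> S \<times> T \<rightarrow> carrier A"
  shows "(\<Oplus>\<^bsub>A\<^esub>p\<in>S \<times> T. w p) = (\<Oplus>\<^bsub>A\<^esub>s\<in>S. \<Oplus>\<^bsub>A\<^esub>t\<in>T. w (s, t))"
  using assms(1,3)
proof (induction S rule: finite_induct)
  case empty
  then show ?case by simp
next
  case (insert s S)
  have w: "w \<in> S \<times> T \<rightarrow> carrier A" "w \<in> Pair s ` T \<rightarrow> carrier A"
    "\<And>s'. s' \<in> insert s S \<Longrightarrow> (\<lambda>t. w (s', t)) \<in> T \<rightarrow> carrier A"
    using insert.prems by auto
  have "insert s S \<times> T = Pair s ` T \<union> S \<times> T"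
    by auto
  moreover have "Pair s ` T \<inter> S \<times> T = {}"
    using insert by auto
  ultimately have "(\<Oplus>\<^bsub>A\<^esub>p\<in>insert s S \<times> T. w p) = (\<Oplus>\<^bsub>A\<^esub>p\<in>Pair s ` T. w p) \<oplus>\<^bsub>A\<^esub> (\<Oplus>\<^bsub>A\<^esub>p\<in>S \<times> T. w p)"
    using insert w assms(2) by (simp add: M.finsum_Un_disjoint)
  also have "(\<Oplus>\<^bsub>A\<^esub>p\<in>Pair s ` T. w p) = (\<Oplus>\<^bsub>A\<^esub>t\<in>T. w (s, t))"
    by (rule M.finsum_reindex [OF w(2)]) (auto simp: inj_on_def)
  finally show ?case
    using insert w assms(2) by simp
qed

lemma eval_na_mult:
  assumes f: "f \<in> carrier (free_nalg K)" and g: "g \<in> carrier (free_nalg K)"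
    and v: "range v \<subseteq> carrier A"
  shows "eval_na K A v (f \<otimes>\<^bsub>free_nalg K\<^esub> g) = eval_na K A v f \<otimes>\<^bsub>A\<^esub> eval_na K A v g"
proof -
  note fg = free_nalg_carrierD [OF f] free_nalg_carrierD [OF g]
  note e = eval_monomial_closed [OF v]
  define S T where "S = {m. f m \<noteq> \<zero>\<^bsub>K\<^esub>}" and "T = {m. g m \<noteq> \<zero>\<^bsub>K\<^esub>}"
  have fin: "finite S" "finite T" using fg by (auto simp: S_def T_def)
  let ?M = "\<lambda>(s, t). Mul s t"
  let ?u = "\<lambda>s. f s \<odot>\<^bsub>A\<^esub> eval_monomial A v s" and ?w = "\<lambda>t. g t \<odot>\<^bsub>A\<^esub> eval_monomial A v t"
  have "eval_na K A v (f \<otimes>\<^bsub>free_nalg K\<^esub> g)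
      = (\<Oplus>\<^bsub>A\<^esub>m \<in> ?M ` (S \<times> T). (f \<otimes>\<^bsub>free_nalg K\<^esub> g) m \<odot>\<^bsub>A\<^esub> eval_monomial A v m)"
  proof (rule eval_na_superset [OF free_nalg_closed(4) [OF f g] v])
    show "{m. (f \<otimes>\<^bsub>free_nalg K\<^esub> g) m \<noteq> \<zero>\<^bsub>K\<^esub>} \<subseteq> ?M ` (S \<times> T)"
    proof
      fix m assume "m \<in> {m. (f \<otimes>\<^bsub>free_nalg K\<^esub> g) m \<noteq> \<zero>\<^bsub>K\<^esub>}"
      with fg show "m \<in> ?M ` (S \<times> T)"
        by (cases m) (auto simp: S_def T_def free_nalg_def)
    qed
  qed (use fin in auto)
  also have "\<dots> = (\<Oplus>\<^bsub>A\<^esub>p \<in> S \<times> T. (f \<otimes>\<^bsub>free_nalg K\<^esub> g) (?M p) \<odot>\<^bsub>A\<^esub> eval_monomial A v (?M p))"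
  proof (rule M.finsum_reindex)
    show "(\<lambda>m. (f \<otimes>\<^bsub>free_nalg K\<^esub> g) m \<odot>\<^bsub>A\<^esub> eval_monomial A v m) \<in> ?M ` (S \<times> T) \<rightarrow> carrier A"
      using e free_nalg_carrierD(1) [OF free_nalg_closed(4) [OF f g]] by auto
  qed (auto simp: inj_on_def)
  also have "\<dots> = (\<Oplus>\<^bsub>A\<^esub>p \<in> S \<times> T. ?u (fst p) \<otimes>\<^bsub>A\<^esub> ?w (snd p))"
  proof (rule M.finsum_cong' [OF refl])
    fix p assume "p \<in> S \<times> T"
    show "(f \<otimes>\<^bsub>free_nalg K\<^esub> g) (?M p) \<odot>\<^bsub>A\<^esub> eval_monomial A v (?M p) = ?u (fst p) \<otimes>\<^bsub>A\<^esub> ?w (snd p)"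
    proof (cases p)
      case (Pair s t)
      have "?u s \<otimes>\<^bsub>A\<^esub> ?w t = f s \<odot>\<^bsub>A\<^esub> (eval_monomial A v s \<otimes>\<^bsub>A\<^esub> ?w t)"
        using fg e by (intro smult_mult_l) auto
      also have "eval_monomial A v s \<otimes>\<^bsub>A\<^esub> ?w t = g t \<odot>\<^bsub>A\<^esub> eval_monomial A v (Mul s t)"
        using fg e by (simp add: smult_mult_r)
      finally show ?thesis
        using fg e Pair by (simp add: free_nalg_def smult_assoc1)
    qed
  qed (use fg e in auto)
  also have "\<dots> = (\<Oplus>\<^bsub>A\<^esub>s\<in>S. \<Oplus>\<^bsub>A\<^esub>t\<in>T. ?u s \<otimes>\<^bsub>A\<^esub> ?w t)"
    by (subst finsum_Times [OF fin]) (use fg e in auto)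
  also have "\<dots> = (\<Oplus>\<^bsub>A\<^esub>s\<in>S. ?u s \<otimes>\<^bsub>A\<^esub> (\<Oplus>\<^bsub>A\<^esub>t\<in>T. ?w t))"
  proof (rule M.finsum_cong' [OF refl])
    show "(\<lambda>s. ?u s \<otimes>\<^bsub>A\<^esub> (\<Oplus>\<^bsub>A\<^esub>t\<in>T. ?w t)) \<in> S \<rightarrow> carrier A"
      using fg e by (auto intro!: M.finsum_closed)
  qed (use fg e fin in \<open>auto intro!: finsum_mult_right [symmetric]\<close>)
  also have "\<dots> = (\<Oplus>\<^bsub>A\<^esub>s\<in>S. ?u s) \<otimes>\<^bsub>A\<^esub> (\<Oplus>\<^bsub>A\<^esub>t\<in>T. ?w t)"
    by (rule finsum_mult_left [symmetric]) (use fg e fin in \<open>auto intro!: M.finsum_closed\<close>)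
  finally show ?thesis
    by (simp add: eval_na_def S_def T_def)
qed

lemma subalgebraI:
  assumes "S \<subseteq> carrier A" "\<zero>\<^bsub>A\<^esub> \<in> S"
    and "\<And>x y. \<lbrakk>x \<in> S; y \<in> S\<rbrakk> \<Longrightarrow> x \<oplus>\<^bsub>A\<^esub> y \<in> S"
    and "\<And>x y. \<lbrakk>x \<in> S; y \<in> S\<rbrakk> \<Longrightarrow> x \<otimes>\<^bsub>A\<^esub> y \<in> S"
    and "\<And>a x. \<lbrakk>a \<in> carrier K; x \<in> S\<rbrakk> \<Longrightarrow> a \<odot>\<^bsub>A\<^esub> x \<in> S"
  shows "subalgebra K A S"
  unfolding subalgebra_def
proof (intro conjI submoduleI ballI)
  fix x assume x: "x \<in> S"
  have "\<ominus>\<^bsub>A\<^esub> x = (\<ominus>\<^bsub>K\<^esub> \<one>\<^bsub>K\<^esub>) \<odot>\<^bsub>A\<^esub> x"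
    using x assms(1) smult_l_minus [of "\<one>\<^bsub>K\<^esub>" x] by auto
  then show "\<ominus>\<^bsub>A\<^esub> x \<in> S"
    using x assms(5) by simp
qed (use assms in auto)

lemma subalgebraD:
  assumes "subalgebra K A S"
  shows "S \<subseteq> carrier A" "\<zero>\<^bsub>A\<^esub> \<in> S"
    and "\<And>x y. \<lbrakk>x \<in> S; y \<in> S\<rbrakk> \<Longrightarrow> x \<oplus>\<^bsub>A\<^esub> y \<in> S"
    and "\<And>x y. \<lbrakk>x \<in> S; y \<in> S\<rbrakk> \<Longrightarrow> x \<otimes>\<^bsub>A\<^esub> y \<in> S"
    and "\<And>a x. \<lbrakk>a \<in> carrier K; x \<in> S\<rbrakk> \<Longrightarrow> a \<odot>\<^bsub>A\<^esub> x \<in> S"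
proof -
  have S: "submodule S K A" and m: "\<forall>x\<in>S. \<forall>y\<in>S. x \<otimes>\<^bsub>A\<^esub> y \<in> S"
    using assms by (auto simp: subalgebra_def)
  show sub: "S \<subseteq> carrier A" and
    "\<And>x y. \<lbrakk>x \<in> S; y \<in> S\<rbrakk> \<Longrightarrow> x \<oplus>\<^bsub>A\<^esub> y \<in> S"
    "\<And>a x. \<lbrakk>a \<in> carrier K; x \<in> S\<rbrakk> \<Longrightarrow> a \<odot>\<^bsub>A\<^esub> x \<in> S"
    using submoduleE [OF S] by auto
  show "\<And>x y. \<lbrakk>x \<in> S; y \<in> S\<rbrakk> \<Longrightarrow> x \<otimes>\<^bsub>A\<^esub> y \<in> S"
    using m by auto
  show "\<zero>\<^bsub>A\<^esub> \<in> S"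
    using subgroup.one_closed [OF submodule.axioms(1) [OF S]] by simp
qed

lemma subalgebra_eval_image:
  assumes v: "range v \<subseteq> carrier A"
  shows "subalgebra K A (eval_na K A v ` carrier (free_nalg K))"
proof (rule subalgebraI)
  show "eval_na K A v ` carrier (free_nalg K) \<subseteq> carrier A"
    using eval_na_closed [OF _ v] by auto
  show "\<zero>\<^bsub>A\<^esub> \<in> eval_na K A v ` carrier (free_nalg K)"
    by (rule image_eqI [where x = "\<zero>\<^bsub>free_nalg K\<^esub>"]) (auto simp: eval_na_zero free_nalg_closed)
qed (blast intro: eval_na_add [OF _ _ v, symmetric] eval_na_mult [OF _ _ v, symmetric]
       eval_na_smult [OF _ _ v, symmetric] free_nalg_closed(3-5))+

end

lemma alg_homD:
  assumes "h \<in> alg_hom K A B"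
  shows "x \<in> carrier A \<Longrightarrow> h x \<in> carrier B"
    and "\<lbrakk>x \<in> carrier A; y \<in> carrier A\<rbrakk> \<Longrightarrow> h (x \<oplus>\<^bsub>A\<^esub> y) = h x \<oplus>\<^bsub>B\<^esub> h y"
    and "\<lbrakk>x \<in> carrier A; y \<in> carrier A\<rbrakk> \<Longrightarrow> h (x \<otimes>\<^bsub>A\<^esub> y) = h x \<otimes>\<^bsub>B\<^esub> h y"
    and "\<lbrakk>a \<in> carrier K; x \<in> carrier A\<rbrakk> \<Longrightarrow> h (a \<odot>\<^bsub>A\<^esub> x) = a \<odot>\<^bsub>B\<^esub> h x"
  using assms by (auto simp: alg_hom_def)

lemma alg_hom_comp:
  assumes "h \<in> alg_hom K A B" "k \<in> alg_hom K B C"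
  shows "(\<lambda>x. k (h x)) \<in> alg_hom K A C"
  using alg_homD [OF assms(1)] alg_homD [OF assms(2)] by (auto simp: alg_hom_def)

lemma alg_hom_restrict:
  assumes "nonassoc_algebra K A" "h \<in> alg_hom K A B"
  shows "restrict h (carrier A) \<in> alg_hom K A B"
proof -
  interpret nonassoc_algebra K A by fact
  show ?thesis
    using alg_homD [OF assms(2)] by (auto simp: alg_hom_def)
qed

lemma alg_hom_zero:
  assumes "nonassoc_algebra K A" "nonassoc_algebra K B" "h \<in> alg_hom K A B"
  shows "h \<zero>\<^bsub>A\<^esub> = \<zero>\<^bsub>B\<^esub>"
proof -
  interpret A: nonassoc_algebra K A by fact
  interpret B: nonassoc_algebra K B by fact
  have "h (\<zero>\<^bsub>K\<^esub> \<odot>\<^bsub>A\<^esub> \<zero>\<^bsub>A\<^esub>) = \<zero>\<^bsub>K\<^esub> \<odot>\<^bsub>B\<^esub> h \<zero>\<^bsub>A\<^esub>"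
    by (rule alg_homD(4) [OF assms(3)]) auto
  then show ?thesis
    using alg_homD(1) [OF assms(3), of "\<zero>\<^bsub>A\<^esub>"] by simp
qed

lemma alg_hom_eval_na:
  assumes A: "nonassoc_algebra K A" and B: "nonassoc_algebra K B" and h: "h \<in> alg_hom K A B"
    and f: "f \<in> carrier (free_nalg K)" and v: "range v \<subseteq> carrier A"
  shows "h (eval_na K A v f) = eval_na K B (\<lambda>x. h (v x)) f"
proof -
  interpret A: nonassoc_algebra K A by fact
  interpret B: nonassoc_algebra K B by fact
  note hD = alg_homD [OF h]
  note fc = free_nalg_carrierD [OF f]
  note e = A.eval_monomial_closed [OF v]
  have m: "h (eval_monomial A v m) = eval_monomial B (\<lambda>x. h (v x)) m" for m
    by (induction m) (auto simp: hD e)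
  have "h (\<Oplus>\<^bsub>A\<^esub>m\<in>T. f m \<odot>\<^bsub>A\<^esub> eval_monomial A v m)
      = (\<Oplus>\<^bsub>B\<^esub>m\<in>T. f m \<odot>\<^bsub>B\<^esub> eval_monomial B (\<lambda>x. h (v x)) m)" if "finite T" for T
    using that
  proof (induction T rule: finite_induct)
    case empty
    then show ?case using alg_hom_zero [OF A B h] by simp
  next
    case (insert n T)
    let ?a = "\<lambda>m. f m \<odot>\<^bsub>A\<^esub> eval_monomial A v m"
    let ?b = "\<lambda>m. f m \<odot>\<^bsub>B\<^esub> eval_monomial B (\<lambda>x. h (v x)) m"
    have a: "?a m \<in> carrier A" for m using fc e by auto
    have b: "?b m = h (?a m)" for m using fc e by (simp add: hD m)
    have b': "?b m \<in> carrier B" for m unfolding b using hD(1) a by blast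
    have "h (finsum A ?a (insert n T)) = h (?a n \<oplus>\<^bsub>A\<^esub> finsum A ?a T)"
      using insert a by (subst A.M.finsum_insert) auto
    also have "\<dots> = h (?a n) \<oplus>\<^bsub>B\<^esub> h (finsum A ?a T)"
      using a by (intro hD) (auto intro: A.M.finsum_closed)
    also have "\<dots> = ?b n \<oplus>\<^bsub>B\<^esub> finsum B ?b T"
      using insert.IH b by simp
    also have "\<dots> = finsum B ?b (insert n T)"
      using insert b' by (subst B.M.finsum_insert) auto
    finally show ?case .
  qed
  with fc show ?thesis by (simp add: eval_na_def)
qed


subsection \<open>Subalgebras and isomorphic copies\<close>

lemma nonassoc_algebra_via_inj:
  assumes "nonassoc_algebra K C" and h: "h \<in> alg_hom K B C" and inj: "inj_on h (carrier B)"
    and zero: "\<zero>\<^bsub>B\<^esub> \<in> carrier B" "h \<zero>\<^bsub>B\<^esub> = \<zero>\<^bsub>C\<^esub>"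
    and add: "\<And>x y. \<lbrakk>x \<in> carrier B; y \<in> carrier B\<rbrakk> \<Longrightarrow> x \<oplus>\<^bsub>B\<^esub> y \<in> carrier B"
    and mult: "\<And>x y. \<lbrakk>x \<in> carrier B; y \<in> carrier B\<rbrakk> \<Longrightarrow> x \<otimes>\<^bsub>B\<^esub> y \<in> carrier B"
    and smult: "\<And>a x. \<lbrakk>a \<in> carrier K; x \<in> carrier B\<rbrakk> \<Longrightarrow> a \<odot>\<^bsub>B\<^esub> x \<in> carrier B"
  shows "nonassoc_algebra K B"
proof -
  interpret nonassoc_algebra K C by fact
  note hD = alg_homD [OF h]
  note cl = zero(1) add mult smult
  have eq: "x = y" if "h x = h y" "x \<in> carrier B" "y \<in> carrier B" for x y
    using inj that by (auto dest: inj_onD)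
  have "abelian_group B"
  proof (rule abelian_groupI)
    fix x assume x: "x \<in> carrier B"
    have "(\<ominus>\<^bsub>K\<^esub> \<one>\<^bsub>K\<^esub>) \<odot>\<^bsub>B\<^esub> x \<oplus>\<^bsub>B\<^esub> x = \<zero>\<^bsub>B\<^esub>"
      by (rule eq) (use x in \<open>auto simp: hD cl zero smult_l_minus M.l_neg\<close>)
    then show "\<exists>y\<in>carrier B. y \<oplus>\<^bsub>B\<^esub> x = \<zero>\<^bsub>B\<^esub>"
      using x by (intro bexI [of _ "(\<ominus>\<^bsub>K\<^esub> \<one>\<^bsub>K\<^esub>) \<odot>\<^bsub>B\<^esub> x"]) (auto simp: cl)
  next
    fix x y z assume "x \<in> carrier B" "y \<in> carrier B" "z \<in> carrier B"
    then show "(x \<oplus>\<^bsub>B\<^esub> y) \<oplus>\<^bsub>B\<^esub> z = x \<oplus>\<^bsub>B\<^esub> (y \<oplus>\<^bsub>B\<^esub> z)"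
      by (intro eq) (auto simp: hD cl M.a_assoc)
  next
    fix x y assume "x \<in> carrier B" "y \<in> carrier B"
    then show "x \<oplus>\<^bsub>B\<^esub> y = y \<oplus>\<^bsub>B\<^esub> x"
      by (intro eq) (auto simp: hD cl M.a_comm)
  next
    fix x assume "x \<in> carrier B"
    then show "\<zero>\<^bsub>B\<^esub> \<oplus>\<^bsub>B\<^esub> x = x"
      by (intro eq) (auto simp: hD cl zero)
  qed (auto simp: cl)
  then have "Module.module K B"
    by (rule moduleI [OF R.is_cring])
      (auto intro!: eq simp: hD cl smult_l_distr smult_r_distr smult_assoc1)
  then show ?thesis
    by (intro nonassoc_algebra.intro nonassoc_algebra_axioms.intro field_axioms)
      (auto intro!: eq simp: hD cl mult_l_distr mult_r_distr smult_mult_l smult_mult_r)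
qed

lemma in_variety_via_inj:
  assumes I: "defining_identities K I" and C: "in_variety K I C"
    and B: "nonassoc_algebra K B" and h: "h \<in> alg_hom K B C" and inj: "inj_on h (carrier B)"
  shows "in_variety K I B"
proof -
  have C': "nonassoc_algebra K C" using C by (simp add: in_variety_def)
  interpret B: nonassoc_algebra K B by fact
  show ?thesis
    unfolding in_variety_def satisfies_def
  proof (intro conjI ballI allI impI B)
    fix f v assume f: "f \<in> I" and v: "range (v :: nat \<Rightarrow> _) \<subseteq> carrier B"
    have f': "f \<in> carrier (free_nalg K)" using f I by (auto simp: defining_identities_def)
    have "range (\<lambda>x. h (v x)) \<subseteq> carrier C"
      using v alg_homD(1) [OF h] by auto
    then have "eval_na K C (\<lambda>x. h (v x)) f = \<zero>\<^bsub>C\<^esub>"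
      using C f by (auto simp: in_variety_def satisfies_def)
    then have "h (eval_na K B v f) = h \<zero>\<^bsub>B\<^esub>"
      by (simp add: alg_hom_eval_na [OF B C' h f' v] alg_hom_zero [OF B C' h])
    then show "eval_na K B v f = \<zero>\<^bsub>B\<^esub>"
      by (rule inj_onD [OF inj]) (use B.eval_na_closed [OF f' v] in auto)
  qed
qed

lemma subalgebra_in_variety:
  assumes I: "defining_identities K I" and A: "in_variety K I A" and S: "subalgebra K A S"
  shows "in_variety K I (A\<lparr>carrier := S\<rparr>)" "(\<lambda>x. x) \<in> alg_hom K (A\<lparr>carrier := S\<rparr>) A"
proof -
  have A': "nonassoc_algebra K A" using A by (simp add: in_variety_def)
  note SD = nonassoc_algebra.subalgebraD [OF A' S]
  show h: "(\<lambda>x. x) \<in> alg_hom K (A\<lparr>carrier := S\<rparr>) A"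
    using SD(1) by (auto simp: alg_hom_def)
  have "nonassoc_algebra K (A\<lparr>carrier := S\<rparr>)"
    by (rule nonassoc_algebra_via_inj [OF A' h]) (auto simp: SD)
  then show "in_variety K I (A\<lparr>carrier := S\<rparr>)"
    by (rule in_variety_via_inj [OF I A _ h]) auto
qed

definition copy_alg :: "('a \<Rightarrow> 'b) \<Rightarrow> ('k, 'a) module \<Rightarrow> ('k, 'b) module" where
  "copy_alg \<phi> A = (let \<psi> = inv_into (carrier A) \<phi> in
    \<lparr>carrier = \<phi> ` carrier A,
     mult = (\<lambda>x y. \<phi> (\<psi> x \<otimes>\<^bsub>A\<^esub> \<psi> y)), one = \<phi> \<zero>\<^bsub>A\<^esub>, zero = \<phi> \<zero>\<^bsub>A\<^esub>,
     add = (\<lambda>x y. \<phi> (\<psi> x \<oplus>\<^bsub>A\<^esub> \<psi> y)), smult = (\<lambda>a x. \<phi> (a \<odot>\<^bsub>A\<^esub> \<psi> x))\<rparr>)"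

lemma copy_alg:
  assumes I: "defining_identities K I" and A: "in_variety K I A" and inj: "inj_on \<phi> (carrier A)"
  shows "in_variety K I (copy_alg \<phi> A)" "\<phi> \<in> alg_hom K A (copy_alg \<phi> A)"
    and "inv_into (carrier A) \<phi> \<in> alg_hom K (copy_alg \<phi> A) A"
    and "carrier (copy_alg \<phi> A) = \<phi> ` carrier A"
proof -
  have A': "nonassoc_algebra K A" using A by (simp add: in_variety_def)
  interpret nonassoc_algebra K A by fact
  let ?\<psi> = "inv_into (carrier A) \<phi>"
  have inv: "?\<psi> (\<phi> x) = x" if "x \<in> carrier A" for x
    using inj that by simp
  show \<psi>: "?\<psi> \<in> alg_hom K (copy_alg \<phi> A) A"
    by (auto simp: alg_hom_def copy_alg_def inv Let_def)
  show "\<phi> \<in> alg_hom K A (copy_alg \<phi> A)"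
    by (auto simp: alg_hom_def copy_alg_def inv Let_def)
  show "carrier (copy_alg \<phi> A) = \<phi> ` carrier A"
    by (simp add: copy_alg_def Let_def)
  have i: "inj_on ?\<psi> (carrier (copy_alg \<phi> A))"
    by (auto simp: copy_alg_def Let_def intro: inj_on_inv_into)
  have "nonassoc_algebra K (copy_alg \<phi> A)"
    by (rule nonassoc_algebra_via_inj [OF A' \<psi> i]) (auto simp: copy_alg_def Let_def inv)
  then show "in_variety K I (copy_alg \<phi> A)"
    by (rule in_variety_via_inj [OF I A _ \<psi> i])
qed


subsection \<open>Universal properties over arbitrary types\<close>

text \<open>
  Every subalgebra generated by a family indexed by \<open>'x\<close> embeds into the type of sets of
  nonassociative polynomials over \<open>'x\<close>.
\<close>

lemma inj_on_eval_fibres: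
  "inj_on (\<lambda>c. {p \<in> carrier (free_nalg K). eval_na K A v p = c})
     (eval_na K A v ` carrier (free_nalg K))"
  by (rule inj_onI) blast

lemma variety_identity_all_types:
  fixes A :: "('k, 'a) module"
  assumes I: "defining_identities K I" and f: "variety_identity K I f" and A: "in_variety K I A"
  shows "satisfies K A f"
  unfolding satisfies_def
proof (intro allI impI)
  fix v :: "nat \<Rightarrow> 'a" assume v: "range v \<subseteq> carrier A"
  have A': "nonassoc_algebra K A" using A by (simp add: in_variety_def)
  interpret A: nonassoc_algebra K A by fact
  have fc: "f \<in> carrier (free_nalg K)" using f by (simp add: variety_identity_def)
  define S where "S = eval_na K A v ` carrier (free_nalg K)"
  have S: "subalgebra K A S" unfolding S_def by (rule A.subalgebra_eval_image [OF v])
  note B = subalgebra_in_variety [OF I A S]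
  let ?B = "A\<lparr>carrier := S\<rparr>"
  have B': "nonassoc_algebra K ?B" using B by (simp add: in_variety_def)
  define \<phi> where "\<phi> = (\<lambda>c. {p \<in> carrier (free_nalg K). eval_na K A v p = c})"
  have inj: "inj_on \<phi> (carrier ?B)" unfolding \<phi>_def S_def using inj_on_eval_fibres by simp
  note C = copy_alg [OF I B(1) inj]
  have C': "nonassoc_algebra K (copy_alg \<phi> ?B)" using C(1) by (simp add: in_variety_def)
  have "v x \<in> S" for x
    unfolding S_def by (rule image_eqI [where x = "nvar K x"]) (auto simp: A.eval_na_nvar [OF v] A.free_nalg_closed)
  then have vB: "range v \<subseteq> carrier ?B" by auto
  then have "range (\<lambda>x. \<phi> (v x)) \<subseteq> carrier (copy_alg \<phi> ?B)"
    by (auto simp: C(4))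
  then have "eval_na K (copy_alg \<phi> ?B) (\<lambda>x. \<phi> (v x)) f = \<zero>\<^bsub>copy_alg \<phi> ?B\<^esub>"
    using f C(1) by (auto simp: variety_identity_def satisfies_def)
  then have "\<phi> (eval_na K ?B v f) = \<phi> \<zero>\<^bsub>?B\<^esub>"
    using alg_hom_eval_na [OF B' C' C(2) fc vB] alg_hom_zero [OF B' C' C(2)] by simp
  moreover have "eval_na K ?B v f \<in> carrier ?B" "\<zero>\<^bsub>?B\<^esub> \<in> carrier ?B"
    using nonassoc_algebra.eval_na_closed [OF B' fc vB] A.subalgebraD(2) [OF S] by auto
  ultimately have "eval_na K ?B v f = \<zero>\<^bsub>?B\<^esub>"
    by (rule inj_onD [OF inj])
  then show "eval_na K A v f = \<zero>\<^bsub>A\<^esub>"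
    using alg_hom_eval_na [OF B' A' B(2) fc vB] by simp
qed

lemma free_algD:
  fixes A :: "('k, 'a) module" and B :: "('k, ('a na_monomial \<Rightarrow> 'k) set) module"
  assumes "free_alg K I A Y" "in_variety K I B" "g \<in> Y \<rightarrow> carrier B"
  shows "\<exists>!h. h \<in> alg_hom K A B \<inter> extensional (carrier A) \<and> (\<forall>y\<in>Y. h y = g y)"
  using assms unfolding free_alg_def by simp

lemma free_alg_extension_all_types:
  fixes A :: "('k, 'a) module" and B :: "('k, 'b) module"
  assumes I: "defining_identities K I" and free: "free_alg K I A Y" and B: "in_variety K I B"
    and g: "g \<in> Y \<rightarrow> carrier B"
  shows "\<exists>h \<in> alg_hom K A B. \<forall>y\<in>Y. h y = g y"
proof -
  have B': "nonassoc_algebra K B" using B by (simp add: in_variety_def)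
  interpret B: nonassoc_algebra K B by fact
  define v where "v y = (if y \<in> Y then g y else \<zero>\<^bsub>B\<^esub>)" for y
  have v: "range v \<subseteq> carrier B" using g by (auto simp: v_def)
  define S where "S = eval_na K B v ` carrier (free_nalg K)"
  have S: "subalgebra K B S" unfolding S_def by (rule B.subalgebra_eval_image [OF v])
  note C = subalgebra_in_variety [OF I B S]
  let ?C = "B\<lparr>carrier := S\<rparr>"
  define \<phi> where "\<phi> = (\<lambda>c. {p \<in> carrier (free_nalg K). eval_na K B v p = c})"
  have inj: "inj_on \<phi> (carrier ?C)" unfolding \<phi>_def S_def using inj_on_eval_fibres by simp
  note D = copy_alg [OF I C(1) inj]
  have vS: "v y \<in> S" for y
    unfolding S_def by (rule image_eqI [where x = "nvar K y"]) (auto simp: B.eval_na_nvar [OF v] B.free_nalg_closed)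
  have "(\<lambda>y. \<phi> (v y)) \<in> Y \<rightarrow> carrier (copy_alg \<phi> ?C)"
    using vS by (auto simp: D(4))
  from ex1_implies_ex [OF free_algD [OF free D(1) this]]
  obtain h where "h \<in> alg_hom K A (copy_alg \<phi> ?C) \<inter> extensional (carrier A)"
    and hY: "\<forall>y\<in>Y. h y = \<phi> (v y)"
    by (elim exE conjE)
  then have h: "h \<in> alg_hom K A (copy_alg \<phi> ?C)"
    by (elim IntD1)
  let ?h = "\<lambda>x. inv_into (carrier ?C) \<phi> (h x)"
  have "?h \<in> alg_hom K A B"
    using alg_hom_comp [OF alg_hom_comp [OF h D(3)] C(2)] by simp
  moreover have "?h y = g y" if "y \<in> Y" for y
  proof -
    have "?h y = inv_into (carrier ?C) \<phi> (\<phi> (v y))" using bspec [OF hY that] by (rule arg_cong)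
    also have "\<dots> = v y" using vS by (intro inv_into_f_f [OF inj]) simp
    finally show ?thesis using that by (simp add: v_def)
  qed
  ultimately show ?thesis by (intro bexI [where x = ?h] ballI)
qed

lemma free_alg_generated:
  fixes A :: "('k, 'a) module"
  assumes I: "defining_identities K I" and free: "free_alg K I A Y"
    and S: "subalgebra K A S" "Y \<subseteq> S"
  shows "S = carrier A"
proof -
  have A: "in_variety K I A" and Y: "Y \<subseteq> carrier A" using free by (auto simp: free_alg_def)
  have A': "nonassoc_algebra K A" using A by (simp add: in_variety_def)
  interpret A: nonassoc_algebra K A by fact
  note B = subalgebra_in_variety [OF I A S(1)]
  obtain r where r: "r \<in> alg_hom K A (A\<lparr>carrier := S\<rparr>)" "\<forall>y\<in>Y. r y = y"
    using free_alg_extension_all_types [OF I free B(1), of "\<lambda>y. y"] S(2) by auto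
  have r': "r \<in> alg_hom K A A"
    using alg_hom_comp [OF r(1) B(2)] by simp
  define \<phi> :: "'a \<Rightarrow> ('a na_monomial \<Rightarrow> 'k) set" where "\<phi> x = {nvar K x}" for x
  have "nvar K x \<noteq> nvar K y" if "x \<noteq> y" for x y :: 'a
  proof
    assume "nvar K x = nvar K y"
    then have "nvar K x (Sym x) = nvar K y (Sym x)" by simp
    then show False using that by (simp add: nvar_def)
  qed
  then have inj: "inj_on \<phi> (carrier A)"
    by (auto simp: inj_on_def \<phi>_def)
  note C = copy_alg [OF I A inj]
  let ?h1 = "restrict (\<lambda>x. \<phi> (r x)) (carrier A)" and ?h2 = "restrict \<phi> (carrier A)"
  have h: "?h1 \<in> alg_hom K A (copy_alg \<phi> A) \<inter> extensional (carrier A)"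
    "?h2 \<in> alg_hom K A (copy_alg \<phi> A) \<inter> extensional (carrier A)"
    using alg_hom_restrict [OF A' alg_hom_comp [OF r' C(2)]] alg_hom_restrict [OF A' C(2)] by auto
  have "\<forall>y\<in>Y. ?h1 y = \<phi> y" "\<forall>y\<in>Y. ?h2 y = \<phi> y"
    using r(2) Y by auto
  moreover have \<phi>: "\<phi> \<in> Y \<rightarrow> carrier (copy_alg \<phi> A)"
    using Y by (auto simp: C(4))
  ultimately have "?h1 = ?h2"
    using ex1E [OF free_algD [OF free C(1) \<phi>], of "?h1 = ?h2"] h by metis
  then have "r x = x" if "x \<in> carrier A" for x
  proof -
    have "\<phi> (r x) = \<phi> x"
      using fun_cong [OF \<open>?h1 = ?h2\<close>, of x] that by simp
    then show ?thesis
      using inj that alg_homD(1) [OF r'] by (auto dest: inj_onD)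
  qed
  then have "carrier A \<subseteq> S"
    using alg_homD(1) [OF r(1)] by fastforce
  then show ?thesis
    using A.subalgebraD(1) [OF S(1)] by auto
qed

lemma free_alg_uniqueness_all_types:
  fixes A :: "('k, 'a) module" and B :: "('k, 'b) module"
  assumes I: "defining_identities K I" and free: "free_alg K I A Y" and B: "in_variety K I B"
    and h1: "h1 \<in> alg_hom K A B" and h2: "h2 \<in> alg_hom K A B" and eq: "\<forall>y\<in>Y. h1 y = h2 y"
    and x: "x \<in> carrier A"
  shows "h1 x = h2 x"
proof -
  have A': "nonassoc_algebra K A" and B': "nonassoc_algebra K B" and Y: "Y \<subseteq> carrier A"
    using free B by (auto simp: free_alg_def in_variety_def)
  interpret A: nonassoc_algebra K A by fact
  interpret B: nonassoc_algebra K B by fact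
  have "subalgebra K A {x \<in> carrier A. h1 x = h2 x}"
    by (rule A.subalgebraI)
      (auto simp: alg_homD [OF h1] alg_homD [OF h2] alg_hom_zero [OF A' B' h1] alg_hom_zero [OF A' B' h2])
  then have "{x \<in> carrier A. h1 x = h2 x} = carrier A"
    by (rule free_alg_generated [OF I free]) (use eq Y in auto)
  then show ?thesis using x by blast
qed

lemma free_alg_iso:
  fixes A :: "('k, 'a) module" and B :: "('k, 'b) module"
  assumes I: "defining_identities K I" and free: "free_alg K I A Y" and B: "in_variety K I B"
    and h: "h \<in> alg_hom K A B" and k: "k \<in> alg_hom K B A"
    and kh: "\<And>x. x \<in> carrier A \<Longrightarrow> k (h x) = x" and hk: "\<And>x. x \<in> carrier B \<Longrightarrow> h (k x) = x"
  shows "free_alg K I B (h ` Y)"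
  unfolding free_alg_def
proof (intro conjI allI impI ballI)
  have Y: "Y \<subseteq> carrier A" and B': "nonassoc_algebra K B"
    using free B by (auto simp: free_alg_def in_variety_def)
  show "in_variety K I B" by fact
  show "h ` Y \<subseteq> carrier B" using Y alg_homD(1) [OF h] by auto
  fix C :: "('k, ('b na_monomial \<Rightarrow> 'k) set) module" and g
  assume C: "in_variety K I C" and g: "g \<in> h ` Y \<rightarrow> carrier C"
  have "(\<lambda>y. g (h y)) \<in> Y \<rightarrow> carrier C" using g by blast
  from free_alg_extension_all_types [OF I free C this]
  obtain u where u: "u \<in> alg_hom K A C" "\<forall>y\<in>Y. u y = g (h y)" by blast
  show "\<exists>!e. e \<in> alg_hom K B C \<inter> extensional (carrier B) \<and> (\<forall>y\<in>h ` Y. e y = g y)"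
  proof (rule ex1I)
    show "restrict (\<lambda>x. u (k x)) (carrier B) \<in> alg_hom K B C \<inter> extensional (carrier B) \<and>
        (\<forall>y\<in>h ` Y. restrict (\<lambda>x. u (k x)) (carrier B) y = g y)"
      using alg_hom_restrict [OF B' alg_hom_comp [OF k u(1)]] u(2) Y kh alg_homD(1) [OF h]
      by (auto simp: subset_iff)
    fix e assume e: "e \<in> alg_hom K B C \<inter> extensional (carrier B) \<and> (\<forall>y\<in>h ` Y. e y = g y)"
    have "e (h x) = u x" if "x \<in> carrier A" for x
      by (rule free_alg_uniqueness_all_types [OF I free C alg_hom_comp [OF h] u(1) _ that])
        (use e u in auto)
    then have "e x = u (k x)" if "x \<in> carrier B" for x
      using that hk alg_homD(1) [OF k] by metis
    then show "e = restrict (\<lambda>x. u (k x)) (carrier B)"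
      using e by (auto simp: extensional_def restrict_def fun_eq_iff)
  qed
qed

lemma schreier_variety_all_types:
  fixes A :: "('k, 'a) module" and i :: "'a \<Rightarrow> 'g"
  assumes I: "defining_identities K I" and schreier: "schreier_variety TYPE('g) K I"
    and free: "free_alg K I A Y" and i: "inj_on i Y" and S: "subalgebra K A S"
  shows "\<exists>Z. free_alg K I (A\<lparr>carrier := S\<rparr>) Z"
proof -
  have A: "in_variety K I A" and Y: "Y \<subseteq> carrier A" using free by (auto simp: free_alg_def)
  have A': "nonassoc_algebra K A" using A by (simp add: in_variety_def)
  interpret A: nonassoc_algebra K A by fact
  note B = subalgebra_in_variety [OF I A S]
  note SD = A.subalgebraD [OF S]
  let ?B = "A\<lparr>carrier := S\<rparr>"
  define v where "v x = (if x \<in> i ` Y then inv_into Y i x else \<zero>\<^bsub>A\<^esub>)" for x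
  have v: "range v \<subseteq> carrier A"
    using Y by (auto simp: v_def i)
  have "y \<in> eval_na K A v ` carrier (free_nalg K)" if "y \<in> Y" for y
  proof (rule image_eqI [OF _ A.free_nalg_closed(2)])
    show "y = eval_na K A v (nvar K (i y))"
      using that i by (simp add: A.eval_na_nvar [OF v] v_def)
  qed
  then have gen: "eval_na K A v ` carrier (free_nalg K) = carrier A"
    by (intro free_alg_generated [OF I free A.subalgebra_eval_image [OF v]]) auto
  define \<phi> where "\<phi> = (\<lambda>c. {p \<in> carrier (free_nalg K). eval_na K A v p = c})"
  have inj: "inj_on \<phi> (carrier A)"
    using inj_on_eval_fibres [of K A v] unfolding gen \<phi>_def .
  note C = copy_alg [OF I A inj]
  let ?C = "copy_alg \<phi> A" and ?\<psi> = "inv_into (carrier A) \<phi>"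
  have inv: "?\<psi> (\<phi> x) = x" if "x \<in> carrier A" for x
    using inj that by simp
  have invS: "?\<psi> (\<phi> x) = x" if "x \<in> S" for x
    using inv that SD(1) by auto
  have "free_alg K I ?C (\<phi> ` Y)"
    by (rule free_alg_iso [OF I free C(1-3)]) (auto simp: C(4) inj)
  moreover have S': "subalgebra K ?C (\<phi> ` S)"
  proof (rule nonassoc_algebra.subalgebraI)
    show "nonassoc_algebra K ?C" using C(1) by (simp add: in_variety_def)
  qed (use SD invS in \<open>auto simp: copy_alg_def Let_def\<close>)
  ultimately obtain Z where Z: "free_alg K I (?C\<lparr>carrier := \<phi> ` S\<rparr>) Z"
    using schreier unfolding schreier_variety_def by blast
  have "?\<psi> \<in> alg_hom K (?C\<lparr>carrier := \<phi> ` S\<rparr>) ?B" "\<phi> \<in> alg_hom K ?B (?C\<lparr>carrier := \<phi> ` S\<rparr>)"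
    using SD invS by (auto simp: alg_hom_def copy_alg_def Let_def)
  then have "free_alg K I ?B (?\<psi> ` Z)"
    by (rule free_alg_iso [OF I Z B(1)]) (auto simp: invS)
  then show ?thesis by blast
qed

end

theory Submission
  imports "HOL-Library.Multiset" "HOL-Library.Nat_Bijection" "HOL-Library.List_Lexorder" Defs
begin

text \<open>
  Let \<open>A\<close> be an algebra over \<open>F\<close> in which the \<open>K\<close>-subalgebra \<open>G\<close> generated by \<open>Y\<close> is free. The \<open>F\<close>-subalgebra
  generated by \<open>Y\<close> is the \<open>F\<close>-span of \<open>G\<close>, and it is free as soon as the natural map \<open>F \<otimes>\<^sub>K G \<rightarrow> A\<close> is
  injective: then homomorphisms from \<open>G\<close> extend \<open>F\<close>-linearly.

  Injectivity means that \<open>K\<close>-independent elements of \<open>G\<close> are \<open>F\<close>-independent in \<open>A\<close>. Take a relation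
  \<open>a\<^sub>1 u\<^sub>1 + \<dots> + a\<^sub>n u\<^sub>n = 0\<close>. Suppose that an operator \<open>M\<close> composed of multiplications by \<open>u\<^sub>1\<close> kills \<open>u\<^sub>1\<close> and
  that its kernel in \<open>G\<close> is just \<open>K u\<^sub>1\<close>. Applying \<open>M\<close> yields a relation with fewer terms between
  \<open>M u\<^sub>2, \<dots>, M u\<^sub>n\<close>, and these are again \<open>K\<close>-independent, so induction applies
  (\<open>independent_over_extension\<close>). If \<open>u u = 0\<close>, a natural operator is \<open>M v = v u\<close>; in general
  \<open>M v = (u u) v - (v u) u\<close> kills \<open>u\<close>. The lemma \<open>MLM_varietyI\<close> thus reduces the MLM property to the
  statement that these equations force \<open>v \<in> K u\<close> in free algebras over \<open>K\<close>.

  In a Schreier variety with \<open>x\<^sup>2 = 0\<close> and nonzero products, \<open>v u = 0\<close> makes the span of \<open>u\<close> and \<open>v\<close> a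
  free algebra with zero product, which cannot have two generators
  (\<open>schreier_commuting_dependent\<close>).

  Lie and anticommutative algebras are treated through normal forms (\<open>normal_forms\<close>), which show both
  that the variety is homogeneous and that every nonzero element of a free algebra has a leading term
  in a concrete model. Free anticommutative algebras have a basis of monomials with sorted factors.
  In characteristic 2 they are the free commutative algebras, where squares do not vanish and the
  operator \<open>(u u) v - (v u) u\<close> is the one to use. For free Lie algebras the normal forms are the standard
  bracketings of Lyndon words: they span by the Jacobi identity (\<open>hall_bracket_reducible\<close>), and in the
  algebra of noncommutative power series, with the commutator as product, they have their
  Lyndon words as leading words (\<open>hall_lead\<close>). Distinct Lyndon words do not commute, so
  commuting Lie elements have the same leading word, and subtracting a multiple shows that they are
  proportional.
\<close>

section \<open>Linear independence over an extension field\<close>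

text \<open>
  A \<open>K\<close>-subspace \<open>G\<close> of an \<open>F\<close>-space \<open>V\<close>. The aim of this locale is a criterion for the natural map
  \<open>F \<otimes>\<^sub>K G \<rightarrow> V\<close> to be injective, phrased without tensor products.
\<close>

locale subspace_over_subfield =
  K: field K + F: field F + V: Module.module F V
  for K :: "'k ring" and F :: "'f ring" and V :: "('f, 'a) module" +
  fixes \<iota> :: "'k \<Rightarrow> 'f" and G :: "'a set"
  assumes embedding: "\<iota> \<in> ring_hom K F"
    and subset: "G \<subseteq> carrier V"
    and zero_mem: "\<zero>\<^bsub>V\<^esub> \<in> G"
    and add_mem: "\<lbrakk>x \<in> G; y \<in> G\<rbrakk> \<Longrightarrow> x \<oplus>\<^bsub>V\<^esub> y \<in> G"
    and smult_mem: "\<lbrakk>c \<in> carrier K; x \<in> G\<rbrakk> \<Longrightarrow> \<iota> c \<odot>\<^bsub>V\<^esub> x \<in> G"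
begin

lemma embedding_simps [simp]:
  "c \<in> carrier K \<Longrightarrow> \<iota> c \<in> carrier F"
  "\<iota> \<zero>\<^bsub>K\<^esub> = \<zero>\<^bsub>F\<^esub>" "\<iota> \<one>\<^bsub>K\<^esub> = \<one>\<^bsub>F\<^esub>"
  "\<lbrakk>c \<in> carrier K; d \<in> carrier K\<rbrakk> \<Longrightarrow> \<iota> (c \<oplus>\<^bsub>K\<^esub> d) = \<iota> c \<oplus>\<^bsub>F\<^esub> \<iota> d"
  "\<lbrakk>c \<in> carrier K; d \<in> carrier K\<rbrakk> \<Longrightarrow> \<iota> (c \<otimes>\<^bsub>K\<^esub> d) = \<iota> c \<otimes>\<^bsub>F\<^esub> \<iota> d"
  "c \<in> carrier K \<Longrightarrow> \<iota> (\<ominus>\<^bsub>K\<^esub> c) = \<ominus>\<^bsub>F\<^esub> \<iota> c"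
proof -
  interpret h: ring_hom_cring K F \<iota>
    by (rule ring_hom_cring.intro ring_hom_cring_axioms.intro K.is_cring F.is_cring embedding)+
  show "c \<in> carrier K \<Longrightarrow> \<iota> c \<in> carrier F" "\<iota> \<zero>\<^bsub>K\<^esub> = \<zero>\<^bsub>F\<^esub>" "\<iota> \<one>\<^bsub>K\<^esub> = \<one>\<^bsub>F\<^esub>"
    "\<lbrakk>c \<in> carrier K; d \<in> carrier K\<rbrakk> \<Longrightarrow> \<iota> (c \<oplus>\<^bsub>K\<^esub> d) = \<iota> c \<oplus>\<^bsub>F\<^esub> \<iota> d"
    "\<lbrakk>c \<in> carrier K; d \<in> carrier K\<rbrakk> \<Longrightarrow> \<iota> (c \<otimes>\<^bsub>K\<^esub> d) = \<iota> c \<otimes>\<^bsub>F\<^esub> \<iota> d"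
    "c \<in> carrier K \<Longrightarrow> \<iota> (\<ominus>\<^bsub>K\<^esub> c) = \<ominus>\<^bsub>F\<^esub> \<iota> c"
    by auto
qed

text \<open>
  \<open>F\<close>-linear operators that detect multiples of \<open>u\<close>: on \<open>G\<close>, the kernel of \<open>M\<close> is the line \<open>K u\<close>.
\<close>

definition separates :: "('a \<Rightarrow> 'a) \<Rightarrow> 'a \<Rightarrow> bool" where
  "separates M u \<longleftrightarrow> M \<in> carrier V \<rightarrow> carrier V \<and>
     (\<forall>x\<in>carrier V. \<forall>y\<in>carrier V. M (x \<oplus>\<^bsub>V\<^esub> y) = M x \<oplus>\<^bsub>V\<^esub> M y) \<and>
     (\<forall>a\<in>carrier F. \<forall>x\<in>carrier V. M (a \<odot>\<^bsub>V\<^esub> x) = a \<odot>\<^bsub>V\<^esub> M x) \<and>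
     M ` G \<subseteq> G \<and> M u = \<zero>\<^bsub>V\<^esub> \<and>
     (\<forall>v\<in>G. M v = \<zero>\<^bsub>V\<^esub> \<longrightarrow> (\<exists>c\<in>carrier K. v = \<iota> c \<odot>\<^bsub>V\<^esub> u))"

lemma combination_mem:
  assumes "finite S" "u \<in> S \<rightarrow> G" "c \<in> S \<rightarrow> carrier K"
  shows "(\<Oplus>\<^bsub>V\<^esub>i\<in>S. \<iota> (c i) \<odot>\<^bsub>V\<^esub> u i) \<in> G"
  using assms
proof (induction S rule: finite_induct)
  case empty
  then show ?case by (simp add: zero_mem)
next
  case (insert j S)
  then have "(\<lambda>i. \<iota> (c i) \<odot>\<^bsub>V\<^esub> u i) \<in> insert j S \<rightarrow> carrier V"
    using subset by (auto simp: Pi_def subset_iff)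
  then show ?case
    using insert by (simp add: add_mem smult_mem Pi_def)
qed

lemma linear_finsum:
  assumes M: "M \<in> carrier V \<rightarrow> carrier V"
    and add: "\<And>x y. \<lbrakk>x \<in> carrier V; y \<in> carrier V\<rbrakk> \<Longrightarrow> M (x \<oplus>\<^bsub>V\<^esub> y) = M x \<oplus>\<^bsub>V\<^esub> M y"
    and smult: "\<And>a x. \<lbrakk>a \<in> carrier F; x \<in> carrier V\<rbrakk> \<Longrightarrow> M (a \<odot>\<^bsub>V\<^esub> x) = a \<odot>\<^bsub>V\<^esub> M x"
    and "finite S" "u \<in> S \<rightarrow> carrier V" "a \<in> S \<rightarrow> carrier F"
  shows "M (\<Oplus>\<^bsub>V\<^esub>i\<in>S. a i \<odot>\<^bsub>V\<^esub> u i) = (\<Oplus>\<^bsub>V\<^esub>i\<in>S. a i \<odot>\<^bsub>V\<^esub> M (u i))"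
  using assms(4-)
proof (induction S rule: finite_induct)
  case empty
  have "M (\<zero>\<^bsub>F\<^esub> \<odot>\<^bsub>V\<^esub> \<zero>\<^bsub>V\<^esub>) = \<zero>\<^bsub>F\<^esub> \<odot>\<^bsub>V\<^esub> M \<zero>\<^bsub>V\<^esub>" by (rule smult) auto
  moreover have "M \<zero>\<^bsub>V\<^esub> \<in> carrier V" using M by auto
  ultimately show ?case by simp
next
  case (insert j S)
  have "(\<lambda>i. a i \<odot>\<^bsub>V\<^esub> u i) \<in> S \<rightarrow> carrier V" "(\<lambda>i. a i \<odot>\<^bsub>V\<^esub> M (u i)) \<in> S \<rightarrow> carrier V"
    "a j \<odot>\<^bsub>V\<^esub> u j \<in> carrier V" "a j \<odot>\<^bsub>V\<^esub> M (u j) \<in> carrier V"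
    using insert.prems M by (auto intro!: V.smult_closed)
  then show ?case
    using insert by (simp add: add smult Pi_def)
qed

text \<open>
  Injectivity of \<open>F \<otimes>\<^sub>K G \<rightarrow> V\<close>. An operator separating one member \<open>u\<^sub>j\<close> of the family removes the
  \<open>j\<close>-th term from an \<open>F\<close>-linear relation. It turns the other members into a family that is again
  \<open>K\<close>-independent, because a \<open>K\<close>-relation between the images puts a \<open>K\<close>-combination of them on the
  line \<open>K u\<^sub>j\<close>. So induction on the number of terms applies.
\<close>

lemma independent_over_extension:
  assumes op: "\<And>u. \<lbrakk>u \<in> G; u \<noteq> \<zero>\<^bsub>V\<^esub>\<rbrakk> \<Longrightarrow> \<exists>M. separates M u"
    and "finite S" "u \<in> S \<rightarrow> G"
    and "\<forall>c \<in> S \<rightarrow> carrier K. (\<Oplus>\<^bsub>V\<^esub>i\<in>S. \<iota> (c i) \<odot>\<^bsub>V\<^esub> u i) = \<zero>\<^bsub>V\<^esub> \<longrightarrow> (\<forall>i\<in>S. c i = \<zero>\<^bsub>K\<^esub>)"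
    and "a \<in> S \<rightarrow> carrier F" "(\<Oplus>\<^bsub>V\<^esub>i\<in>S. a i \<odot>\<^bsub>V\<^esub> u i) = \<zero>\<^bsub>V\<^esub>"
  shows "\<forall>i\<in>S. a i = \<zero>\<^bsub>F\<^esub>"
  using assms(2-)
proof (induction S arbitrary: u rule: finite_induct)
  case empty
  then show ?case by simp
next
  case (insert j S)
  note indep = insert.prems(2) [THEN bspec, THEN mp]
  have u: "u j \<in> G" "u \<in> S \<rightarrow> G" "u j \<in> carrier V" "u \<in> S \<rightarrow> carrier V" "u \<in> insert j S \<rightarrow> carrier V"
    and a: "a j \<in> carrier F" "a \<in> S \<rightarrow> carrier F"
    using insert.prems subset by auto
  have uj: "u j \<noteq> \<zero>\<^bsub>V\<^esub>"
  proof
    assume "u j = \<zero>\<^bsub>V\<^esub>"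
    define c where "c i = (if i = j then \<one>\<^bsub>K\<^esub> else \<zero>\<^bsub>K\<^esub>)" for i
    have "(\<Oplus>\<^bsub>V\<^esub>i\<in>insert j S. \<iota> (c i) \<odot>\<^bsub>V\<^esub> u i) = (\<Oplus>\<^bsub>V\<^esub>i\<in>insert j S. \<zero>\<^bsub>V\<^esub>)"
      by (rule V.M.finsum_cong') (use u \<open>u j = \<zero>\<^bsub>V\<^esub>\<close> in \<open>auto simp: c_def Pi_def\<close>)
    also have "\<dots> = \<zero>\<^bsub>V\<^esub>" by simp
    finally have "\<forall>i\<in>insert j S. c i = \<zero>\<^bsub>K\<^esub>"
      by (intro indep) (auto simp: c_def)
    then show False by (simp add: c_def)
  qed
  obtain M where "separates M (u j)" using op [OF u(1) uj] by blast
  then have M: "M \<in> carrier V \<rightarrow> carrier V"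
    and Madd: "\<And>x y. \<lbrakk>x \<in> carrier V; y \<in> carrier V\<rbrakk> \<Longrightarrow> M (x \<oplus>\<^bsub>V\<^esub> y) = M x \<oplus>\<^bsub>V\<^esub> M y"
    and Msmult: "\<And>a x. \<lbrakk>a \<in> carrier F; x \<in> carrier V\<rbrakk> \<Longrightarrow> M (a \<odot>\<^bsub>V\<^esub> x) = a \<odot>\<^bsub>V\<^esub> M x"
    and MG: "M ` G \<subseteq> G" and Mu: "M (u j) = \<zero>\<^bsub>V\<^esub>"
    and ker: "\<And>v. \<lbrakk>v \<in> G; M v = \<zero>\<^bsub>V\<^esub>\<rbrakk> \<Longrightarrow> \<exists>c\<in>carrier K. v = \<iota> c \<odot>\<^bsub>V\<^esub> u j"
    by (simp_all add: separates_def)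
  note M_sum = linear_finsum [OF M Madd Msmult]
  have Mu': "(\<lambda>i. M (u i)) \<in> S \<rightarrow> carrier V" using M u by auto
  have "\<forall>i\<in>S. a i = \<zero>\<^bsub>F\<^esub>"
  proof (rule insert.IH [where u = "\<lambda>i. M (u i)"])
    show "(\<lambda>i. M (u i)) \<in> S \<rightarrow> G" using MG u by auto
    have "M (\<Oplus>\<^bsub>V\<^esub>i\<in>insert j S. a i \<odot>\<^bsub>V\<^esub> u i) = (\<Oplus>\<^bsub>V\<^esub>i\<in>insert j S. a i \<odot>\<^bsub>V\<^esub> M (u i))"
      by (rule M_sum) (use insert.hyps insert.prems(3) u in auto)
    also have "\<dots> = (\<Oplus>\<^bsub>V\<^esub>i\<in>S. a i \<odot>\<^bsub>V\<^esub> M (u i))"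
    proof (subst V.M.finsum_insert)
      show "(\<lambda>i. a i \<odot>\<^bsub>V\<^esub> M (u i)) \<in> S \<rightarrow> carrier V"
        using a Mu' by (auto intro!: V.smult_closed)
      then show "a j \<odot>\<^bsub>V\<^esub> M (u j) \<oplus>\<^bsub>V\<^esub> (\<Oplus>\<^bsub>V\<^esub>i\<in>S. a i \<odot>\<^bsub>V\<^esub> M (u i)) = (\<Oplus>\<^bsub>V\<^esub>i\<in>S. a i \<odot>\<^bsub>V\<^esub> M (u i))"
        using a by (simp add: Mu)
    qed (use insert a in \<open>auto simp: Mu\<close>)
    finally show "(\<Oplus>\<^bsub>V\<^esub>i\<in>S. a i \<odot>\<^bsub>V\<^esub> M (u i)) = \<zero>\<^bsub>V\<^esub>"
      using insert.prems(4) Mu Madd [of "\<zero>\<^bsub>V\<^esub>" "\<zero>\<^bsub>V\<^esub>"] M_sum [of "{}" u a] by simp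
    show "\<forall>c\<in>S \<rightarrow> carrier K. (\<Oplus>\<^bsub>V\<^esub>i\<in>S. \<iota> (c i) \<odot>\<^bsub>V\<^esub> M (u i)) = \<zero>\<^bsub>V\<^esub> \<longrightarrow> (\<forall>i\<in>S. c i = \<zero>\<^bsub>K\<^esub>)"
    proof (intro ballI impI)
      fix c i assume c: "c \<in> S \<rightarrow> carrier K" and 0: "(\<Oplus>\<^bsub>V\<^esub>i\<in>S. \<iota> (c i) \<odot>\<^bsub>V\<^esub> M (u i)) = \<zero>\<^bsub>V\<^esub>"
        and i: "i \<in> S"
      define w where "w = (\<Oplus>\<^bsub>V\<^esub>i\<in>S. \<iota> (c i) \<odot>\<^bsub>V\<^esub> u i)"
      have w: "w \<in> G" unfolding w_def by (rule combination_mem) (use insert u c in auto)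
      have "M w = \<zero>\<^bsub>V\<^esub>"
        unfolding w_def by (subst M_sum) (use insert u c 0 in \<open>auto simp: Pi_def\<close>)
      then obtain d where d: "d \<in> carrier K" "w = \<iota> d \<odot>\<^bsub>V\<^esub> u j" using ker [OF w] by auto
      \<comment> \<open>\<open>M w = 0\<close> puts \<open>w\<close> on the line through \<open>u j\<close>; this is a \<open>K\<close>-relation of the original family\<close>
      define c' where "c' i = (if i = j then \<ominus>\<^bsub>K\<^esub> d else c i)" for i
      have "(\<Oplus>\<^bsub>V\<^esub>i\<in>insert j S. \<iota> (c' i) \<odot>\<^bsub>V\<^esub> u i) = \<iota> (c' j) \<odot>\<^bsub>V\<^esub> u j \<oplus>\<^bsub>V\<^esub> (\<Oplus>\<^bsub>V\<^esub>i\<in>S. \<iota> (c' i) \<odot>\<^bsub>V\<^esub> u i)"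
        by (rule V.M.finsum_insert) (use insert.hyps c d u in \<open>auto simp: c'_def Pi_def\<close>)
      also have "(\<Oplus>\<^bsub>V\<^esub>i\<in>S. \<iota> (c' i) \<odot>\<^bsub>V\<^esub> u i) = w"
        unfolding w_def by (rule V.M.finsum_cong') (use insert.hyps c u in \<open>auto simp: c'_def Pi_def\<close>)
      also have "\<iota> (c' j) \<odot>\<^bsub>V\<^esub> u j \<oplus>\<^bsub>V\<^esub> w = \<zero>\<^bsub>V\<^esub>"
        using d u by (simp add: c'_def V.smult_l_minus V.M.l_neg)
      finally have "\<forall>i\<in>insert j S. c' i = \<zero>\<^bsub>K\<^esub>"
        by (intro indep) (use c d in \<open>auto simp: c'_def\<close>)
      then show "c i = \<zero>\<^bsub>K\<^esub>" using i insert.hyps by (auto simp: c'_def split: if_splits)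
    qed
  qed (use a in auto)
  moreover have "a j = \<zero>\<^bsub>F\<^esub>"
  proof (rule ccontr)
    assume aj: "a j \<noteq> \<zero>\<^bsub>F\<^esub>"
    have "(\<Oplus>\<^bsub>V\<^esub>i\<in>insert j S. a i \<odot>\<^bsub>V\<^esub> u i) = a j \<odot>\<^bsub>V\<^esub> u j \<oplus>\<^bsub>V\<^esub> (\<Oplus>\<^bsub>V\<^esub>i\<in>S. a i \<odot>\<^bsub>V\<^esub> u i)"
      by (rule V.M.finsum_insert) (use insert.hyps a u in \<open>auto simp: Pi_def\<close>)
    also have "(\<Oplus>\<^bsub>V\<^esub>i\<in>S. a i \<odot>\<^bsub>V\<^esub> u i) = (\<Oplus>\<^bsub>V\<^esub>i\<in>S. \<zero>\<^bsub>V\<^esub>)"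
      by (rule V.M.finsum_cong') (use \<open>\<forall>i\<in>S. a i = \<zero>\<^bsub>F\<^esub>\<close> u in \<open>auto simp: Pi_def\<close>)
    finally have 0: "a j \<odot>\<^bsub>V\<^esub> u j = \<zero>\<^bsub>V\<^esub>" using insert.prems(4) a u by simp
    have inv: "inv\<^bsub>F\<^esub> a j \<in> carrier F" "inv\<^bsub>F\<^esub> a j \<otimes>\<^bsub>F\<^esub> a j = \<one>\<^bsub>F\<^esub>"
      using F.field_Units aj a by auto
    have "u j = (inv\<^bsub>F\<^esub> a j \<otimes>\<^bsub>F\<^esub> a j) \<odot>\<^bsub>V\<^esub> u j" using inv u by simp
    also have "\<dots> = inv\<^bsub>F\<^esub> a j \<odot>\<^bsub>V\<^esub> (a j \<odot>\<^bsub>V\<^esub> u j)" using inv a u by (intro V.smult_assoc1) auto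
    finally show False using 0 inv uj by simp
  qed
  ultimately show ?case by simp
qed

text \<open>
  Every \<open>F\<close>-relation between elements of \<open>G\<close> is a consequence of \<open>K\<close>-relations, hence is respected by
  every \<open>K\<close>-linear map into an \<open>F\<close>-space: as long as the family is \<open>K\<close>-dependent, one member can be
  eliminated, and a \<open>K\<close>-independent family has only the trivial \<open>F\<close>-relation.
\<close>

lemma relation_transfer:
  fixes W :: "('f, 'b) module"
  assumes op: "\<And>u. \<lbrakk>u \<in> G; u \<noteq> \<zero>\<^bsub>V\<^esub>\<rbrakk> \<Longrightarrow> \<exists>M. separates M u"
    and W: "Module.module F W"
    and h: "h \<in> G \<rightarrow> carrier W"
    and h_add: "\<And>x y. \<lbrakk>x \<in> G; y \<in> G\<rbrakk> \<Longrightarrow> h (x \<oplus>\<^bsub>V\<^esub> y) = h x \<oplus>\<^bsub>W\<^esub> h y"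
    and h_smult: "\<And>c x. \<lbrakk>c \<in> carrier K; x \<in> G\<rbrakk> \<Longrightarrow> h (\<iota> c \<odot>\<^bsub>V\<^esub> x) = \<iota> c \<odot>\<^bsub>W\<^esub> h x"
    and "finite S" "u \<in> S \<rightarrow> G" "a \<in> S \<rightarrow> carrier F" "(\<Oplus>\<^bsub>V\<^esub>i\<in>S. a i \<odot>\<^bsub>V\<^esub> u i) = \<zero>\<^bsub>V\<^esub>"
  shows "(\<Oplus>\<^bsub>W\<^esub>i\<in>S. a i \<odot>\<^bsub>W\<^esub> h (u i)) = \<zero>\<^bsub>W\<^esub>"
proof -
  interpret W: Module.module F W by fact
  have h0: "h \<zero>\<^bsub>V\<^esub> = \<zero>\<^bsub>W\<^esub>"
    using h_smult [of "\<zero>\<^bsub>K\<^esub>" "\<zero>\<^bsub>V\<^esub>"] Pi_mem [OF h zero_mem] zero_mem by simp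
  have h_sum: "h (\<Oplus>\<^bsub>V\<^esub>i\<in>S. \<iota> (c i) \<odot>\<^bsub>V\<^esub> u i) = (\<Oplus>\<^bsub>W\<^esub>i\<in>S. \<iota> (c i) \<odot>\<^bsub>W\<^esub> h (u i))"
    if "finite S" "u \<in> S \<rightarrow> G" "c \<in> S \<rightarrow> carrier K" for S :: "'c set" and u c
    using that
  proof (induction S rule: finite_induct)
    case empty
    then show ?case by (simp add: h0)
  next
    case (insert j S)
    have 1: "(\<lambda>i. \<iota> (c i) \<odot>\<^bsub>V\<^esub> u i) \<in> insert j S \<rightarrow> carrier V"
      "(\<lambda>i. \<iota> (c i) \<odot>\<^bsub>W\<^esub> h (u i)) \<in> insert j S \<rightarrow> carrier W"
      using insert.prems h subset by (auto simp: Pi_def subset_iff)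
    have 2: "(\<Oplus>\<^bsub>V\<^esub>i\<in>S. \<iota> (c i) \<odot>\<^bsub>V\<^esub> u i) \<in> G" "\<iota> (c j) \<odot>\<^bsub>V\<^esub> u j \<in> G"
      using insert by (auto intro!: combination_mem smult_mem)
    show ?case using insert 1 2 by (simp add: h_add h_smult Pi_def)
  qed
  show ?thesis
    using assms(6-)
  proof (induction "card S" arbitrary: S u a)
    case 0
    then show ?case by simp
  next
    case (Suc n)
    show ?case
    proof (cases "\<forall>c \<in> S \<rightarrow> carrier K. (\<Oplus>\<^bsub>V\<^esub>i\<in>S. \<iota> (c i) \<odot>\<^bsub>V\<^esub> u i) = \<zero>\<^bsub>V\<^esub> \<longrightarrow> (\<forall>i\<in>S. c i = \<zero>\<^bsub>K\<^esub>)")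
      case True
      have 0: "\<forall>i\<in>S. a i = \<zero>\<^bsub>F\<^esub>"
        by (rule independent_over_extension [OF op Suc.prems(1,2) True Suc.prems(3,4)])
      have "(\<Oplus>\<^bsub>W\<^esub>i\<in>S. a i \<odot>\<^bsub>W\<^esub> h (u i)) = (\<Oplus>\<^bsub>W\<^esub>i\<in>S. \<zero>\<^bsub>W\<^esub>)"
        by (rule W.M.finsum_cong') (use 0 h Suc.prems in \<open>auto simp: Pi_def\<close>)
      then show ?thesis by simp
    next
      case False
      then obtain c j where c: "c \<in> S \<rightarrow> carrier K" "(\<Oplus>\<^bsub>V\<^esub>i\<in>S. \<iota> (c i) \<odot>\<^bsub>V\<^esub> u i) = \<zero>\<^bsub>V\<^esub>"
        and j: "j \<in> S" "c j \<noteq> \<zero>\<^bsub>K\<^esub>" by blast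
      define S' where "S' = S - {j}"
      have S: "S = insert j S'" "j \<notin> S'" "finite S'" "card S' = n"
        using j Suc by (auto simp: S'_def)
      have u: "u j \<in> G" "u \<in> S' \<rightarrow> G" and a: "a j \<in> carrier F" "a \<in> S' \<rightarrow> carrier F"
        and cc: "c j \<in> carrier K" "c \<in> S' \<rightarrow> carrier K"
        using Suc.prems c j S by auto
      define d where "d i = \<ominus>\<^bsub>K\<^esub> (inv\<^bsub>K\<^esub> c j \<otimes>\<^bsub>K\<^esub> c i)" for i
      have inv: "inv\<^bsub>K\<^esub> c j \<in> carrier K" "inv\<^bsub>K\<^esub> c j \<otimes>\<^bsub>K\<^esub> c j = \<one>\<^bsub>K\<^esub>"
        using K.field_Units j cc by auto
      have d: "d \<in> S' \<rightarrow> carrier K" using inv cc by (auto simp: d_def Pi_def)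
      have uV: "u j \<in> carrier V" "u \<in> S' \<rightarrow> carrier V" using u subset by auto
      have sumV: "(\<Oplus>\<^bsub>V\<^esub>i\<in>S'. \<iota> (c i) \<odot>\<^bsub>V\<^esub> u i) \<in> carrier V" "(\<lambda>i. \<iota> (c i) \<odot>\<^bsub>V\<^esub> u i) \<in> S' \<rightarrow> carrier V"
        using uV cc by (auto intro!: V.M.finsum_closed simp: Pi_def)
      have eq0: "\<iota> (c j) \<odot>\<^bsub>V\<^esub> u j \<oplus>\<^bsub>V\<^esub> (\<Oplus>\<^bsub>V\<^esub>i\<in>S'. \<iota> (c i) \<odot>\<^bsub>V\<^esub> u i) = \<zero>\<^bsub>V\<^esub>"
        using c(2) S cc uV sumV by simp
      \<comment> \<open>solve the dependence for \<open>u j\<close>\<close>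
      have uj: "u j = (\<Oplus>\<^bsub>V\<^esub>i\<in>S'. \<iota> (d i) \<odot>\<^bsub>V\<^esub> u i)"
      proof -
        have "(\<Oplus>\<^bsub>V\<^esub>i\<in>S'. \<iota> (d i) \<odot>\<^bsub>V\<^esub> u i)
            = (\<Oplus>\<^bsub>V\<^esub>i\<in>S'. (\<ominus>\<^bsub>F\<^esub> \<iota> (inv\<^bsub>K\<^esub> c j)) \<odot>\<^bsub>V\<^esub> (\<iota> (c i) \<odot>\<^bsub>V\<^esub> u i))"
        proof (rule V.M.finsum_cong')
          fix i assume "i \<in> S'"
          then have i: "c i \<in> carrier K" "u i \<in> carrier V" using cc uV by auto
          have "\<iota> (d i) = \<ominus>\<^bsub>F\<^esub> \<iota> (inv\<^bsub>K\<^esub> c j) \<otimes>\<^bsub>F\<^esub> \<iota> (c i)"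
            using i inv by (simp add: d_def F.l_minus)
          then show "\<iota> (d i) \<odot>\<^bsub>V\<^esub> u i = (\<ominus>\<^bsub>F\<^esub> \<iota> (inv\<^bsub>K\<^esub> c j)) \<odot>\<^bsub>V\<^esub> (\<iota> (c i) \<odot>\<^bsub>V\<^esub> u i)"
            using i inv by (simp add: V.smult_assoc1)
        qed (use sumV uV cc inv in \<open>auto simp: Pi_def\<close>)
        also have "\<dots> = (\<ominus>\<^bsub>F\<^esub> \<iota> (inv\<^bsub>K\<^esub> c j)) \<odot>\<^bsub>V\<^esub> (\<Oplus>\<^bsub>V\<^esub>i\<in>S'. \<iota> (c i) \<odot>\<^bsub>V\<^esub> u i)"
          by (rule V.finsum_smult_ldistr [symmetric]) (use S inv sumV in auto)
        also have "(\<Oplus>\<^bsub>V\<^esub>i\<in>S'. \<iota> (c i) \<odot>\<^bsub>V\<^esub> u i) = \<ominus>\<^bsub>V\<^esub> (\<iota> (c j) \<odot>\<^bsub>V\<^esub> u j)"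
          by (rule V.M.minus_equality [symmetric]) (use eq0 sumV cc uV in \<open>simp_all add: V.M.a_comm\<close>)
        also have "(\<ominus>\<^bsub>F\<^esub> \<iota> (inv\<^bsub>K\<^esub> c j)) \<odot>\<^bsub>V\<^esub> (\<ominus>\<^bsub>V\<^esub> (\<iota> (c j) \<odot>\<^bsub>V\<^esub> u j)) = \<iota> (inv\<^bsub>K\<^esub> c j) \<odot>\<^bsub>V\<^esub> (\<iota> (c j) \<odot>\<^bsub>V\<^esub> u j)"
          using inv cc uV by (simp add: V.smult_l_minus V.smult_r_minus)
        also have "\<dots> = (\<iota> (inv\<^bsub>K\<^esub> c j) \<otimes>\<^bsub>F\<^esub> \<iota> (c j)) \<odot>\<^bsub>V\<^esub> u j"
          using inv cc uV by (simp add: V.smult_assoc1)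
        also have "\<iota> (inv\<^bsub>K\<^esub> c j) \<otimes>\<^bsub>F\<^esub> \<iota> (c j) = \<one>\<^bsub>F\<^esub>"
          using inv cc embedding_simps(5) [of "inv\<^bsub>K\<^esub> c j" "c j"] by simp
        finally show ?thesis using inv uV by simp
      qed
      have huj: "h (u j) = (\<Oplus>\<^bsub>W\<^esub>i\<in>S'. \<iota> (d i) \<odot>\<^bsub>W\<^esub> h (u i))"
        by (subst uj, rule h_sum) (use S u d in auto)
      \<comment> \<open>the same regrouping of coefficients is used on both sides of \<open>h\<close>\<close>
      have split: "(\<Oplus>\<^bsub>X\<^esub>i\<in>S'. (a i \<oplus>\<^bsub>F\<^esub> a j \<otimes>\<^bsub>F\<^esub> \<iota> (d i)) \<odot>\<^bsub>X\<^esub> w i) = (\<Oplus>\<^bsub>X\<^esub>i\<in>S. a i \<odot>\<^bsub>X\<^esub> w i)"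
        if X: "Module.module F X" and w: "w \<in> S \<rightarrow> carrier X"
          and wj: "w j = (\<Oplus>\<^bsub>X\<^esub>i\<in>S'. \<iota> (d i) \<odot>\<^bsub>X\<^esub> w i)"
        for X :: "('f, 'x) module" and w
      proof -
        interpret X: Module.module F X by fact
        have w': "w j \<in> carrier X" "w \<in> S' \<rightarrow> carrier X" using w S by auto
        have t: "(\<lambda>i. a i \<odot>\<^bsub>X\<^esub> w i) \<in> S' \<rightarrow> carrier X" "(\<lambda>i. \<iota> (d i) \<odot>\<^bsub>X\<^esub> w i) \<in> S' \<rightarrow> carrier X"
          "(\<lambda>i. a j \<odot>\<^bsub>X\<^esub> (\<iota> (d i) \<odot>\<^bsub>X\<^esub> w i)) \<in> S' \<rightarrow> carrier X"
          using a d w' by (auto simp: Pi_def)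
        have "(\<Oplus>\<^bsub>X\<^esub>i\<in>S'. (a i \<oplus>\<^bsub>F\<^esub> a j \<otimes>\<^bsub>F\<^esub> \<iota> (d i)) \<odot>\<^bsub>X\<^esub> w i)
            = (\<Oplus>\<^bsub>X\<^esub>i\<in>S'. a i \<odot>\<^bsub>X\<^esub> w i \<oplus>\<^bsub>X\<^esub> a j \<odot>\<^bsub>X\<^esub> (\<iota> (d i) \<odot>\<^bsub>X\<^esub> w i))"
          by (rule X.M.finsum_cong') (use a d w' in \<open>auto simp: Pi_def X.smult_l_distr X.smult_assoc1\<close>)
        also have "\<dots> = (\<Oplus>\<^bsub>X\<^esub>i\<in>S'. a i \<odot>\<^bsub>X\<^esub> w i) \<oplus>\<^bsub>X\<^esub> (\<Oplus>\<^bsub>X\<^esub>i\<in>S'. a j \<odot>\<^bsub>X\<^esub> (\<iota> (d i) \<odot>\<^bsub>X\<^esub> w i))"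
          by (rule X.M.finsum_addf [OF t(1,3)])
        also have "(\<Oplus>\<^bsub>X\<^esub>i\<in>S'. a j \<odot>\<^bsub>X\<^esub> (\<iota> (d i) \<odot>\<^bsub>X\<^esub> w i)) = a j \<odot>\<^bsub>X\<^esub> w j"
          unfolding wj by (rule X.finsum_smult_ldistr [symmetric]) (use S a t in auto)
        also have "(\<Oplus>\<^bsub>X\<^esub>i\<in>S'. a i \<odot>\<^bsub>X\<^esub> w i) \<oplus>\<^bsub>X\<^esub> a j \<odot>\<^bsub>X\<^esub> w j = (\<Oplus>\<^bsub>X\<^esub>i\<in>S. a i \<odot>\<^bsub>X\<^esub> w i)"
          unfolding S(1) using S a t w' by (subst X.M.finsum_insert) (auto intro!: X.M.a_comm X.M.finsum_closed)
        finally show ?thesis .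
      qed
      have "(\<Oplus>\<^bsub>V\<^esub>i\<in>S'. (a i \<oplus>\<^bsub>F\<^esub> a j \<otimes>\<^bsub>F\<^esub> \<iota> (d i)) \<odot>\<^bsub>V\<^esub> u i) = \<zero>\<^bsub>V\<^esub>"
        using split [OF V.module_axioms _ uj] Suc.prems subset by (auto simp: Pi_def subset_iff)
      then have "(\<Oplus>\<^bsub>W\<^esub>i\<in>S'. (a i \<oplus>\<^bsub>F\<^esub> a j \<otimes>\<^bsub>F\<^esub> \<iota> (d i)) \<odot>\<^bsub>W\<^esub> h (u i)) = \<zero>\<^bsub>W\<^esub>"
        by (intro Suc.hyps(1)) (use S u a d in \<open>auto simp: Pi_def\<close>)
      then show ?thesis
        using split [OF W _ huj] Suc.prems h by (auto simp: Pi_def)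
    qed
  qed
qed

end

section \<open>A criterion for the MLM property\<close>

lemma restrict_scalars_simps [simp]:
  "carrier (restrict_scalars \<iota> A) = carrier A"
  "(\<otimes>\<^bsub>restrict_scalars \<iota> A\<^esub>) = (\<otimes>\<^bsub>A\<^esub>)"
  "zero (restrict_scalars \<iota> A) = zero A"
  "add (restrict_scalars \<iota> A) = add A"
  "smult (restrict_scalars \<iota> A) c x = \<iota> c \<odot>\<^bsub>A\<^esub> x"
  by (simp_all add: restrict_scalars_def)

lemma finsum_restrict_scalars [simp]: "finsum (restrict_scalars \<iota> A) f S = finsum A f S"
  by (simp add: finsum_def finprod_def)

lemma eval_monomial_restrict_scalars [simp]:
  "eval_monomial (restrict_scalars \<iota> A) v m = eval_monomial A v m"
  by (induction m) auto

lemma eval_monomial_carrier_update [simp]: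
  "eval_monomial (A\<lparr>carrier := S\<rparr>) v m = eval_monomial A v m"
  by (induction m) auto

context
  fixes K :: "'k ring" and F :: "'f ring" and \<iota> :: "'k \<Rightarrow> 'f"
  assumes K: "field K" and F: "field F" and \<iota>: "\<iota> \<in> ring_hom K F"
begin

interpretation K: field K by (rule K)
interpretation F: field F by (rule F)

lemma field_embedding_eq_zero_iff:
  assumes "c \<in> carrier K"
  shows "\<iota> c = \<zero>\<^bsub>F\<^esub> \<longleftrightarrow> c = \<zero>\<^bsub>K\<^esub>"
proof -
  interpret h: ring_hom_cring K F \<iota>
    by (rule ring_hom_cring.intro ring_hom_cring_axioms.intro K.is_cring F.is_cring \<iota>)+
  have "\<iota> c \<noteq> \<zero>\<^bsub>F\<^esub>" if "c \<noteq> \<zero>\<^bsub>K\<^esub>"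
  proof
    assume "\<iota> c = \<zero>\<^bsub>F\<^esub>"
    have inv: "inv\<^bsub>K\<^esub> c \<in> carrier K" "c \<otimes>\<^bsub>K\<^esub> inv\<^bsub>K\<^esub> c = \<one>\<^bsub>K\<^esub>"
      using K.field_Units that assms by auto
    have "\<iota> c \<otimes>\<^bsub>F\<^esub> \<iota> (inv\<^bsub>K\<^esub> c) = \<one>\<^bsub>F\<^esub>"
      using inv assms h.hom_mult [of c "inv\<^bsub>K\<^esub> c"] by simp
    then show False using \<open>\<iota> c = \<zero>\<^bsub>F\<^esub>\<close> inv by simp
  qed
  then show ?thesis by auto
qed

lemma defining_identities_extend:
  assumes "defining_identities K I"
  shows "defining_identities F (extend_identities \<iota> I)"
proof -
  interpret h: ring_hom_cring K F \<iota>
    by (rule ring_hom_cring.intro ring_hom_cring_axioms.intro K.is_cring F.is_cring \<iota>)+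
  have "\<iota> \<circ> f \<in> carrier (free_nalg F)" if f: "f \<in> carrier (free_nalg K)" for f :: "nat na_monomial \<Rightarrow> 'k"
  proof -
    note fc = free_nalg_carrierD [OF f]
    have "finite {m. (\<iota> \<circ> f) m \<noteq> \<zero>\<^bsub>F\<^esub>}"
      by (rule finite_subset [OF _ fc(2)]) auto
    then show ?thesis using fc by (auto simp: free_nalg_def)
  qed
  then show ?thesis using assms by (auto simp: defining_identities_def extend_identities_def)
qed

lemma nonassoc_algebra_restrict_scalars:
  assumes "nonassoc_algebra F A"
  shows "nonassoc_algebra K (restrict_scalars \<iota> A)"
proof -
  interpret A: nonassoc_algebra F A by fact
  interpret h: ring_hom_cring K F \<iota>
    by (rule ring_hom_cring.intro ring_hom_cring_axioms.intro K.is_cring F.is_cring \<iota>)+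
  have "abelian_group (restrict_scalars \<iota> A)"
    by (rule abelian_groupI) (auto simp: A.M.a_ac intro: A.M.l_neg bexI [of _ "\<ominus>\<^bsub>A\<^esub> _"])
  then have "Module.module K (restrict_scalars \<iota> A)"
    by (rule moduleI [OF K.is_cring])
      (auto simp: A.smult_l_distr A.smult_r_distr A.smult_assoc1)
  then show ?thesis
    by (intro nonassoc_algebra.intro nonassoc_algebra_axioms.intro K)
      (auto simp: A.mult_l_distr A.mult_r_distr A.smult_mult_l A.smult_mult_r)
qed

lemma in_variety_restrict_scalars:
  assumes I: "defining_identities K I" and A: "in_variety F (extend_identities \<iota> I) A"
  shows "in_variety K I (restrict_scalars \<iota> A)"
proof -
  have "eval_na K (restrict_scalars \<iota> A) v f = eval_na F A v (\<iota> \<circ> f)" if "f \<in> I" for v f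
  proof -
    have "f \<in> carrier (free_nalg K)" using that I by (auto simp: defining_identities_def)
    then have "{m. (\<iota> \<circ> f) m \<noteq> \<zero>\<^bsub>F\<^esub>} = {m. f m \<noteq> \<zero>\<^bsub>K\<^esub>}"
      by (auto simp: field_embedding_eq_zero_iff free_nalg_carrierD(1))
    then show ?thesis by (simp add: eval_na_def)
  qed
  then show ?thesis
    using A nonassoc_algebra_restrict_scalars
    by (auto simp: in_variety_def satisfies_def extend_identities_def)
qed

end

lemma gen_subalgebra:
  assumes "nonassoc_algebra K A" and Y: "Y \<subseteq> carrier A"
  obtains S where "gen_subalgebra K A Y = A\<lparr>carrier := S\<rparr>" "subalgebra K A S" "Y \<subseteq> S"
    "\<And>T. \<lbrakk>subalgebra K A T; Y \<subseteq> T\<rbrakk> \<Longrightarrow> S \<subseteq> T"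
proof
  interpret nonassoc_algebra K A by fact
  let ?S = "\<Inter>{S. subalgebra K A S \<and> Y \<subseteq> S}"
  show "gen_subalgebra K A Y = A\<lparr>carrier := ?S\<rparr>" by (simp add: gen_subalgebra_def)
  have carrier: "subalgebra K A (carrier A)" by (rule subalgebraI) auto
  show "subalgebra K A ?S"
  proof (rule subalgebraI)
    show "?S \<subseteq> carrier A" using carrier Y by auto
  qed (auto dest: subalgebraD)
qed auto

text \<open>
  Reduction of the MLM property to free algebras over \<open>K\<close>. The operators \<open>v \<mapsto> v u\<close> and
  \<open>v \<mapsto> (u u) v - (v u) u\<close> are \<open>F\<close>-linear on the whole algebra, preserve the \<open>K\<close>-subalgebra generated
  by \<open>Y\<close> and kill \<open>u\<close> (the first one if \<open>u u = 0\<close>). The assumption \<open>crit\<close> says that the kernel of the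
  first operator if \<open>u u = 0\<close>, and of the second one otherwise, consists of the multiples of \<open>u\<close> when
  the algebra is free over \<open>K\<close>; so this operator separates in the sense of
  \<^const>\<open>subspace_over_subfield.separates\<close>. Monomials in \<open>Y\<close> lie in the free \<open>K\<close>-algebra, so a
  polynomial over \<open>F\<close> vanishing at \<open>Y\<close> is an \<open>F\<close>-relation between its elements, and
  \<open>relation_transfer\<close> makes it vanish in every other algebra of the variety.
\<close>

lemma MLM_varietyI:
  fixes K :: "'k ring"
  assumes K: "field K" and I: "defining_identities K I" and homogeneous: "homogeneous_variety K I"
    and crit: "\<And>(G :: ('k, 'a) module) Y u v. \<lbrakk>free_alg K I G Y; finite Y; u \<in> carrier G; v \<in> carrier G;
        u \<noteq> \<zero>\<^bsub>G\<^esub>; if u \<otimes>\<^bsub>G\<^esub> u = \<zero>\<^bsub>G\<^esub> then v \<otimes>\<^bsub>G\<^esub> u = \<zero>\<^bsub>G\<^esub>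
          else (u \<otimes>\<^bsub>G\<^esub> u) \<otimes>\<^bsub>G\<^esub> v = (v \<otimes>\<^bsub>G\<^esub> u) \<otimes>\<^bsub>G\<^esub> u\<rbrakk>
        \<Longrightarrow> \<exists>c\<in>carrier K. v = c \<odot>\<^bsub>G\<^esub> u"
  shows "MLM_variety TYPE('f) TYPE('a) K I"
  unfolding MLM_variety_def
proof (intro conjI allI impI homogeneous)
  fix F :: "'f ring" and \<iota> and A :: "('f, 'a) module" and Y
  let ?I = "extend_identities \<iota> I" and ?R = "restrict_scalars \<iota> A"
  assume "field F \<and> \<iota> \<in> ring_hom K F \<and> in_variety F ?I A \<and> Y \<subseteq> carrier A \<and> finite Y \<and> 2 \<le> card Y \<and>
    free_alg K I (gen_subalgebra K ?R Y) Y"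
  then have F: "field F" and \<iota>: "\<iota> \<in> ring_hom K F" and A: "in_variety F ?I A"
    and Y: "Y \<subseteq> carrier A" "finite Y" and free: "free_alg K I (gen_subalgebra K ?R Y) Y"
    by auto
  have A': "nonassoc_algebra F A" using A by (simp add: in_variety_def)
  have I': "defining_identities F ?I" by (rule defining_identities_extend [OF K F \<iota> I])
  have R': "nonassoc_algebra K ?R" by (rule nonassoc_algebra_restrict_scalars [OF K F \<iota> A'])
  interpret A: nonassoc_algebra F A by fact
  interpret R: nonassoc_algebra K ?R by fact
  obtain G where G: "gen_subalgebra K ?R Y = ?R\<lparr>carrier := G\<rparr>" "subalgebra K ?R G" "Y \<subseteq> G"
    using gen_subalgebra [OF R', of Y] Y by (metis restrict_scalars_simps(1))
  note GD = R.subalgebraD [OF G(2), simplified]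
  have free: "free_alg K I (?R\<lparr>carrier := G\<rparr>) Y" using free G by simp
  interpret subspace_over_subfield K F A \<iota> G
    by (intro subspace_over_subfield.intro subspace_over_subfield_axioms.intro K F A.module_axioms \<iota>)
      (auto simp: GD)
  have G_minus: "\<ominus>\<^bsub>A\<^esub> x \<in> G" if "x \<in> G" for x
  proof -
    have "\<ominus>\<^bsub>A\<^esub> x = \<iota> (\<ominus>\<^bsub>K\<^esub> \<one>\<^bsub>K\<^esub>) \<odot>\<^bsub>A\<^esub> x"
      using that subset by (auto simp: A.smult_l_minus)
    then show ?thesis using that smult_mem [of "\<ominus>\<^bsub>K\<^esub> \<one>\<^bsub>K\<^esub>" x] by simp
  qed
  have op: "\<exists>M. separates M u" if u: "u \<in> G" "u \<noteq> \<zero>\<^bsub>A\<^esub>" for u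
  proof (cases "u \<otimes>\<^bsub>A\<^esub> u = \<zero>\<^bsub>A\<^esub>")
    case True
    have "separates (\<lambda>v. v \<otimes>\<^bsub>A\<^esub> u) u"
      unfolding separates_def
      using u subset GD True crit [OF free Y(2), of u]
      by (auto simp: A.mult_l_distr A.smult_mult_l)
    then show ?thesis by blast
  next
    case False
    have uA: "u \<in> carrier A" using u subset by auto
    let ?M = "\<lambda>v. (u \<otimes>\<^bsub>A\<^esub> u) \<otimes>\<^bsub>A\<^esub> v \<oplus>\<^bsub>A\<^esub> \<ominus>\<^bsub>A\<^esub> ((v \<otimes>\<^bsub>A\<^esub> u) \<otimes>\<^bsub>A\<^esub> u)"
    have eq: "(u \<otimes>\<^bsub>A\<^esub> u) \<otimes>\<^bsub>A\<^esub> v = (v \<otimes>\<^bsub>A\<^esub> u) \<otimes>\<^bsub>A\<^esub> u" if "?M v = \<zero>\<^bsub>A\<^esub>" "v \<in> G" for v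
      using A.M.minus_equality [OF that(1)] that uA subset by auto
    have MG: "?M v \<in> G" if "v \<in> G" for v
      by (intro GD(3) G_minus GD(4) u(1) that)
    have "separates ?M u"
      unfolding separates_def
      using uA u(1,2) subset GD False crit [OF free Y(2), of u] eq
      by (auto simp: A.mult_l_distr A.smult_mult_l A.mult_r_distr A.smult_mult_r A.M.minus_add
        A.smult_r_distr A.smult_r_minus A.M.r_neg A.M.a_ac subset_iff intro: MG)
    then show ?thesis by blast
  qed
  obtain C where C: "gen_subalgebra F A Y = A\<lparr>carrier := C\<rparr>" "subalgebra F A C" "Y \<subseteq> C"
    and C_least: "\<And>T. \<lbrakk>subalgebra F A T; Y \<subseteq> T\<rbrakk> \<Longrightarrow> C \<subseteq> T"
    using gen_subalgebra [OF A' Y(1)] by metis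
  note CD = A.subalgebraD [OF C(2)]
  define v where "v y = (if y \<in> Y then y else \<zero>\<^bsub>A\<^esub>)" for y
  have v: "range v \<subseteq> carrier A" using Y by (auto simp: v_def)
  have v_G: "eval_monomial A v m \<in> G" for m
    by (induction m) (use G(3) GD in \<open>auto simp: v_def\<close>)
  have C_eval: "C \<subseteq> eval_na F A v ` carrier (free_nalg F)"
  proof (rule C_least [OF A.subalgebra_eval_image [OF v]])
    show "Y \<subseteq> eval_na F A v ` carrier (free_nalg F)"
    proof
      fix y assume "y \<in> Y"
      then show "y \<in> eval_na F A v ` carrier (free_nalg F)"
        by (intro image_eqI [where x = "nvar F y"]) (auto simp: A.eval_na_nvar [OF v] v_def A.free_nalg_closed)
    qed
  qed
  show "free_alg F ?I (gen_subalgebra F A Y) Y"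
    unfolding free_alg_def C(1)
  proof (intro conjI allI impI ballI)
    show inC: "in_variety F ?I (A\<lparr>carrier := C\<rparr>)" by (rule subalgebra_in_variety [OF I' A C(2)])
    show "Y \<subseteq> carrier (A\<lparr>carrier := C\<rparr>)" using C by simp
    fix B :: "('f, ('a na_monomial \<Rightarrow> 'f) set) module" and g
    assume B: "in_variety F ?I B" and g: "g \<in> Y \<rightarrow> carrier B"
    have B': "nonassoc_algebra F B" using B by (simp add: in_variety_def)
    interpret B: nonassoc_algebra F B by fact
    define w where "w y = (if y \<in> Y then g y else \<zero>\<^bsub>B\<^esub>)" for y
    have w: "range w \<subseteq> carrier B" using g by (auto simp: w_def)
    have RB: "in_variety K I (restrict_scalars \<iota> B)" by (rule in_variety_restrict_scalars [OF K F \<iota> I B])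
    obtain h0 where h0: "h0 \<in> alg_hom K (?R\<lparr>carrier := G\<rparr>) (restrict_scalars \<iota> B)"
      and h0Y: "\<forall>y\<in>Y. h0 y = g y"
      using free_alg_extension_all_types [OF I free RB, of g] g by auto
    note hD = alg_homD [OF h0, simplified]
    have "h0 \<zero>\<^bsub>A\<^esub> = \<zero>\<^bsub>B\<^esub>"
      using hD(4) [of "\<zero>\<^bsub>K\<^esub>" "\<zero>\<^bsub>A\<^esub>"] hD(1) GD(2) by simp
    then have h0_mono: "h0 (eval_monomial A v m) = eval_monomial B w m" for m
      by (induction m) (use h0Y v_G in \<open>auto simp: v_def w_def hD\<close>)
    have kernel: "eval_na F B w p = \<zero>\<^bsub>B\<^esub>" if p: "p \<in> carrier (free_nalg F)" and 0: "eval_na F A v p = \<zero>\<^bsub>A\<^esub>" for p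
      using relation_transfer [OF op B.module_axioms, of h0 "{m. p m \<noteq> \<zero>\<^bsub>F\<^esub>}" "eval_monomial A v" p]
        hD v_G free_nalg_carrierD [OF p] 0
      by (simp add: eval_na_def h0_mono Pi_def)
    have eq: "eval_na F B w p = eval_na F B w q"
      if p: "p \<in> carrier (free_nalg F)" and q: "q \<in> carrier (free_nalg F)"
        and pq: "eval_na F A v p = eval_na F A v q" for p q
    proof -
      let ?m = "\<ominus>\<^bsub>F\<^esub> \<one>\<^bsub>F\<^esub> \<odot>\<^bsub>free_nalg F\<^esub> q"
      have m: "?m \<in> carrier (free_nalg F)" using q by (simp add: A.free_nalg_closed)
      have ev: "eval_na F A v q \<in> carrier A" "eval_na F B w q \<in> carrier B" "eval_na F B w p \<in> carrier B"
        using p q v w by (auto intro: A.eval_na_closed B.eval_na_closed)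
      have "eval_na F A v (p \<oplus>\<^bsub>free_nalg F\<^esub> ?m) = \<zero>\<^bsub>A\<^esub>"
        using p q m ev by (simp add: A.eval_na_add v A.eval_na_smult pq A.smult_l_minus A.M.r_neg)
      then have "eval_na F B w (p \<oplus>\<^bsub>free_nalg F\<^esub> ?m) = \<zero>\<^bsub>B\<^esub>"
        by (intro kernel A.free_nalg_closed p m)
      then have "eval_na F B w p \<oplus>\<^bsub>B\<^esub> \<ominus>\<^bsub>B\<^esub> eval_na F B w q = \<zero>\<^bsub>B\<^esub>"
        using p q m ev by (simp add: B.eval_na_add w B.eval_na_smult B.smult_l_minus)
      from B.M.minus_equality [OF this] ev show ?thesis by simp
    qed
    define P where "P x = (SOME p. p \<in> carrier (free_nalg F) \<and> eval_na F A v p = x)" for x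
    have P: "P x \<in> carrier (free_nalg F)" "eval_na F A v (P x) = x" if "x \<in> C" for x
      unfolding P_def using someI_ex [of "\<lambda>p. p \<in> carrier (free_nalg F) \<and> eval_na F A v p = x"] that C_eval
      by blast+
    define h where "h x = eval_na F B w (P x)" for x
    have h: "h \<in> alg_hom F (A\<lparr>carrier := C\<rparr>) B"
      unfolding alg_hom_def h_def
    proof (intro CollectI conjI ballI; simp)
      show "(\<lambda>x. eval_na F B w (P x)) \<in> C \<rightarrow> carrier B"
        by (simp add: P B.eval_na_closed [OF _ w])
      fix x y assume xy: "x \<in> C" "y \<in> C"
      show "eval_na F B w (P (x \<oplus>\<^bsub>A\<^esub> y)) = eval_na F B w (P x) \<oplus>\<^bsub>B\<^esub> eval_na F B w (P y)"
        by (subst B.eval_na_add [symmetric], (use xy P w in auto)[3])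
          (rule eq, use xy P CD in \<open>auto simp: A.free_nalg_closed A.eval_na_add v\<close>)
      show "eval_na F B w (P (x \<otimes>\<^bsub>A\<^esub> y)) = eval_na F B w (P x) \<otimes>\<^bsub>B\<^esub> eval_na F B w (P y)"
        by (subst B.eval_na_mult [symmetric], (use xy P w in auto)[3])
          (rule eq, use xy P CD in \<open>auto simp: A.free_nalg_closed A.eval_na_mult v\<close>)
    next
      fix a x assume ax: "a \<in> carrier F" "x \<in> C"
      show "eval_na F B w (P (a \<odot>\<^bsub>A\<^esub> x)) = a \<odot>\<^bsub>B\<^esub> eval_na F B w (P x)"
        by (subst B.eval_na_smult [symmetric], (use ax P w in auto)[3])
          (rule eq, use ax P CD in \<open>auto simp: A.free_nalg_closed A.eval_na_smult v\<close>)
    qed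
    have hY: "h y = g y" if "y \<in> Y" for y
    proof -
      have "h y = eval_na F B w (nvar F y)"
        unfolding h_def by (rule eq) (use that C(3) P [of y] in \<open>auto simp: A.free_nalg_closed A.eval_na_nvar [OF v] v_def\<close>)
      then show ?thesis using that by (simp add: B.eval_na_nvar [OF w] w_def)
    qed
    show "\<exists>!h. h \<in> alg_hom F (A\<lparr>carrier := C\<rparr>) B \<inter> extensional (carrier (A\<lparr>carrier := C\<rparr>)) \<and> (\<forall>y\<in>Y. h y = g y)"
    proof (rule ex1I)
      show "restrict h C \<in> alg_hom F (A\<lparr>carrier := C\<rparr>) B \<inter> extensional (carrier (A\<lparr>carrier := C\<rparr>)) \<and>
          (\<forall>y\<in>Y. restrict h C y = g y)"
        using alg_hom_restrict [OF _ h] inC hY C by (auto simp: in_variety_def)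
      fix e assume e: "e \<in> alg_hom F (A\<lparr>carrier := C\<rparr>) B \<inter> extensional (carrier (A\<lparr>carrier := C\<rparr>)) \<and> (\<forall>y\<in>Y. e y = g y)"
      then have e': "e \<in> alg_hom F (A\<lparr>carrier := C\<rparr>) B" by simp
      have zero: "e \<zero>\<^bsub>A\<^esub> = \<zero>\<^bsub>B\<^esub>" "h \<zero>\<^bsub>A\<^esub> = \<zero>\<^bsub>B\<^esub>"
        using alg_hom_zero [OF _ B' e'] alg_hom_zero [OF _ B' h] inC by (auto simp: in_variety_def)
      have "subalgebra F A {x \<in> C. e x = h x}"
        by (rule A.subalgebraI)
          (use CD zero in \<open>auto simp: alg_homD [OF e', simplified] alg_homD [OF h, simplified]\<close>)
      then have "C \<subseteq> {x \<in> C. e x = h x}"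
        by (rule C_least) (use C e hY in auto)
      then show "e = restrict h C"
        using e by (auto simp: extensional_def restrict_def fun_eq_iff)
    qed
  qed
qed

section \<open>Schreier varieties\<close>

lemma (in nonassoc_algebra) eval_na_product_of_variables:
  assumes "range v \<subseteq> carrier A"
  shows "eval_na K A v (nvar K x \<otimes>\<^bsub>free_nalg K\<^esub> nvar K y) = v x \<otimes>\<^bsub>A\<^esub> v y"
  by (simp add: eval_na_mult [OF _ _ assms] free_nalg_closed eval_na_nvar [OF assms])

text \<open>
  Two generators of a free algebra can be sent to arbitrary elements, so their product vanishes only
  if all products vanish.
\<close>

lemma free_alg_no_two_orthogonal_generators:
  fixes A :: "('k, 'a) module"
  assumes K: "field K" and I: "defining_identities K I" and free: "free_alg K I A Z"
    and nontrivial: "\<not> variety_identity K I (nvar K i \<otimes>\<^bsub>free_nalg K\<^esub> nvar K j)"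
    and z: "z1 \<in> Z" "z2 \<in> Z" "z1 \<noteq> z2"
  shows "z1 \<otimes>\<^bsub>A\<^esub> z2 \<noteq> \<zero>\<^bsub>A\<^esub>"
proof
  assume 0: "z1 \<otimes>\<^bsub>A\<^esub> z2 = \<zero>\<^bsub>A\<^esub>"
  have A: "nonassoc_algebra K A" and Z: "Z \<subseteq> carrier A"
    using free by (auto simp: free_alg_def in_variety_def)
  interpret A: nonassoc_algebra K A by fact
  have "satisfies K B (nvar K i \<otimes>\<^bsub>free_nalg K\<^esub> nvar K j)"
    if B: "in_variety K I B" for B :: "('k, (nat na_monomial \<Rightarrow> 'k) set) module"
    unfolding satisfies_def
  proof (intro allI impI)
    fix v :: "nat \<Rightarrow> (nat na_monomial \<Rightarrow> 'k) set" assume v: "range v \<subseteq> carrier B"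
    have B': "nonassoc_algebra K B" using B by (simp add: in_variety_def)
    interpret B: nonassoc_algebra K B by fact
    have "(\<lambda>z. if z = z1 then v i else v j) \<in> Z \<rightarrow> carrier B" using v by auto
    from free_alg_extension_all_types [OF I free B this]
    obtain h where h: "h \<in> alg_hom K A B" "\<forall>z\<in>Z. h z = (if z = z1 then v i else v j)" by blast
    have "v i \<otimes>\<^bsub>B\<^esub> v j = h (z1 \<otimes>\<^bsub>A\<^esub> z2)"
      using h z Z alg_homD(3) [OF h(1), of z1 z2] by auto
    also have "\<dots> = \<zero>\<^bsub>B\<^esub>" unfolding 0 by (rule alg_hom_zero [OF A B' h(1)])
    finally show "eval_na K B v (nvar K i \<otimes>\<^bsub>free_nalg K\<^esub> nvar K j) = \<zero>\<^bsub>B\<^esub>"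
      by (simp add: B.eval_na_product_of_variables [OF v])
  qed
  moreover have "nvar K i \<otimes>\<^bsub>free_nalg K\<^esub> nvar K j \<in> carrier (free_nalg K)"
    by (intro A.free_nalg_closed)
  ultimately show False using nontrivial by (simp add: variety_identity_def)
qed

text \<open>
  If \<open>v u = 0\<close>, then \<open>u\<close> and \<open>v\<close> span a subalgebra with zero multiplication. The Schreier property makes
  it free, and a free generating set of it has at most one element because products of distinct free
  generators are nonzero. So the span is at most one-dimensional.
\<close>

lemma schreier_commuting_dependent:
  fixes G :: "('k, 'a) module"
  assumes K: "field K" and I: "defining_identities K I"
    and schreier: "schreier_variety TYPE('g::infinite) K I"
    and square: "variety_identity K I (nvar K i \<otimes>\<^bsub>free_nalg K\<^esub> nvar K i)"
    and nontrivial: "\<not> variety_identity K I (nvar K j \<otimes>\<^bsub>free_nalg K\<^esub> nvar K k)"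
    and free: "free_alg K I G Y" and Y: "finite Y"
    and u: "u \<in> carrier G" "u \<noteq> \<zero>\<^bsub>G\<^esub>" and v: "v \<in> carrier G" and vu: "v \<otimes>\<^bsub>G\<^esub> u = \<zero>\<^bsub>G\<^esub>"
  shows "\<exists>c\<in>carrier K. v = c \<odot>\<^bsub>G\<^esub> u"
proof -
  have G: "in_variety K I G" and G': "nonassoc_algebra K G" and YG: "Y \<subseteq> carrier G"
    using free by (auto simp: free_alg_def in_variety_def)
  interpret G: nonassoc_algebra K G by fact
  have sq: "x \<otimes>\<^bsub>G\<^esub> x = \<zero>\<^bsub>G\<^esub>" if "x \<in> carrier G" for x
    using variety_identity_all_types [OF I square G] that
      G.eval_na_product_of_variables [of "\<lambda>_. x" i i]
    by (auto simp: satisfies_def)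
  have uv: "u \<otimes>\<^bsub>G\<^esub> v = \<zero>\<^bsub>G\<^esub>"
  proof -
    have "u \<otimes>\<^bsub>G\<^esub> v = (u \<oplus>\<^bsub>G\<^esub> v) \<otimes>\<^bsub>G\<^esub> (u \<oplus>\<^bsub>G\<^esub> v)"
      using u v by (simp add: G.mult_l_distr G.mult_r_distr sq [OF u(1)] sq [OF v] vu)
    then show ?thesis using u v by (simp add: sq)
  qed
  define S where "S = {a \<odot>\<^bsub>G\<^esub> u \<oplus>\<^bsub>G\<^esub> b \<odot>\<^bsub>G\<^esub> v | a b. a \<in> carrier K \<and> b \<in> carrier K}"
  have prod0: "x \<otimes>\<^bsub>G\<^esub> y = \<zero>\<^bsub>G\<^esub>" if "x \<in> S" "y \<in> S" for x y
    using that u v by (auto simp: S_def G.mult_l_distr G.mult_r_distr G.smult_mult_l G.smult_mult_r sq vu uv)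
  have mem: "u \<in> S" "v \<in> S"
  proof -
    have "u = \<one>\<^bsub>K\<^esub> \<odot>\<^bsub>G\<^esub> u \<oplus>\<^bsub>G\<^esub> \<zero>\<^bsub>K\<^esub> \<odot>\<^bsub>G\<^esub> v" "v = \<zero>\<^bsub>K\<^esub> \<odot>\<^bsub>G\<^esub> u \<oplus>\<^bsub>G\<^esub> \<one>\<^bsub>K\<^esub> \<odot>\<^bsub>G\<^esub> v"
      using u v by simp_all
    then show "u \<in> S" "v \<in> S" unfolding S_def by blast+
  qed
  have S: "subalgebra K G S"
  proof (rule G.subalgebraI)
    show "S \<subseteq> carrier G" using u v by (auto simp: S_def)
    have "\<zero>\<^bsub>G\<^esub> = \<zero>\<^bsub>K\<^esub> \<odot>\<^bsub>G\<^esub> u \<oplus>\<^bsub>G\<^esub> \<zero>\<^bsub>K\<^esub> \<odot>\<^bsub>G\<^esub> v" using u v by simp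
    then show zero: "\<zero>\<^bsub>G\<^esub> \<in> S" unfolding S_def by blast
    show "x \<otimes>\<^bsub>G\<^esub> y \<in> S" if "x \<in> S" "y \<in> S" for x y using prod0 [OF that] zero by simp
    show "x \<oplus>\<^bsub>G\<^esub> y \<in> S" if "x \<in> S" "y \<in> S" for x y
    proof -
      obtain a b c d where abcd: "a \<in> carrier K" "b \<in> carrier K" "c \<in> carrier K" "d \<in> carrier K"
        "x = a \<odot>\<^bsub>G\<^esub> u \<oplus>\<^bsub>G\<^esub> b \<odot>\<^bsub>G\<^esub> v" "y = c \<odot>\<^bsub>G\<^esub> u \<oplus>\<^bsub>G\<^esub> d \<odot>\<^bsub>G\<^esub> v"
        using \<open>x \<in> S\<close> \<open>y \<in> S\<close> unfolding S_def by blast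
      then have "x \<oplus>\<^bsub>G\<^esub> y = (a \<oplus>\<^bsub>K\<^esub> c) \<odot>\<^bsub>G\<^esub> u \<oplus>\<^bsub>G\<^esub> (b \<oplus>\<^bsub>K\<^esub> d) \<odot>\<^bsub>G\<^esub> v"
        using u v by (simp add: G.smult_l_distr G.M.a_ac)
      moreover have "a \<oplus>\<^bsub>K\<^esub> c \<in> carrier K" "b \<oplus>\<^bsub>K\<^esub> d \<in> carrier K" using abcd by auto
      ultimately show ?thesis unfolding S_def by blast
    qed
    show "e \<odot>\<^bsub>G\<^esub> x \<in> S" if "e \<in> carrier K" "x \<in> S" for e x
    proof -
      obtain a b where ab: "a \<in> carrier K" "b \<in> carrier K" "x = a \<odot>\<^bsub>G\<^esub> u \<oplus>\<^bsub>G\<^esub> b \<odot>\<^bsub>G\<^esub> v"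
        using \<open>x \<in> S\<close> unfolding S_def by blast
      then have "e \<odot>\<^bsub>G\<^esub> x = (e \<otimes>\<^bsub>K\<^esub> a) \<odot>\<^bsub>G\<^esub> u \<oplus>\<^bsub>G\<^esub> (e \<otimes>\<^bsub>K\<^esub> b) \<odot>\<^bsub>G\<^esub> v"
        using u v that by (simp add: G.smult_r_distr G.smult_assoc1)
      moreover have "e \<otimes>\<^bsub>K\<^esub> a \<in> carrier K" "e \<otimes>\<^bsub>K\<^esub> b \<in> carrier K" using ab that by auto
      ultimately show ?thesis unfolding S_def by blast
    qed
  qed
  obtain T :: "'g set" where "finite T" "card T = card Y"
    using infinite_arbitrarily_large [OF infinite_UNIV] by blast
  then obtain f where "bij_betw f Y T" using finite_same_card_bij [OF Y] by metis
  then have "inj_on f Y" by (rule bij_betw_imp_inj_on)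
  from schreier_variety_all_types [OF I schreier free this S]
  obtain Z where Z: "free_alg K I (G\<lparr>carrier := S\<rparr>) Z" by blast
  then have ZS: "Z \<subseteq> S" and S': "nonassoc_algebra K (G\<lparr>carrier := S\<rparr>)"
    by (auto simp: free_alg_def in_variety_def)
  have SG: "S \<subseteq> carrier G" by (rule G.subalgebraD [OF S])
  have "z1 = z2" if "z1 \<in> Z" "z2 \<in> Z" for z1 z2
    using free_alg_no_two_orthogonal_generators [OF K I Z nontrivial that] prod0 [of z1 z2] that ZS
    by auto
  then obtain z where z: "z \<in> S" "Z \<subseteq> {z}"
    using ZS mem(1) by (cases "Z = {}") auto
  have zG: "z \<in> carrier G" using z SG by auto
  let ?T = "{c \<odot>\<^bsub>G\<^esub> z | c. c \<in> carrier K}"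
  have "?T = carrier (G\<lparr>carrier := S\<rparr>)"
  proof (rule free_alg_generated [OF I Z])
    have one: "z = \<one>\<^bsub>K\<^esub> \<odot>\<^bsub>G\<^esub> z" and zero: "\<zero>\<^bsub>G\<^esub> = \<zero>\<^bsub>K\<^esub> \<odot>\<^bsub>G\<^esub> z" using zG by simp_all
    show "Z \<subseteq> ?T" using z one by blast
    show "subalgebra K (G\<lparr>carrier := S\<rparr>) ?T"
    proof (rule nonassoc_algebra.subalgebraI [OF S']; simp)
      show T: "?T \<subseteq> S" using z G.subalgebraD(5) [OF S] by blast
      show T0: "\<exists>c. \<zero>\<^bsub>G\<^esub> = c \<odot>\<^bsub>G\<^esub> z \<and> c \<in> carrier K" using zero by blast
      show "\<exists>c. x \<otimes>\<^bsub>G\<^esub> y = c \<odot>\<^bsub>G\<^esub> z \<and> c \<in> carrier K"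
        if "\<exists>c. x = c \<odot>\<^bsub>G\<^esub> z \<and> c \<in> carrier K" "\<exists>c. y = c \<odot>\<^bsub>G\<^esub> z \<and> c \<in> carrier K" for x y
      proof -
        have "x \<in> S" "y \<in> S" using T that by blast+
        then show ?thesis using prod0 T0 by simp
      qed
      show "\<exists>c. x \<oplus>\<^bsub>G\<^esub> y = c \<odot>\<^bsub>G\<^esub> z \<and> c \<in> carrier K"
        if "\<exists>c. x = c \<odot>\<^bsub>G\<^esub> z \<and> c \<in> carrier K" "\<exists>c. y = c \<odot>\<^bsub>G\<^esub> z \<and> c \<in> carrier K" for x y
        using that zG by (metis G.smult_l_distr G.R.a_closed)
      show "\<exists>c. e \<odot>\<^bsub>G\<^esub> x = c \<odot>\<^bsub>G\<^esub> z \<and> c \<in> carrier K"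
        if "e \<in> carrier K" "\<exists>c. x = c \<odot>\<^bsub>G\<^esub> z \<and> c \<in> carrier K" for e x
        using that zG by (metis G.smult_assoc1 G.R.m_closed)
    qed
  qed
  then have "u \<in> ?T" "v \<in> ?T" using mem by auto
  then obtain a b where ab: "a \<in> carrier K" "b \<in> carrier K" "u = a \<odot>\<^bsub>G\<^esub> z" "v = b \<odot>\<^bsub>G\<^esub> z"
    by blast
  have "a \<noteq> \<zero>\<^bsub>K\<^esub>" using u ab zG by auto
  then have inv: "inv\<^bsub>K\<^esub> a \<in> carrier K" "inv\<^bsub>K\<^esub> a \<otimes>\<^bsub>K\<^esub> a = \<one>\<^bsub>K\<^esub>"
    using G.field_Units ab by auto
  have "(b \<otimes>\<^bsub>K\<^esub> inv\<^bsub>K\<^esub> a) \<odot>\<^bsub>G\<^esub> u = (b \<otimes>\<^bsub>K\<^esub> (inv\<^bsub>K\<^esub> a \<otimes>\<^bsub>K\<^esub> a)) \<odot>\<^bsub>G\<^esub> z"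
    using ab inv(1) zG by (simp add: G.smult_assoc1)
  then have "v = (b \<otimes>\<^bsub>K\<^esub> inv\<^bsub>K\<^esub> a) \<odot>\<^bsub>G\<^esub> u" using ab inv by simp
  then show ?thesis using ab inv by blast
qed

lemma schreier_MLM:
  fixes K :: "'k ring"
  assumes K: "field K" and I: "defining_identities K I" and homogeneous: "homogeneous_variety K I"
    and schreier: "schreier_variety TYPE('g::infinite) K I"
    and square: "variety_identity K I (nvar K i \<otimes>\<^bsub>free_nalg K\<^esub> nvar K i)"
    and nontrivial: "\<not> variety_identity K I (nvar K j \<otimes>\<^bsub>free_nalg K\<^esub> nvar K k)"
  shows "MLM_variety TYPE('f) TYPE('a) K I"
proof (rule MLM_varietyI [OF K I homogeneous])
  fix G :: "('k, 'a) module" and Y u v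
  assume free: "free_alg K I G Y" and Y: "finite Y" and uv: "u \<in> carrier G" "v \<in> carrier G" "u \<noteq> \<zero>\<^bsub>G\<^esub>"
    and crit: "if u \<otimes>\<^bsub>G\<^esub> u = \<zero>\<^bsub>G\<^esub> then v \<otimes>\<^bsub>G\<^esub> u = \<zero>\<^bsub>G\<^esub> else u \<otimes>\<^bsub>G\<^esub> u \<otimes>\<^bsub>G\<^esub> v = v \<otimes>\<^bsub>G\<^esub> u \<otimes>\<^bsub>G\<^esub> u"
  have G: "in_variety K I G" and G': "nonassoc_algebra K G"
    using free by (auto simp: free_alg_def in_variety_def)
  have "u \<otimes>\<^bsub>G\<^esub> u = \<zero>\<^bsub>G\<^esub>"
    using variety_identity_all_types [OF I square G] uv(1)
      nonassoc_algebra.eval_na_product_of_variables [OF G', of "\<lambda>_. u" i i]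
    by (auto simp: satisfies_def)
  then show "\<exists>c\<in>carrier K. v = c \<odot>\<^bsub>G\<^esub> u"
    using crit uv schreier_commuting_dependent [OF K I schreier square nontrivial free Y] by simp
qed

section \<open>Algebras of functions\<close>

text \<open>
  The models of free algebras below consist of all functions on an index set with pointwise linear
  structure; only the product \<open>\<mu>\<close> varies. Leading terms will be lowest ones for a well-founded order,
  so they exist for arbitrary functions and no condition on supports has to be maintained.
\<close>

definition fun_algebra :: "'k ring \<Rightarrow> (('i \<Rightarrow> 'k) \<Rightarrow> ('i \<Rightarrow> 'k) \<Rightarrow> 'i \<Rightarrow> 'k) \<Rightarrow> ('k, 'i \<Rightarrow> 'k) module" where
  "fun_algebra K \<mu> =
    \<lparr>carrier = {f. range f \<subseteq> carrier K}, mult = \<mu>, one = (\<lambda>i. \<zero>\<^bsub>K\<^esub>), zero = (\<lambda>i. \<zero>\<^bsub>K\<^esub>),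
     add = (\<lambda>f g i. f i \<oplus>\<^bsub>K\<^esub> g i), smult = (\<lambda>a f i. a \<otimes>\<^bsub>K\<^esub> f i)\<rparr>"

lemma fun_algebra_simps [simp]:
  "f \<in> carrier (fun_algebra K \<mu>) \<longleftrightarrow> (\<forall>i. f i \<in> carrier K)"
  "(\<otimes>\<^bsub>fun_algebra K \<mu>\<^esub>) = \<mu>"
  "zero (fun_algebra K \<mu>) = (\<lambda>i. \<zero>\<^bsub>K\<^esub>)"
  "add (fun_algebra K \<mu>) f g = (\<lambda>i. f i \<oplus>\<^bsub>K\<^esub> g i)"
  "smult (fun_algebra K \<mu>) a f = (\<lambda>i. a \<otimes>\<^bsub>K\<^esub> f i)"
  by (auto simp: fun_algebra_def)

lemma nonassoc_algebra_fun_algebra: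
  assumes K: "field K"
    and closed: "\<And>f g i. \<lbrakk>\<And>j. f j \<in> carrier K; \<And>j. g j \<in> carrier K\<rbrakk> \<Longrightarrow> \<mu> f g i \<in> carrier K"
    and add_l: "\<And>f g h i. \<lbrakk>\<And>j. f j \<in> carrier K; \<And>j. g j \<in> carrier K; \<And>j. h j \<in> carrier K\<rbrakk> \<Longrightarrow>
      \<mu> (\<lambda>j. f j \<oplus>\<^bsub>K\<^esub> g j) h i = \<mu> f h i \<oplus>\<^bsub>K\<^esub> \<mu> g h i"
    and add_r: "\<And>f g h i. \<lbrakk>\<And>j. f j \<in> carrier K; \<And>j. g j \<in> carrier K; \<And>j. h j \<in> carrier K\<rbrakk> \<Longrightarrow>
      \<mu> h (\<lambda>j. f j \<oplus>\<^bsub>K\<^esub> g j) i = \<mu> h f i \<oplus>\<^bsub>K\<^esub> \<mu> h g i"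
    and smult_l: "\<And>c f g i. \<lbrakk>c \<in> carrier K; \<And>j. f j \<in> carrier K; \<And>j. g j \<in> carrier K\<rbrakk> \<Longrightarrow>
      \<mu> (\<lambda>j. c \<otimes>\<^bsub>K\<^esub> f j) g i = c \<otimes>\<^bsub>K\<^esub> \<mu> f g i"
    and smult_r: "\<And>c f g i. \<lbrakk>c \<in> carrier K; \<And>j. f j \<in> carrier K; \<And>j. g j \<in> carrier K\<rbrakk> \<Longrightarrow>
      \<mu> f (\<lambda>j. c \<otimes>\<^bsub>K\<^esub> g j) i = c \<otimes>\<^bsub>K\<^esub> \<mu> f g i"
  shows "nonassoc_algebra K (fun_algebra K \<mu>)"
proof -
  interpret field K by fact
  have "abelian_group (fun_algebra K \<mu>)"
  proof (rule abelian_groupI)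
    fix f assume "f \<in> carrier (fun_algebra K \<mu>)"
    then show "\<exists>g\<in>carrier (fun_algebra K \<mu>). g \<oplus>\<^bsub>fun_algebra K \<mu>\<^esub> f = \<zero>\<^bsub>fun_algebra K \<mu>\<^esub>"
      by (intro bexI [of _ "\<lambda>i. \<ominus>\<^bsub>K\<^esub> f i"]) (auto simp: l_neg)
  qed (auto simp: a_ac)
  then have "Module.module K (fun_algebra K \<mu>)"
    by (rule moduleI [OF is_cring]) (auto simp: l_distr r_distr m_assoc)
  then show ?thesis
    by (intro nonassoc_algebra.intro nonassoc_algebra_axioms.intro K)
      (auto simp: closed fun_eq_iff add_l add_r smult_l smult_r)
qed

section \<open>Polynomials modulo the identities of a variety\<close>

definition nmono :: "'k ring \<Rightarrow> 'x na_monomial \<Rightarrow> 'x na_monomial \<Rightarrow> 'k" where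
  "nmono K m = (\<lambda>n. if n = m then \<one>\<^bsub>K\<^esub> else \<zero>\<^bsub>K\<^esub>)"

lemma (in nonassoc_algebra) eval_na_cong:
  assumes f: "f \<in> carrier (free_nalg K)" and v: "range v \<subseteq> carrier A" and w: "range w \<subseteq> carrier A"
    and eq: "\<And>m. f m \<noteq> \<zero>\<^bsub>K\<^esub> \<Longrightarrow> eval_monomial A v m = eval_monomial A w m"
  shows "eval_na K A v f = eval_na K A w f"
  unfolding eval_na_def
  by (rule M.finsum_cong')
    (use eq free_nalg_carrierD(1) [OF f] eval_monomial_closed [OF w] in auto)

text \<open>
  Equality in the relatively free algebra, expressed by evaluation instead of a quotient. The choice
  of type for the test algebras is harmless by \<open>id_cong_all_types\<close>.
\<close>

definition id_cong ::
    "'k ring \<Rightarrow> (nat na_monomial \<Rightarrow> 'k) set \<Rightarrow> (nat na_monomial \<Rightarrow> 'k) \<Rightarrow> (nat na_monomial \<Rightarrow> 'k) \<Rightarrow> bool" where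
  "id_cong K I f g \<longleftrightarrow> f \<in> carrier (free_nalg K) \<and> g \<in> carrier (free_nalg K) \<and>
     (\<forall>(A :: ('k, (nat na_monomial \<Rightarrow> 'k) set) module) v.
        in_variety K I A \<longrightarrow> range v \<subseteq> carrier A \<longrightarrow> eval_na K A v f = eval_na K A v g)"

text \<open>
  The class of \<open>f\<close> in the relatively free algebra lies in the span of the monomials from \<open>X\<close>.
\<close>

definition reducible ::
    "'k ring \<Rightarrow> (nat na_monomial \<Rightarrow> 'k) set \<Rightarrow> nat na_monomial set \<Rightarrow> (nat na_monomial \<Rightarrow> 'k) \<Rightarrow> bool" where
  "reducible K I X f \<longleftrightarrow> (\<exists>p. id_cong K I f p \<and> {m. p m \<noteq> \<zero>\<^bsub>K\<^esub>} \<subseteq> X)"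

context
  fixes K :: "'k ring"
  assumes K: "field K"
begin

interpretation K: field K by (rule K)

text \<open>
  The algebra with zero product supplies the instance of \<^locale>\<open>nonassoc_algebra\<close> in which
  closure of the polynomials under the operations is stated.
\<close>

lemma poly_closed:
  shows "\<zero>\<^bsub>free_nalg K\<^esub> \<in> carrier (free_nalg K)"
    and "nvar K x \<in> carrier (free_nalg K)"
    and "nmono K m \<in> carrier (free_nalg K)"
    and "\<lbrakk>f \<in> carrier (free_nalg K); g \<in> carrier (free_nalg K)\<rbrakk> \<Longrightarrow>
           f \<oplus>\<^bsub>free_nalg K\<^esub> g \<in> carrier (free_nalg K)"
    and "\<lbrakk>f \<in> carrier (free_nalg K); g \<in> carrier (free_nalg K)\<rbrakk> \<Longrightarrow>
           f \<otimes>\<^bsub>free_nalg K\<^esub> g \<in> carrier (free_nalg K)"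
    and "\<lbrakk>a \<in> carrier K; f \<in> carrier (free_nalg K)\<rbrakk> \<Longrightarrow>
           a \<odot>\<^bsub>free_nalg K\<^esub> f \<in> carrier (free_nalg K)"
proof -
  interpret Z: nonassoc_algebra K "fun_algebra K (\<lambda>_ _ _. \<zero>\<^bsub>K\<^esub>)"
    by (rule nonassoc_algebra_fun_algebra [OF K]) auto
  show "nmono K m \<in> carrier (free_nalg K)"
    by (auto simp: free_nalg_def nmono_def)
qed (use nonassoc_algebra.free_nalg_closed [OF nonassoc_algebra_fun_algebra [OF K, of "\<lambda>_ _ _. \<zero>\<^bsub>K\<^esub>"]]
    in auto)

lemma eval_na_nmono:
  assumes A: "nonassoc_algebra K A" and v: "range v \<subseteq> carrier A"
  shows "eval_na K A v (nmono K m) = eval_monomial A v m"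
proof -
  interpret A: nonassoc_algebra K A by fact
  have "eval_na K A v (nmono K m) = (\<Oplus>\<^bsub>A\<^esub>n \<in> {m}. nmono K m n \<odot>\<^bsub>A\<^esub> eval_monomial A v n)"
    by (rule A.eval_na_superset [OF poly_closed(3) v]) (auto simp: nmono_def)
  then show ?thesis using A.eval_monomial_closed [OF v] by (simp add: nmono_def)
qed

lemma nmono_mult: "nmono K s \<otimes>\<^bsub>free_nalg K\<^esub> nmono K t = nmono K (Mul s t)"
  by (auto simp: free_nalg_def nmono_def fun_eq_iff split: na_monomial.split)

lemma poly_decompose:
  assumes f: "f \<in> carrier (free_nalg K)"
  shows "f = f m \<odot>\<^bsub>free_nalg K\<^esub> nmono K m \<oplus>\<^bsub>free_nalg K\<^esub> f(m := \<zero>\<^bsub>K\<^esub>)"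
    and "f(m := \<zero>\<^bsub>K\<^esub>) \<in> carrier (free_nalg K)"
proof -
  note fc = free_nalg_carrierD [OF f]
  show "f = f m \<odot>\<^bsub>free_nalg K\<^esub> nmono K m \<oplus>\<^bsub>free_nalg K\<^esub> f(m := \<zero>\<^bsub>K\<^esub>)"
    using fc(1) by (auto simp: free_nalg_def nmono_def fun_eq_iff)
  have "finite {n. (f(m := \<zero>\<^bsub>K\<^esub>)) n \<noteq> \<zero>\<^bsub>K\<^esub>}"
    by (rule finite_subset [OF _ fc(2)]) auto
  then show "f(m := \<zero>\<^bsub>K\<^esub>) \<in> carrier (free_nalg K)"
    using fc(1) by (auto simp: free_nalg_def)
qed

lemma support_add:
  "{m. (p \<oplus>\<^bsub>free_nalg K\<^esub> q) m \<noteq> \<zero>\<^bsub>K\<^esub>} \<subseteq> {m. p m \<noteq> \<zero>\<^bsub>K\<^esub>} \<union> {m. q m \<noteq> \<zero>\<^bsub>K\<^esub>}"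
  by (auto simp: free_nalg_def)

lemma poly_induct [consumes 2, case_names zero add]:
  assumes "f \<in> carrier (free_nalg K)" "{m. f m \<noteq> \<zero>\<^bsub>K\<^esub>} \<subseteq> X"
    and zero: "Q \<zero>\<^bsub>free_nalg K\<^esub>"
    and add: "\<And>c m g. \<lbrakk>c \<in> carrier K; m \<in> X; g \<in> carrier (free_nalg K); {m. g m \<noteq> \<zero>\<^bsub>K\<^esub>} \<subseteq> X; Q g\<rbrakk>
      \<Longrightarrow> Q (c \<odot>\<^bsub>free_nalg K\<^esub> nmono K m \<oplus>\<^bsub>free_nalg K\<^esub> g)"
  shows "Q f"
proof -
  have "Q g" if "finite S" "S \<subseteq> X" "g \<in> carrier (free_nalg K)" "{m. g m \<noteq> \<zero>\<^bsub>K\<^esub>} \<subseteq> S" for S g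
    using that
  proof (induction S arbitrary: g rule: finite_induct)
    case empty
    then have "g = \<zero>\<^bsub>free_nalg K\<^esub>" by (auto simp: free_nalg_def)
    then show ?case using zero by simp
  next
    case (insert m S)
    note dec = poly_decompose [OF insert.prems(2), of m]
    have "Q (g m \<odot>\<^bsub>free_nalg K\<^esub> nmono K m \<oplus>\<^bsub>free_nalg K\<^esub> g(m := \<zero>\<^bsub>K\<^esub>))"
    proof (rule add)
      show "Q (g(m := \<zero>\<^bsub>K\<^esub>))" by (rule insert.IH [OF _ dec(2)]) (use insert.prems in auto)
      show "g m \<in> carrier K" by (rule free_nalg_carrierD(1) [OF insert.prems(2)])
      show "m \<in> X" using insert.prems(1) by simp
      show "g(m := \<zero>\<^bsub>K\<^esub>) \<in> carrier (free_nalg K)" by (rule dec(2))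
      show "{n. (g(m := \<zero>\<^bsub>K\<^esub>)) n \<noteq> \<zero>\<^bsub>K\<^esub>} \<subseteq> X" using insert.prems by auto
    qed
    then show ?case using dec by simp
  qed
  then show ?thesis
    using free_nalg_carrierD(2) [OF assms(1)] assms(1,2) by blast
qed

context
  fixes I :: "(nat na_monomial \<Rightarrow> 'k) set"
  assumes I: "defining_identities K I"
begin

lemma id_cong_carrier:
  assumes "id_cong K I f g"
  shows "f \<in> carrier (free_nalg K)" "g \<in> carrier (free_nalg K)"
  using assms by (auto simp: id_cong_def)

lemma variety_identity_iff: "variety_identity K I f \<longleftrightarrow> id_cong K I f \<zero>\<^bsub>free_nalg K\<^esub>"
  by (auto simp: variety_identity_def id_cong_def satisfies_def poly_closed in_variety_def
      nonassoc_algebra.eval_na_zero)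

lemma id_cong_refl: "f \<in> carrier (free_nalg K) \<Longrightarrow> id_cong K I f f"
  and id_cong_trans [trans]: "\<lbrakk>id_cong K I f g; id_cong K I g h\<rbrakk> \<Longrightarrow> id_cong K I f h"
  by (auto simp: id_cong_def)

lemma id_cong_add:
  assumes "id_cong K I f f'" "id_cong K I g g'"
  shows "id_cong K I (f \<oplus>\<^bsub>free_nalg K\<^esub> g) (f' \<oplus>\<^bsub>free_nalg K\<^esub> g')"
  using assms by (simp add: id_cong_def poly_closed in_variety_def nonassoc_algebra.eval_na_add)

lemma id_cong_mult:
  assumes "id_cong K I f f'" "id_cong K I g g'"
  shows "id_cong K I (f \<otimes>\<^bsub>free_nalg K\<^esub> g) (f' \<otimes>\<^bsub>free_nalg K\<^esub> g')"
  using assms by (simp add: id_cong_def poly_closed in_variety_def nonassoc_algebra.eval_na_mult)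

lemma id_cong_smult:
  assumes "id_cong K I f f'" "c \<in> carrier K"
  shows "id_cong K I (c \<odot>\<^bsub>free_nalg K\<^esub> f) (c \<odot>\<^bsub>free_nalg K\<^esub> f')"
  using assms by (simp add: id_cong_def poly_closed in_variety_def nonassoc_algebra.eval_na_smult)

text \<open>
  Transfer along \<open>variety_identity_all_types\<close>, applied to the difference.
\<close>

lemma id_cong_all_types:
  fixes A :: "('k, 'a) module"
  assumes fg: "id_cong K I f g" and A: "in_variety K I A" and v: "range v \<subseteq> carrier A"
  shows "eval_na K A v f = eval_na K A v g"
proof -
  interpret A: nonassoc_algebra K A using A by (simp add: in_variety_def)
  note c = id_cong_carrier [OF fg]
  let ?m = "\<ominus>\<^bsub>K\<^esub> \<one>\<^bsub>K\<^esub> \<odot>\<^bsub>free_nalg K\<^esub> g"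
  have m: "?m \<in> carrier (free_nalg K)" using c by (simp add: poly_closed)
  have "id_cong K I (f \<oplus>\<^bsub>free_nalg K\<^esub> ?m) (g \<oplus>\<^bsub>free_nalg K\<^esub> ?m)"
    by (intro id_cong_add fg id_cong_refl m)
  moreover have "g \<oplus>\<^bsub>free_nalg K\<^esub> ?m = \<zero>\<^bsub>free_nalg K\<^esub>"
    using free_nalg_carrierD(1) [OF c(2)] by (auto simp: free_nalg_def fun_eq_iff K.l_minus K.r_neg)
  ultimately have "satisfies K A (f \<oplus>\<^bsub>free_nalg K\<^esub> ?m)"
    using variety_identity_all_types [OF I _ A] variety_identity_iff by metis
  then have "eval_na K A v f \<oplus>\<^bsub>A\<^esub> \<ominus>\<^bsub>A\<^esub> eval_na K A v g = \<zero>\<^bsub>A\<^esub>"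
    using c m v by (simp add: satisfies_def A.eval_na_add A.eval_na_smult A.smult_l_minus A.eval_na_closed)
  from A.M.minus_equality [OF this] c v show ?thesis
    by (simp add: A.eval_na_closed)
qed

lemma reducible_zero: "reducible K I X \<zero>\<^bsub>free_nalg K\<^esub>"
  unfolding reducible_def
  using id_cong_refl [OF poly_closed(1)] by (intro exI conjI) (auto simp: free_nalg_def)

lemma reducible_nmono: "m \<in> X \<Longrightarrow> reducible K I X (nmono K m)"
  unfolding reducible_def
  using id_cong_refl [OF poly_closed(3) [of m]] by (intro exI conjI) (auto simp: nmono_def split: if_splits)

lemma reducible_cong: "\<lbrakk>id_cong K I f g; reducible K I X g\<rbrakk> \<Longrightarrow> reducible K I X f"
  unfolding reducible_def using id_cong_trans by blast

lemma reducible_mono: "\<lbrakk>reducible K I X f; X \<subseteq> X'\<rbrakk> \<Longrightarrow> reducible K I X' f"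
  unfolding reducible_def by blast

lemma reducible_add:
  assumes "reducible K I X f" "reducible K I X g"
  shows "reducible K I X (f \<oplus>\<^bsub>free_nalg K\<^esub> g)"
proof -
  obtain p q where pq: "id_cong K I f p" "{m. p m \<noteq> \<zero>\<^bsub>K\<^esub>} \<subseteq> X" "id_cong K I g q" "{m. q m \<noteq> \<zero>\<^bsub>K\<^esub>} \<subseteq> X"
    using assms by (auto simp: reducible_def)
  have "{m. (p \<oplus>\<^bsub>free_nalg K\<^esub> q) m \<noteq> \<zero>\<^bsub>K\<^esub>} \<subseteq> X"
    using support_add [of p q] pq by blast
  then show ?thesis using id_cong_add [OF pq(1,3)] by (auto simp: reducible_def)
qed

lemma reducible_smult:
  assumes "reducible K I X f" "c \<in> carrier K"
  shows "reducible K I X (c \<odot>\<^bsub>free_nalg K\<^esub> f)"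
proof -
  obtain p where p: "id_cong K I f p" "{m. p m \<noteq> \<zero>\<^bsub>K\<^esub>} \<subseteq> X"
    using assms by (auto simp: reducible_def)
  have "{m. (c \<odot>\<^bsub>free_nalg K\<^esub> p) m \<noteq> \<zero>\<^bsub>K\<^esub>} \<subseteq> X"
    using p assms by (auto simp: free_nalg_def)
  then show ?thesis using id_cong_smult [OF p(1) assms(2)] by (auto simp: reducible_def)
qed

lemma reducible_poly:
  assumes "f \<in> carrier (free_nalg K)" "{m. f m \<noteq> \<zero>\<^bsub>K\<^esub>} \<subseteq> X"
    and "\<And>m. m \<in> X \<Longrightarrow> reducible K I X' (nmono K m)"
  shows "reducible K I X' f"
  using assms(1,2)
  by (induction rule: poly_induct) (auto intro: reducible_zero reducible_add reducible_smult assms(3))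

lemma reducible_mult:
  assumes f: "reducible K I X f" and g: "reducible K I Y g"
    and prod: "\<And>s t. \<lbrakk>s \<in> X; t \<in> Y\<rbrakk> \<Longrightarrow> reducible K I Z (nmono K (Mul s t))"
  shows "reducible K I Z (f \<otimes>\<^bsub>free_nalg K\<^esub> g)"
proof -
  obtain p where p: "id_cong K I f p" "{m. p m \<noteq> \<zero>\<^bsub>K\<^esub>} \<subseteq> X" using f by (auto simp: reducible_def)
  obtain q where q: "id_cong K I g q" "{m. q m \<noteq> \<zero>\<^bsub>K\<^esub>} \<subseteq> Y" using g by (auto simp: reducible_def)
  note c = id_cong_carrier(2) [OF p(1)] id_cong_carrier(2) [OF q(1)]
  have "reducible K I Z (p \<otimes>\<^bsub>free_nalg K\<^esub> q)"
  proof (rule reducible_poly)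
    show "p \<otimes>\<^bsub>free_nalg K\<^esub> q \<in> carrier (free_nalg K)" using c by (simp add: poly_closed)
    show "{m. (p \<otimes>\<^bsub>free_nalg K\<^esub> q) m \<noteq> \<zero>\<^bsub>K\<^esub>} \<subseteq> {Mul s t | s t. s \<in> X \<and> t \<in> Y}"
    proof
      fix m assume m: "m \<in> {m. (p \<otimes>\<^bsub>free_nalg K\<^esub> q) m \<noteq> \<zero>\<^bsub>K\<^esub>}"
      then obtain s t where st: "m = Mul s t" "p s \<otimes>\<^bsub>K\<^esub> q t \<noteq> \<zero>\<^bsub>K\<^esub>"
        by (cases m) (auto simp: free_nalg_def)
      then have "p s \<noteq> \<zero>\<^bsub>K\<^esub>" "q t \<noteq> \<zero>\<^bsub>K\<^esub>"
        using free_nalg_carrierD(1) [OF c(1)] free_nalg_carrierD(1) [OF c(2)] by auto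
      then show "m \<in> {Mul s t | s t. s \<in> X \<and> t \<in> Y}" using st p q by auto
    qed
  qed (use prod in auto)
  then show ?thesis using id_cong_mult [OF p(1) q(1)] reducible_cong by blast
qed

end

end

section \<open>Normal forms and leading terms\<close>

text \<open>
  Lowest rather than highest terms, so that power series have leading terms as well.
\<close>

definition lead :: "'k ring \<Rightarrow> ('i \<times> 'i) set \<Rightarrow> ('i \<Rightarrow> 'k) \<Rightarrow> 'i \<Rightarrow> bool" where
  "lead K r f i \<longleftrightarrow> f i \<noteq> \<zero>\<^bsub>K\<^esub> \<and> (\<forall>j. (j, i) \<in> r \<longrightarrow> f j = \<zero>\<^bsub>K\<^esub>)"

lemma eval_monomial_eq_zero:
  assumes A: "nonassoc_algebra K A" and v: "range v \<subseteq> carrier A"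
    and x: "degree_in x m \<noteq> 0" "v x = \<zero>\<^bsub>A\<^esub>"
  shows "eval_monomial A v m = \<zero>\<^bsub>A\<^esub>"
proof -
  interpret nonassoc_algebra K A by fact
  show ?thesis
    using x by (induction m) (auto simp: zero_mult mult_zero eval_monomial_closed [OF v] split: if_splits)
qed

lemma eval_monomial_cong:
  assumes "\<And>x. degree_in x m \<noteq> 0 \<Longrightarrow> v x = w x"
  shows "eval_monomial A v m = eval_monomial A w m"
  using assms by (induction m) auto

text \<open>
  The pattern common to Lie and anticommutative algebras. The monomials in \<open>N\<close> span the relatively free
  algebra, by rewriting that preserves the degree in each variable; and they are independent,
  because their values in the model have distinct leading indices \<open>l\<close>. Consequently, the identities of
  the variety can be read off from normal forms, and free algebras embed into the model.
\<close>

locale normal_forms = K: field K for K :: "'k ring" +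
  fixes I :: "(nat na_monomial \<Rightarrow> 'k) set"
    and \<mu> :: "('i \<Rightarrow> 'k) \<Rightarrow> ('i \<Rightarrow> 'k) \<Rightarrow> 'i \<Rightarrow> 'k"
    and w :: "nat \<Rightarrow> 'i \<Rightarrow> 'k"
    and N :: "nat na_monomial set" and r :: "('i \<times> 'i) set" and l :: "nat na_monomial \<Rightarrow> 'i"
  assumes I: "defining_identities K I"
    and model: "in_variety K I (fun_algebra K \<mu>)"
    and w_closed: "\<And>x i. w x i \<in> carrier K"
    and wf: "wf r" and trans: "trans r" and total: "total r"
    and l_inj: "inj_on l N"
    and l_lead: "\<And>t. t \<in> N \<Longrightarrow> lead K r (eval_monomial (fun_algebra K \<mu>) w t) (l t)"
    and reduction: "\<And>m. reducible K I {t \<in> N. \<forall>x. degree_in x t = degree_in x m} (nmono K m)"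
begin

abbreviation "W \<equiv> fun_algebra K \<mu>"

lemma W: "nonassoc_algebra K W"
  using model by (simp add: in_variety_def)

sublocale W: nonassoc_algebra K W
  by (rule W)

lemma w_range: "range w \<subseteq> carrier W"
  using w_closed by auto

lemmas P_closed = poly_closed [OF K.field_axioms]

lemma eval_step:
  assumes "c \<in> carrier K" "g \<in> carrier (free_nalg K)"
  shows "eval_na K W w (c \<odot>\<^bsub>free_nalg K\<^esub> nmono K m \<oplus>\<^bsub>free_nalg K\<^esub> g) i
    = c \<otimes>\<^bsub>K\<^esub> eval_monomial W w m i \<oplus>\<^bsub>K\<^esub> eval_na K W w g i"
  using assms
  by (simp add: W.eval_na_add [OF _ _ w_range] W.eval_na_smult [OF _ _ w_range] P_closed
      eval_na_nmono [OF K.field_axioms W w_range])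

lemma monomial_closed: "eval_monomial W w m i \<in> carrier K"
  using W.eval_monomial_closed [OF w_range, of m] by simp

lemma eval_above_lead:
  assumes "g \<in> carrier (free_nalg K)" "{m. g m \<noteq> \<zero>\<^bsub>K\<^esub>} \<subseteq> {t \<in> N. (i, l t) \<in> r}"
  shows "eval_na K W w g i = \<zero>\<^bsub>K\<^esub>"
  using assms
proof (induction rule: poly_induct [OF K.field_axioms, consumes 2, case_names zero add])
  case zero
  then show ?case by (simp add: W.eval_na_zero)
next
  case (add c m g)
  then have "eval_monomial W w m i = \<zero>\<^bsub>K\<^esub>" using l_lead [of m] by (auto simp: lead_def)
  with add show ?case by (simp add: eval_step)
qed

lemma eval_lead:
  assumes p: "p \<in> carrier (free_nalg K)" "{m. p m \<noteq> \<zero>\<^bsub>K\<^esub>} \<subseteq> N" "p \<noteq> \<zero>\<^bsub>free_nalg K\<^esub>"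
  shows "\<exists>t\<in>N. lead K r (eval_na K W w p) (l t)"
proof -
  let ?L = "l ` {m. p m \<noteq> \<zero>\<^bsub>K\<^esub>}"
  obtain t0 where "p t0 \<noteq> \<zero>\<^bsub>K\<^esub>" using p(3) by (auto simp: free_nalg_def)
  then have "l t0 \<in> ?L" by blast
  then obtain i where i: "i \<in> ?L" "\<And>j. (j, i) \<in> r \<Longrightarrow> j \<notin> ?L"
    by (rule wfE_min [OF wf]) blast
  then obtain t where t: "p t \<noteq> \<zero>\<^bsub>K\<^esub>" and "i = l t" by blast
  then have min: "(l s, l t) \<notin> r" if "p s \<noteq> \<zero>\<^bsub>K\<^esub>" for s
    using i(2) [of "l s"] that by blast
  have tN: "t \<in> N" using t p by auto
  note dec = poly_decompose [OF K.field_axioms p(1), of t]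
  have pt: "p t \<in> carrier K" using free_nalg_carrierD [OF p(1)] by simp
  have above: "(l t, l s) \<in> r" if "(p(t := \<zero>\<^bsub>K\<^esub>)) s \<noteq> \<zero>\<^bsub>K\<^esub>" for s
  proof -
    have s: "s \<noteq> t" "p s \<noteq> \<zero>\<^bsub>K\<^esub>" "s \<in> N" using that p(2) by (auto split: if_splits)
    then have "l s \<noteq> l t" using l_inj tN by (auto dest: inj_onD)
    then show ?thesis using min [OF s(2)] total by (auto simp: total_on_def)
  qed
  have rest: "eval_na K W w (p(t := \<zero>\<^bsub>K\<^esub>)) i = \<zero>\<^bsub>K\<^esub>" if "i = l t \<or> (i, l t) \<in> r" for i
  proof (rule eval_above_lead [OF dec(2)])
    have "(i, l s) \<in> r" if "(p(t := \<zero>\<^bsub>K\<^esub>)) s \<noteq> \<zero>\<^bsub>K\<^esub>" for s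
      using above [OF that] \<open>i = l t \<or> (i, l t) \<in> r\<close> trans by (auto intro: transD)
    then show "{s. (p(t := \<zero>\<^bsub>K\<^esub>)) s \<noteq> \<zero>\<^bsub>K\<^esub>} \<subseteq> {s \<in> N. (i, l s) \<in> r}"
      using p(2) by (auto split: if_splits)
  qed
  have "eval_na K W w p i = p t \<otimes>\<^bsub>K\<^esub> eval_monomial W w t i" if "i = l t \<or> (i, l t) \<in> r" for i
    by (subst dec(1)) (simp add: eval_step dec(2) pt rest that monomial_closed)
  then have "lead K r (eval_na K W w p) (l t)"
    using l_lead [OF tN] t pt monomial_closed by (auto simp: lead_def K.integral_iff)
  then show ?thesis using tN by blast
qed

lemma normal_eval_zero:
  assumes "p \<in> carrier (free_nalg K)" "{m. p m \<noteq> \<zero>\<^bsub>K\<^esub>} \<subseteq> N" "eval_na K W w p = \<zero>\<^bsub>W\<^esub>"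
  shows "p = \<zero>\<^bsub>free_nalg K\<^esub>"
  using eval_lead [OF assms(1,2)] assms(3) by (auto simp: lead_def)

lemma reduction_poly:
  assumes "f \<in> carrier (free_nalg K)" "{m. f m \<noteq> \<zero>\<^bsub>K\<^esub>} \<subseteq> X"
    and X: "\<And>m n. \<lbrakk>m \<in> X; \<forall>x. degree_in x n = degree_in x m\<rbrakk> \<Longrightarrow> n \<in> X"
  obtains p where "id_cong K I f p" "{m. p m \<noteq> \<zero>\<^bsub>K\<^esub>} \<subseteq> N \<inter> X"
proof -
  have "reducible K I (N \<inter> X) f"
  proof (rule reducible_poly [OF K.field_axioms I assms(1,2)])
    fix m assume "m \<in> X"
    then show "reducible K I (N \<inter> X) (nmono K m)"
      by (intro reducible_mono [OF K.field_axioms I reduction]) (use X in blast)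
  qed
  then show ?thesis using that by (auto simp: reducible_def)
qed

text \<open>
  Rewriting preserves degrees, so the normal forms of a homogeneous component of \<open>f\<close> and of the
  remainder of \<open>f\<close> share no monomials. If \<open>f\<close> is an identity, their sum vanishes, hence so does each.
\<close>

lemma homogeneous: "homogeneous_variety K I"
  unfolding homogeneous_variety_def
proof (intro allI impI)
  fix f d assume f: "variety_identity K I f"
  define X where "X = {m :: nat na_monomial. \<forall>x. degree_in x m = d x}"
  define g h where "g = homogeneous_component K d f" and "h m = (if m \<in> X then \<zero>\<^bsub>K\<^esub> else f m)" for m
  have fc: "f \<in> carrier (free_nalg K)" using f by (simp add: variety_identity_def)
  note fD = free_nalg_carrierD [OF fc]
  have "finite {m. g m \<noteq> \<zero>\<^bsub>K\<^esub>}" "finite {m. h m \<noteq> \<zero>\<^bsub>K\<^esub>}"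
    by (auto intro: finite_subset [OF _ fD(2)] simp: g_def h_def homogeneous_component_def)
  then have gh: "g \<in> carrier (free_nalg K)" "h \<in> carrier (free_nalg K)"
    using fD(1) by (auto simp: free_nalg_def g_def h_def homogeneous_component_def)
  obtain p where p: "id_cong K I g p" "{m. p m \<noteq> \<zero>\<^bsub>K\<^esub>} \<subseteq> N \<inter> X"
    by (rule reduction_poly [OF gh(1), of X]) (auto simp: g_def homogeneous_component_def X_def split: if_splits)
  obtain q where q: "id_cong K I h q" "{m. q m \<noteq> \<zero>\<^bsub>K\<^esub>} \<subseteq> N \<inter> - X"
    by (rule reduction_poly [OF gh(2), of "- X"]) (auto simp: h_def X_def split: if_splits)
  note pq = id_cong_carrier(2) [OF K.field_axioms I p(1)] id_cong_carrier(2) [OF K.field_axioms I q(1)]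
  have "f = g \<oplus>\<^bsub>free_nalg K\<^esub> h"
    using fD(1) by (auto simp: free_nalg_def g_def h_def homogeneous_component_def X_def fun_eq_iff)
  then have cong: "id_cong K I f (p \<oplus>\<^bsub>free_nalg K\<^esub> q)"
    using id_cong_add [OF K.field_axioms I p(1) q(1)] by simp
  have "eval_na K W w f = \<zero>\<^bsub>W\<^esub>"
    using variety_identity_all_types [OF I f model] w_range unfolding satisfies_def by blast
  then have "p \<oplus>\<^bsub>free_nalg K\<^esub> q = \<zero>\<^bsub>free_nalg K\<^esub>"
    using id_cong_all_types [OF K.field_axioms I cong model w_range]
    by (intro normal_eval_zero P_closed pq) (use p q support_add [OF K.field_axioms, of p q] \<open>eval_na K W w f = \<zero>\<^bsub>W\<^esub>\<close> in auto)
  then have 0: "p m \<oplus>\<^bsub>K\<^esub> q m = \<zero>\<^bsub>K\<^esub>" for m by (auto simp: free_nalg_def fun_eq_iff)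
  have "p m = \<zero>\<^bsub>K\<^esub>" for m
    using 0 [of m] p(2) q(2) free_nalg_carrierD(1) [OF pq(1), of m]
    by (cases "m \<in> X") (auto simp: subset_iff, metis K.r_zero)
  then have "p = \<zero>\<^bsub>free_nalg K\<^esub>" by (auto simp: free_nalg_def)
  then show "variety_identity K I (homogeneous_component K d f)"
    using p(1) by (simp add: variety_identity_iff [OF K.field_axioms I] g_def)
qed

text \<open>
  Elements are values of polynomials in normal form, whose values in the model have leading terms;
  in particular \<open>\<theta>\<close> is injective. Enumerating the generators leaves infinitely many variables
  without a value; these are sent to zero, and monomials containing them
  are dropped from the polynomials that represent elements.
\<close>

lemma free_alg_leads:
  fixes G :: "('k, 'a) module"
  assumes free: "free_alg K I G Y" and Y: "finite Y"
  obtains \<theta> where "\<theta> \<in> alg_hom K G W"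
    "\<And>u. \<lbrakk>u \<in> carrier G; u \<noteq> \<zero>\<^bsub>G\<^esub>\<rbrakk> \<Longrightarrow> \<exists>t\<in>N. lead K r (\<theta> u) (l t)"
proof -
  have G: "in_variety K I G" and G': "nonassoc_algebra K G" and YG: "Y \<subseteq> carrier G"
    using free by (auto simp: free_alg_def in_variety_def)
  interpret G: nonassoc_algebra K G by fact
  obtain e where e: "bij_betw e {0..<card Y} Y" using ex_bij_betw_nat_finite [OF Y] by blast
  define n where "n = card Y"
  define v where "v i = (if i < n then e i else \<zero>\<^bsub>G\<^esub>)" for i
  have v: "range v \<subseteq> carrier G" using bij_betwE [OF e] YG by (auto simp: v_def n_def)
  have "(\<lambda>y. w (inv_into {0..<n} e y)) \<in> Y \<rightarrow> carrier W" using w_range by auto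
  from free_alg_extension_all_types [OF I free model this]
  obtain \<theta> where \<theta>: "\<theta> \<in> alg_hom K G W" and \<theta>Y: "\<forall>y\<in>Y. \<theta> y = w (inv_into {0..<n} e y)" by blast
  have \<theta>v: "\<theta> (v i) = w i" if "i < n" for i
    using that \<theta>Y e bij_betwE [OF e] by (simp add: v_def n_def bij_betw_inv_into_left)
  have gen: "eval_na K G v ` carrier (free_nalg K) = carrier G"
  proof (rule free_alg_generated [OF I free G.subalgebra_eval_image [OF v]])
    show "Y \<subseteq> eval_na K G v ` carrier (free_nalg K)"
    proof
      fix y assume "y \<in> Y"
      then have "y \<in> e ` {0..<n}" using bij_betw_imp_surj_on [OF e] by (simp add: n_def)
      then obtain i where "i < n" "y = e i" by auto
      then show "y \<in> eval_na K G v ` carrier (free_nalg K)"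
        by (intro image_eqI [of _ _ "nvar K i"] P_closed) (simp add: G.eval_na_nvar [OF v] v_def)
    qed
  qed
  define X where "X = {m :: nat na_monomial. \<forall>i\<ge>n. degree_in i m = 0}"
  have "\<exists>t\<in>N. lead K r (\<theta> u) (l t)" if u: "u \<in> carrier G" "u \<noteq> \<zero>\<^bsub>G\<^esub>" for u
  proof -
    obtain f where f: "f \<in> carrier (free_nalg K)" "u = eval_na K G v f" using u gen by blast
    note fD = free_nalg_carrierD [OF f(1)]
    define g where "g m = (if m \<in> X then f m else \<zero>\<^bsub>K\<^esub>)" for m
    have g: "g \<in> carrier (free_nalg K)"
      using fD by (auto simp: free_nalg_def g_def intro: finite_subset [OF _ fD(2)])
    have "eval_na K G v g = (\<Oplus>\<^bsub>G\<^esub>m \<in> {m. f m \<noteq> \<zero>\<^bsub>K\<^esub>}. g m \<odot>\<^bsub>G\<^esub> eval_monomial G v m)"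
      by (rule G.eval_na_superset [OF g v fD(2)]) (auto simp: g_def)
    also have "\<dots> = u"
      unfolding f(2) eval_na_def
    proof (rule G.M.finsum_cong')
      fix m assume "m \<in> {m. f m \<noteq> \<zero>\<^bsub>K\<^esub>}"
      show "g m \<odot>\<^bsub>G\<^esub> eval_monomial G v m = f m \<odot>\<^bsub>G\<^esub> eval_monomial G v m"
      proof (cases "m \<in> X")
        case False
        then obtain i where "i \<ge> n" "degree_in i m \<noteq> 0" by (auto simp: X_def)
        then have "eval_monomial G v m = \<zero>\<^bsub>G\<^esub>"
          by (intro eval_monomial_eq_zero [OF G' v]) (auto simp: v_def)
        then show ?thesis using fD by (simp add: g_def)
      qed (simp add: g_def)
    qed (use fD G.eval_monomial_closed [OF v] in auto)
    finally have ug: "u = eval_na K G v g" by simp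
    obtain p where p: "id_cong K I g p" "{m. p m \<noteq> \<zero>\<^bsub>K\<^esub>} \<subseteq> N \<inter> X"
      by (rule reduction_poly [OF g, of X]) (auto simp: g_def X_def split: if_splits)
    note pc = id_cong_carrier(2) [OF K.field_axioms I p(1)]
    have up: "u = eval_na K G v p" using ug id_cong_all_types [OF K.field_axioms I p(1) G v] by simp
    have "\<theta> u = eval_na K W (\<lambda>x. \<theta> (v x)) p"
      unfolding up by (rule alg_hom_eval_na [OF G' W \<theta> pc v])
    also have "\<dots> = eval_na K W w p"
    proof (rule W.eval_na_cong [OF pc _ w_range])
      show "range (\<lambda>x. \<theta> (v x)) \<subseteq> carrier W" using v alg_homD(1) [OF \<theta>] by blast
      fix m assume "p m \<noteq> \<zero>\<^bsub>K\<^esub>"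
      then have "m \<in> X" using p(2) by blast
      then have "i < n" if "degree_in i m \<noteq> 0" for i
        using that by (cases "n \<le> i") (auto simp: X_def)
      then show "eval_monomial W (\<lambda>x. \<theta> (v x)) m = eval_monomial W w m"
        by (intro eval_monomial_cong \<theta>v)
    qed
    finally have "\<theta> u = eval_na K W w p" .
    moreover have "p \<noteq> \<zero>\<^bsub>free_nalg K\<^esub>"
    proof
      assume "p = \<zero>\<^bsub>free_nalg K\<^esub>"
      then show False using up u(2) G.eval_na_zero [of v] by simp
    qed
    ultimately show ?thesis using eval_lead [OF pc] p(2) by simp
  qed
  then show ?thesis using that \<theta> by blast
qed

text \<open>
  It suffices to check the criterion on elements with different leading indices, as a multiple of
  \<open>u\<close> can be subtracted from \<open>v\<close> to remove the coefficient of \<open>v\<close> at the leading index of \<open>u\<close>; if the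
  difference were nonzero, its leading index would differ from that of \<open>u\<close>.
\<close>

lemma MLM:
  assumes crit: "\<And>f g s t. \<lbrakk>f \<in> carrier W; g \<in> carrier W; s \<in> N; t \<in> N; s \<noteq> t; lead K r f (l s); lead K r g (l t);
      if f \<otimes>\<^bsub>W\<^esub> f = \<zero>\<^bsub>W\<^esub> then g \<otimes>\<^bsub>W\<^esub> f = \<zero>\<^bsub>W\<^esub> else (f \<otimes>\<^bsub>W\<^esub> f) \<otimes>\<^bsub>W\<^esub> g = (g \<otimes>\<^bsub>W\<^esub> f) \<otimes>\<^bsub>W\<^esub> f\<rbrakk> \<Longrightarrow> False"
  shows "MLM_variety TYPE('f) TYPE('a) K I"
proof (rule MLM_varietyI [OF K.field_axioms I homogeneous])
  fix G :: "('k, 'a) module" and Y u v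
  assume free: "free_alg K I G Y" "finite Y" and uv: "u \<in> carrier G" "v \<in> carrier G" "u \<noteq> \<zero>\<^bsub>G\<^esub>"
    and vu: "if u \<otimes>\<^bsub>G\<^esub> u = \<zero>\<^bsub>G\<^esub> then v \<otimes>\<^bsub>G\<^esub> u = \<zero>\<^bsub>G\<^esub> else u \<otimes>\<^bsub>G\<^esub> u \<otimes>\<^bsub>G\<^esub> v = v \<otimes>\<^bsub>G\<^esub> u \<otimes>\<^bsub>G\<^esub> u"
  have G': "nonassoc_algebra K G" using free by (auto simp: free_alg_def in_variety_def)
  interpret G: nonassoc_algebra K G by fact
  obtain \<theta> where \<theta>: "\<theta> \<in> alg_hom K G W"
    and leads: "\<And>u. \<lbrakk>u \<in> carrier G; u \<noteq> \<zero>\<^bsub>G\<^esub>\<rbrakk> \<Longrightarrow> \<exists>t\<in>N. lead K r (\<theta> u) (l t)"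
    using free_alg_leads [OF free] by blast
  note \<theta>D = alg_homD [OF \<theta>]
  have \<theta>0: "\<theta> \<zero>\<^bsub>G\<^esub> = \<zero>\<^bsub>W\<^esub>" by (rule alg_hom_zero [OF G' W \<theta>])
  have \<theta>_zero: "\<theta> x = \<zero>\<^bsub>W\<^esub> \<longleftrightarrow> x = \<zero>\<^bsub>G\<^esub>" if "x \<in> carrier G" for x
    using leads [OF that] \<theta>0 by (cases "x = \<zero>\<^bsub>G\<^esub>") (auto simp: lead_def)
  obtain s where s: "s \<in> N" "lead K r (\<theta> u) (l s)" using leads uv by blast
  have uK: "\<theta> u (l s) \<in> carrier K" "\<theta> v (l s) \<in> carrier K" "\<theta> u (l s) \<noteq> \<zero>\<^bsub>K\<^esub>"
    using \<theta>D(1) [OF uv(1)] \<theta>D(1) [OF uv(2)] s by (auto simp: lead_def)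
  define c where "c = \<theta> v (l s) \<otimes>\<^bsub>K\<^esub> inv\<^bsub>K\<^esub> (\<theta> u (l s))"
  have inv: "inv\<^bsub>K\<^esub> (\<theta> u (l s)) \<in> carrier K" "inv\<^bsub>K\<^esub> (\<theta> u (l s)) \<otimes>\<^bsub>K\<^esub> \<theta> u (l s) = \<one>\<^bsub>K\<^esub>"
    using K.field_Units uK by auto
  have c: "c \<in> carrier K" "c \<otimes>\<^bsub>K\<^esub> \<theta> u (l s) = \<theta> v (l s)"
    using uK inv by (auto simp: c_def K.m_assoc)
  define v' where "v' = v \<oplus>\<^bsub>G\<^esub> (\<ominus>\<^bsub>K\<^esub> c) \<odot>\<^bsub>G\<^esub> u"
  have v': "v' \<in> carrier G" using uv c by (simp add: v'_def)
  have "v' = \<zero>\<^bsub>G\<^esub>"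
  proof (rule ccontr)
    assume "v' \<noteq> \<zero>\<^bsub>G\<^esub>"
    then obtain t where t: "t \<in> N" "lead K r (\<theta> v') (l t)" using leads v' by blast
    have "\<theta> v' (l s) = \<zero>\<^bsub>K\<^esub>"
      using uv c uK by (simp add: v'_def \<theta>D K.l_minus K.r_neg)
    then have st: "s \<noteq> t" using t by (auto simp: lead_def)
    have vu': "if u \<otimes>\<^bsub>G\<^esub> u = \<zero>\<^bsub>G\<^esub> then v' \<otimes>\<^bsub>G\<^esub> u = \<zero>\<^bsub>G\<^esub> else u \<otimes>\<^bsub>G\<^esub> u \<otimes>\<^bsub>G\<^esub> v' = v' \<otimes>\<^bsub>G\<^esub> u \<otimes>\<^bsub>G\<^esub> u"
      using vu uv c by (auto simp: v'_def G.mult_l_distr G.mult_r_distr G.smult_mult_l G.smult_mult_r split: if_splits)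
    have "if \<theta> u \<otimes>\<^bsub>W\<^esub> \<theta> u = \<zero>\<^bsub>W\<^esub> then \<theta> v' \<otimes>\<^bsub>W\<^esub> \<theta> u = \<zero>\<^bsub>W\<^esub>
        else (\<theta> u \<otimes>\<^bsub>W\<^esub> \<theta> u) \<otimes>\<^bsub>W\<^esub> \<theta> v' = (\<theta> v' \<otimes>\<^bsub>W\<^esub> \<theta> u) \<otimes>\<^bsub>W\<^esub> \<theta> u"
      using vu' uv v' \<theta>_zero [of "u \<otimes>\<^bsub>G\<^esub> u"] \<theta>_zero [of "v' \<otimes>\<^bsub>G\<^esub> u"]
      by (simp add: \<theta>D(3) [symmetric] del: fun_algebra_simps split: if_splits)
    from crit [OF \<theta>D(1) [OF uv(1)] \<theta>D(1) [OF v'] s(1) t(1) st s(2) t(2) this] show False .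
  qed
  have cu: "c \<odot>\<^bsub>G\<^esub> u \<in> carrier G" using c uv by simp
  have "v \<oplus>\<^bsub>G\<^esub> \<ominus>\<^bsub>G\<^esub> (c \<odot>\<^bsub>G\<^esub> u) = \<zero>\<^bsub>G\<^esub>"
    using \<open>v' = \<zero>\<^bsub>G\<^esub>\<close> c uv by (simp add: v'_def G.smult_l_minus)
  from G.M.minus_equality [OF this] cu uv have "v = c \<odot>\<^bsub>G\<^esub> u" by simp
  then show "\<exists>c\<in>carrier K. v = c \<odot>\<^bsub>G\<^esub> u" using c by blast
qed

end

section \<open>Anticommutative algebras\<close>

lemma lead_unique: "\<lbrakk>total r; lead K r f i; lead K r f j\<rbrakk> \<Longrightarrow> i = j"
  by (auto simp: lead_def total_on_def)

text \<open>
  A well-founded linear order on monomials, given by numbering them, for which \<^const>\<open>Mul\<close> is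
  monotone in both arguments.
\<close>

primrec tree_code :: "nat na_monomial \<Rightarrow> nat" where
  "tree_code (Sym x) = 2 * x"
| "tree_code (Mul s t) = Suc (2 * prod_encode (tree_code s, tree_code t))"

lemma tree_code_eq_iff: "tree_code s = tree_code t \<longleftrightarrow> s = t"
proof
  show "tree_code s = tree_code t \<Longrightarrow> s = t"
  proof (induction s arbitrary: t)
    case (Sym x)
    then show ?case by (cases t) (simp_all, presburger)
  next
    case (Mul s1 s2)
    show ?case
    proof (cases t)
      case (Sym x)
      then show ?thesis using Mul.prems by simp presburger
    next
      case (Mul t1 t2)
      then show ?thesis using Mul.prems Mul.IH by (auto simp: inj_eq [OF inj_prod_encode])
    qed
  qed
qed simp

lemma tree_code_Mul_mono:
  assumes "tree_code s \<le> tree_code s'" "tree_code t \<le> tree_code t'"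
  shows "tree_code (Mul s t) \<le> tree_code (Mul s' t')"
proof -
  have "triangle m \<le> triangle n" if "m \<le> n" for m n
    unfolding triangle_def using that by (intro div_le_mono mult_le_mono) auto
  then have "triangle (tree_code s + tree_code t) \<le> triangle (tree_code s' + tree_code t')"
    using assms by (meson add_mono)
  then show ?thesis using assms by (simp add: prod_encode_def add_mono)
qed

lemma total_tree_code: "total (measure tree_code)"
  by (auto simp: total_on_def tree_code_eq_iff [symmetric])

text \<open>
  The free anticommutative algebra, completed to all functions on monomials; only the monomials with
  sorted factors matter. In characteristic 2 the defining identity is commutativity, squares survive,
  and a monomial with two equal factors is a basis element; otherwise squares vanish.
\<close>

definition ac_mult :: "'k ring \<Rightarrow> (nat na_monomial \<Rightarrow> 'k) \<Rightarrow> (nat na_monomial \<Rightarrow> 'k) \<Rightarrow> nat na_monomial \<Rightarrow> 'k" where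
  "ac_mult K f g m = (case m of Sym x \<Rightarrow> \<zero>\<^bsub>K\<^esub>
     | Mul s t \<Rightarrow> if tree_code s < tree_code t then f s \<otimes>\<^bsub>K\<^esub> g t \<ominus>\<^bsub>K\<^esub> f t \<otimes>\<^bsub>K\<^esub> g s
         else if s = t \<and> \<one>\<^bsub>K\<^esub> \<oplus>\<^bsub>K\<^esub> \<one>\<^bsub>K\<^esub> = \<zero>\<^bsub>K\<^esub> then f s \<otimes>\<^bsub>K\<^esub> g s else \<zero>\<^bsub>K\<^esub>)"

lemma ac_mult_simps [simp]:
  "ac_mult K f g (Sym x) = \<zero>\<^bsub>K\<^esub>"
  "tree_code s < tree_code t \<Longrightarrow> ac_mult K f g (Mul s t) = f s \<otimes>\<^bsub>K\<^esub> g t \<ominus>\<^bsub>K\<^esub> f t \<otimes>\<^bsub>K\<^esub> g s"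
  "tree_code t < tree_code s \<Longrightarrow> ac_mult K f g (Mul s t) = \<zero>\<^bsub>K\<^esub>"
  "\<one>\<^bsub>K\<^esub> \<oplus>\<^bsub>K\<^esub> \<one>\<^bsub>K\<^esub> = \<zero>\<^bsub>K\<^esub> \<Longrightarrow> ac_mult K f g (Mul s s) = f s \<otimes>\<^bsub>K\<^esub> g s"
  "\<one>\<^bsub>K\<^esub> \<oplus>\<^bsub>K\<^esub> \<one>\<^bsub>K\<^esub> \<noteq> \<zero>\<^bsub>K\<^esub> \<Longrightarrow> ac_mult K f g (Mul s s) = \<zero>\<^bsub>K\<^esub>"
  by (auto simp: ac_mult_def)

primrec ac_normal :: "'k ring \<Rightarrow> nat na_monomial \<Rightarrow> bool" where
  "ac_normal K (Sym x) = True"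
| "ac_normal K (Mul s t) = (ac_normal K s \<and> ac_normal K t \<and>
     (tree_code s < tree_code t \<or> s = t \<and> \<one>\<^bsub>K\<^esub> \<oplus>\<^bsub>K\<^esub> \<one>\<^bsub>K\<^esub> = \<zero>\<^bsub>K\<^esub>))"

abbreviation "sorted_Mul s t \<equiv> (if tree_code s \<le> tree_code t then Mul s t else Mul t s)"

context
  fixes K :: "'k ring"
  assumes K: "field K"
begin

interpretation K: field K by (rule K)

lemma anticommutative_defining: "defining_identities K (anticommutative_identities K)"
  by (simp add: defining_identities_def anticommutative_identities_def Let_def poly_closed [OF K])

lemma anticommutative_iff:
  fixes A :: "('k, 'b) module"
  assumes "nonassoc_algebra K A"
  shows "in_variety K (anticommutative_identities K) A \<longleftrightarrow>
    (\<forall>x\<in>carrier A. \<forall>y\<in>carrier A. x \<otimes>\<^bsub>A\<^esub> y \<oplus>\<^bsub>A\<^esub> y \<otimes>\<^bsub>A\<^esub> x = \<zero>\<^bsub>A\<^esub>)"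
proof -
  interpret nonassoc_algebra K A by fact
  let ?f = "nvar K 1 \<otimes>\<^bsub>free_nalg K\<^esub> nvar K 2 \<oplus>\<^bsub>free_nalg K\<^esub> nvar K 2 \<otimes>\<^bsub>free_nalg K\<^esub> nvar K (1 :: nat)"
  have eval: "eval_na K A v ?f = v 1 \<otimes>\<^bsub>A\<^esub> v 2 \<oplus>\<^bsub>A\<^esub> v 2 \<otimes>\<^bsub>A\<^esub> v 1" if "range v \<subseteq> carrier A" for v
    by (simp add: eval_na_add [OF _ _ that] free_nalg_closed eval_na_product_of_variables [OF that])
  have "x \<otimes>\<^bsub>A\<^esub> y \<oplus>\<^bsub>A\<^esub> y \<otimes>\<^bsub>A\<^esub> x = \<zero>\<^bsub>A\<^esub>" if "satisfies K A ?f" "x \<in> carrier A" "y \<in> carrier A" for x y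
  proof -
    let ?v = "\<lambda>i :: nat. if i = 1 then x else y"
    have v: "range ?v \<subseteq> carrier A" using that by auto
    show ?thesis using that(1) eval [OF v] v by (simp add: satisfies_def)
  qed
  moreover have "satisfies K A ?f" if "\<forall>x\<in>carrier A. \<forall>y\<in>carrier A. x \<otimes>\<^bsub>A\<^esub> y \<oplus>\<^bsub>A\<^esub> y \<otimes>\<^bsub>A\<^esub> x = \<zero>\<^bsub>A\<^esub>"
    unfolding satisfies_def
  proof (intro allI impI)
    fix v :: "nat \<Rightarrow> 'b" assume v: "range v \<subseteq> carrier A"
    then have "v i \<in> carrier A" for i by auto
    then show "eval_na K A v ?f = \<zero>\<^bsub>A\<^esub>" using that eval [OF v] by simp
  qed
  ultimately show ?thesis
    using assms by (auto simp: in_variety_def anticommutative_identities_def Let_def)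
qed

lemma ac_model: "in_variety K (anticommutative_identities K) (fun_algebra K (ac_mult K))"
proof -
  have alg: "nonassoc_algebra K (fun_algebra K (ac_mult K))"
    by (rule nonassoc_algebra_fun_algebra [OF K])
      (auto simp: ac_mult_def K.minus_eq K.l_distr K.r_distr K.minus_add K.a_ac K.m_ac K.r_minus
        split: na_monomial.split)
  have "ac_mult K f g m \<oplus>\<^bsub>K\<^esub> ac_mult K g f m = \<zero>\<^bsub>K\<^esub>"
    if f: "\<And>i. f i \<in> carrier K" and g: "\<And>i. g i \<in> carrier K" for f g m
  proof (cases m)
    case (Mul s t)
    consider "tree_code s < tree_code t" | "tree_code t < tree_code s" | "s = t"
      by (metis tree_code_eq_iff linorder_neqE_nat)
    then show ?thesis
    proof cases
      case 1
      then show ?thesis using Mul f g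
        by (simp add: K.minus_eq K.m_comm [OF g f] K.a_assoc K.r_neg1 K.r_neg K.l_neg)
    next
      case 3
      have "f s \<otimes>\<^bsub>K\<^esub> g s \<oplus>\<^bsub>K\<^esub> g s \<otimes>\<^bsub>K\<^esub> f s = (\<one>\<^bsub>K\<^esub> \<oplus>\<^bsub>K\<^esub> \<one>\<^bsub>K\<^esub>) \<otimes>\<^bsub>K\<^esub> (f s \<otimes>\<^bsub>K\<^esub> g s)"
        using f g by (simp add: K.l_distr K.m_comm [of "g s" "f s"])
      then show ?thesis using Mul 3 f g by (cases "\<one>\<^bsub>K\<^esub> \<oplus>\<^bsub>K\<^esub> \<one>\<^bsub>K\<^esub> = \<zero>\<^bsub>K\<^esub>") simp_all
    qed (use Mul in simp)
  qed simp
  then show ?thesis by (auto simp: anticommutative_iff [OF alg] fun_eq_iff)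
qed

lemma ac_eval_normal:
  "ac_normal K t \<Longrightarrow> eval_monomial (fun_algebra K (ac_mult K)) (\<lambda>x. nmono K (Sym x)) t = nmono K t"
proof (induction t)
  case (Mul s t)
  have "ac_mult K (nmono K s) (nmono K t) m = nmono K (Mul s t) m" for m
    using Mul.prems by (cases m) (auto simp: ac_mult_def nmono_def K.minus_eq)
  then have "ac_mult K (nmono K s) (nmono K t) = nmono K (Mul s t)" by (rule ext)
  then show ?case using Mul by auto
qed simp

text \<open>
  Sorting the factors recursively; a monomial with two equal factors is either normal or, if 2 is
  invertible, an identity.
\<close>

lemma ac_reduction:
  "reducible K (anticommutative_identities K)
     {t. ac_normal K t \<and> (\<forall>x. degree_in x t = degree_in x m)} (nmono K m)"
proof (induction m)
  case (Sym x)
  then show ?case by (auto intro: reducible_nmono [OF K anticommutative_defining])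
next
  case (Mul s t)
  let ?I = "anticommutative_identities K"
  let ?Z = "{u. ac_normal K u \<and> (\<forall>x. degree_in x u = degree_in x (Mul s t))}"
  note red_nmono = reducible_nmono [OF K anticommutative_defining]
    and red_cong = reducible_cong [OF K anticommutative_defining]
  note closed = poly_closed [OF K]
  have cong: "id_cong K ?I (nmono K (Mul a b)) (\<ominus>\<^bsub>K\<^esub> \<one>\<^bsub>K\<^esub> \<odot>\<^bsub>free_nalg K\<^esub> nmono K (Mul b a))" for a b
    unfolding id_cong_def
  proof (intro conjI allI impI)
    fix A :: "('k, (nat na_monomial \<Rightarrow> 'k) set) module" and v :: "nat \<Rightarrow> (nat na_monomial \<Rightarrow> 'k) set"
    assume A: "in_variety K ?I A" and v: "range v \<subseteq> carrier A"
    have A': "nonassoc_algebra K A" using A by (simp add: in_variety_def)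
    interpret A: nonassoc_algebra K A by fact
    note e = A.eval_monomial_closed [OF v]
    have "eval_monomial A v b \<otimes>\<^bsub>A\<^esub> eval_monomial A v a \<oplus>\<^bsub>A\<^esub> eval_monomial A v a \<otimes>\<^bsub>A\<^esub> eval_monomial A v b = \<zero>\<^bsub>A\<^esub>"
      using A e by (simp add: anticommutative_iff [OF A'])
    then have "\<ominus>\<^bsub>A\<^esub> (eval_monomial A v b \<otimes>\<^bsub>A\<^esub> eval_monomial A v a) = eval_monomial A v a \<otimes>\<^bsub>A\<^esub> eval_monomial A v b"
      using e by (intro A.M.minus_equality) (auto simp: A.M.a_comm)
    then show "eval_na K A v (nmono K (Mul a b))
        = eval_na K A v (\<ominus>\<^bsub>K\<^esub> \<one>\<^bsub>K\<^esub> \<odot>\<^bsub>free_nalg K\<^esub> nmono K (Mul b a))"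
      using e by (simp add: A.eval_na_smult [OF _ _ v] closed eval_na_nmono [OF K A' v] A.smult_l_minus)
  qed (auto simp: closed)
  have cong0: "id_cong K ?I (nmono K (Mul a a)) \<zero>\<^bsub>free_nalg K\<^esub>" if two: "\<one>\<^bsub>K\<^esub> \<oplus>\<^bsub>K\<^esub> \<one>\<^bsub>K\<^esub> \<noteq> \<zero>\<^bsub>K\<^esub>" for a
    unfolding id_cong_def
  proof (intro conjI allI impI)
    fix A :: "('k, (nat na_monomial \<Rightarrow> 'k) set) module" and v :: "nat \<Rightarrow> (nat na_monomial \<Rightarrow> 'k) set"
    assume A: "in_variety K ?I A" and v: "range v \<subseteq> carrier A"
    have A': "nonassoc_algebra K A" using A by (simp add: in_variety_def)
    interpret A: nonassoc_algebra K A by fact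
    note e = A.eval_monomial_closed [OF v]
    let ?x = "eval_monomial A v a \<otimes>\<^bsub>A\<^esub> eval_monomial A v a" and ?d = "\<one>\<^bsub>K\<^esub> \<oplus>\<^bsub>K\<^esub> \<one>\<^bsub>K\<^esub>"
    have d: "?d \<in> carrier K" "inv\<^bsub>K\<^esub> ?d \<in> carrier K" "inv\<^bsub>K\<^esub> ?d \<otimes>\<^bsub>K\<^esub> ?d = \<one>\<^bsub>K\<^esub>"
      using two K.field_Units by auto
    have "?d \<odot>\<^bsub>A\<^esub> ?x = ?x \<oplus>\<^bsub>A\<^esub> ?x" using e by (simp add: A.smult_l_distr)
    also have "\<dots> = \<zero>\<^bsub>A\<^esub>" using A e by (simp add: anticommutative_iff [OF A'])
    finally have 0: "?d \<odot>\<^bsub>A\<^esub> ?x = \<zero>\<^bsub>A\<^esub>" .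
    have "?x = (inv\<^bsub>K\<^esub> ?d \<otimes>\<^bsub>K\<^esub> ?d) \<odot>\<^bsub>A\<^esub> ?x" using e by (simp only: d) simp
    also have "\<dots> = inv\<^bsub>K\<^esub> ?d \<odot>\<^bsub>A\<^esub> (?d \<odot>\<^bsub>A\<^esub> ?x)" using d e by (intro A.smult_assoc1) auto
    also have "\<dots> = \<zero>\<^bsub>A\<^esub>" using 0 d by simp
    finally show "eval_na K A v (nmono K (Mul a a)) = eval_na K A v \<zero>\<^bsub>free_nalg K\<^esub>"
      by (simp add: eval_na_nmono [OF K A' v] A.eval_na_zero)
  qed (auto simp: closed)
  have "reducible K ?I ?Z (nmono K s \<otimes>\<^bsub>free_nalg K\<^esub> nmono K t)"
  proof (rule reducible_mult [OF K anticommutative_defining Mul.IH])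
    fix a b
    assume a: "a \<in> {u. ac_normal K u \<and> (\<forall>x. degree_in x u = degree_in x s)}"
      and b: "b \<in> {u. ac_normal K u \<and> (\<forall>x. degree_in x u = degree_in x t)}"
    consider "tree_code a < tree_code b" | "tree_code b < tree_code a" | "a = b"
      by (metis tree_code_eq_iff linorder_neqE_nat)
    then show "reducible K ?I ?Z (nmono K (Mul a b))"
    proof cases
      case 1
      then show ?thesis using a b by (intro red_nmono) auto
    next
      case 2
      then have "reducible K ?I ?Z (nmono K (Mul b a))" using a b by (intro red_nmono) auto
      then show ?thesis
        by (rule red_cong [OF cong reducible_smult [OF K anticommutative_defining]]) auto
    next
      case 3
      show ?thesis
      proof (cases "\<one>\<^bsub>K\<^esub> \<oplus>\<^bsub>K\<^esub> \<one>\<^bsub>K\<^esub> = \<zero>\<^bsub>K\<^esub>")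
        case True
        then show ?thesis using a b 3 by (intro red_nmono) auto
      next
        case False
        then show ?thesis unfolding 3
          by (rule red_cong [OF cong0 reducible_zero [OF K anticommutative_defining]])
      qed
    qed
  qed
  then show ?case by (simp only: nmono_mult [OF K])
qed

text \<open>
  Leading monomials multiply, by monotonicity of the order, except that equal leading monomials
  may cancel if the characteristic is not 2.
\<close>

lemma ac_lead_mult:
  assumes f: "\<And>i. f i \<in> carrier K" and g: "\<And>i. g i \<in> carrier K"
    and a: "lead K (measure tree_code) f a" and b: "lead K (measure tree_code) g b"
    and ab: "a \<noteq> b \<or> \<one>\<^bsub>K\<^esub> \<oplus>\<^bsub>K\<^esub> \<one>\<^bsub>K\<^esub> = \<zero>\<^bsub>K\<^esub>"
  shows "lead K (measure tree_code) (ac_mult K f g) (sorted_Mul a b)"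
  unfolding lead_def
proof (intro conjI allI impI)
  have a0: "f a \<noteq> \<zero>\<^bsub>K\<^esub>" "\<And>j. tree_code j < tree_code a \<Longrightarrow> f j = \<zero>\<^bsub>K\<^esub>"
    and b0: "g b \<noteq> \<zero>\<^bsub>K\<^esub>" "\<And>j. tree_code j < tree_code b \<Longrightarrow> g j = \<zero>\<^bsub>K\<^esub>"
    using a b by (auto simp: lead_def)
  have fg: "f a \<otimes>\<^bsub>K\<^esub> g b \<noteq> \<zero>\<^bsub>K\<^esub>" using a0 b0 f g by (simp add: K.integral_iff)
  consider "tree_code a < tree_code b" | "tree_code b < tree_code a" | "a = b"
    by (metis tree_code_eq_iff linorder_neqE_nat)
  then show "ac_mult K f g (sorted_Mul a b) \<noteq> \<zero>\<^bsub>K\<^esub>"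
    by cases (use a0 b0 f g fg ab in \<open>auto simp: K.minus_eq\<close>)
  fix m assume "(m, sorted_Mul a b) \<in> measure tree_code"
  then have less: "tree_code m < tree_code (sorted_Mul a b)" by simp
  have zero: "f s \<otimes>\<^bsub>K\<^esub> g t = \<zero>\<^bsub>K\<^esub>"
    if "m = Mul s t \<or> m = Mul t s" "tree_code (sorted_Mul s t) \<le> tree_code m" for s t
  proof (rule ccontr)
    assume "f s \<otimes>\<^bsub>K\<^esub> g t \<noteq> \<zero>\<^bsub>K\<^esub>"
    then have "f s \<noteq> \<zero>\<^bsub>K\<^esub>" "g t \<noteq> \<zero>\<^bsub>K\<^esub>" using f g by auto
    then have st: "tree_code a \<le> tree_code s" "tree_code b \<le> tree_code t" using a0 b0 not_le by metis+
    have "tree_code (sorted_Mul a b) \<le> tree_code (sorted_Mul s t)"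
      using st by (auto intro!: tree_code_Mul_mono simp del: tree_code.simps)
    then show False using less that by simp
  qed
  show "ac_mult K f g m = \<zero>\<^bsub>K\<^esub>"
  proof (cases m)
    case (Mul s t)
    show ?thesis
    proof (cases "tree_code s \<le> tree_code t")
      case True
      then have "f s \<otimes>\<^bsub>K\<^esub> g t = \<zero>\<^bsub>K\<^esub>" "f t \<otimes>\<^bsub>K\<^esub> g s = \<zero>\<^bsub>K\<^esub>"
        using zero [of s t] zero [of t s] Mul by (auto simp: tree_code_eq_iff)
      then show ?thesis using Mul by (auto simp: ac_mult_def K.minus_eq)
    next
      case False
      then show ?thesis using Mul by (simp add: not_le)
    qed
  qed simp
qed

lemma ac_square_zero:
  assumes "\<And>i. f i \<in> carrier K" "\<one>\<^bsub>K\<^esub> \<oplus>\<^bsub>K\<^esub> \<one>\<^bsub>K\<^esub> \<noteq> \<zero>\<^bsub>K\<^esub>"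
  shows "ac_mult K f f = (\<lambda>m. \<zero>\<^bsub>K\<^esub>)"
proof
  fix m show "ac_mult K f f m = \<zero>\<^bsub>K\<^esub>"
    using assms by (cases m) (auto simp: ac_mult_def K.m_comm K.minus_eq K.r_neg)
qed

text \<open>
  Suppose that the leading monomials \<open>a\<close> of \<open>f\<close> and \<open>b\<close> of \<open>g\<close> differ. If 2 is invertible, \<open>f f = 0\<close> while \<open>g f\<close>
  has the leading monomial \<open>a b\<close> (sorted). In characteristic 2, \<open>f f \<noteq> 0\<close>, and \<open>(f f) g = (g f) f\<close> would
  equate the unordered pairs of factors \<open>{a a, b}\<close> and \<open>{a b, a}\<close>, which forces \<open>a a = a b\<close>.
\<close>

lemma anticommutative_MLM: "MLM_variety TYPE('f) TYPE('a) K (anticommutative_identities K)"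
proof -
  interpret normal_forms K "anticommutative_identities K" "ac_mult K" "\<lambda>x. nmono K (Sym x)"
    "{t. ac_normal K t}" "measure tree_code" "\<lambda>t. t"
  proof (unfold_locales)
    show "lead K (measure tree_code) (eval_monomial (fun_algebra K (ac_mult K)) (\<lambda>x. nmono K (Sym x)) t) t"
      if "t \<in> {t. ac_normal K t}" for t
      using that by (simp add: ac_eval_normal) (auto simp: lead_def nmono_def)
  qed (use ac_model anticommutative_defining ac_reduction total_tree_code
      in \<open>auto simp: nmono_def trans_def\<close>)
  show ?thesis
  proof (rule MLM)
    fix f g :: "nat na_monomial \<Rightarrow> 'k" and a b
    assume fg: "f \<in> carrier W" "g \<in> carrier W" and ab: "a \<noteq> b"
      and a: "lead K (measure tree_code) f a" and b: "lead K (measure tree_code) g b"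
      and crit: "if f \<otimes>\<^bsub>W\<^esub> f = \<zero>\<^bsub>W\<^esub> then g \<otimes>\<^bsub>W\<^esub> f = \<zero>\<^bsub>W\<^esub> else (f \<otimes>\<^bsub>W\<^esub> f) \<otimes>\<^bsub>W\<^esub> g = (g \<otimes>\<^bsub>W\<^esub> f) \<otimes>\<^bsub>W\<^esub> f"
    have f: "f i \<in> carrier K" and g: "g i \<in> carrier K" for i using fg by auto
    have closed: "ac_mult K f f i \<in> carrier K" "ac_mult K g f i \<in> carrier K" for i
      using W.mult_closed [OF fg(1) fg(1)] W.mult_closed [OF fg(2) fg(1)] by auto
    have ba: "lead K (measure tree_code) (ac_mult K g f) (sorted_Mul b a)"
      by (rule ac_lead_mult [OF g f b a]) (use ab in auto)
    show False
    proof (cases "\<one>\<^bsub>K\<^esub> \<oplus>\<^bsub>K\<^esub> \<one>\<^bsub>K\<^esub> = \<zero>\<^bsub>K\<^esub>")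
      case True
      have aa: "lead K (measure tree_code) (ac_mult K f f) (Mul a a)"
        using ac_lead_mult [OF f f a a] True by simp
      have 1: "lead K (measure tree_code) (ac_mult K (ac_mult K f f) g) (sorted_Mul (Mul a a) b)"
        by (rule ac_lead_mult [OF closed(1) g aa b]) (use True in auto)
      have 2: "lead K (measure tree_code) (ac_mult K (ac_mult K g f) f) (sorted_Mul (sorted_Mul b a) a)"
        by (rule ac_lead_mult [OF closed(2) f ba a]) (use True in auto)
      have "ac_mult K (ac_mult K f f) g = ac_mult K (ac_mult K g f) f"
        using crit aa by (auto simp: lead_def split: if_splits)
      from lead_unique [OF total_tree_code 1 [unfolded this] 2]
      have "sorted_Mul (Mul a a) b = sorted_Mul (sorted_Mul b a) a" .
      moreover have "Mul a a \<noteq> a"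
      proof
        assume "Mul a a = a"
        then have "size (Mul a a) = size a" by (rule arg_cong)
        then show False by simp
      qed
      ultimately show False using ab
        by (cases "tree_code (Mul a a) \<le> tree_code b"; cases "tree_code b \<le> tree_code a"; cases "tree_code (sorted_Mul b a) \<le> tree_code a")
          (simp_all del: tree_code.simps)
    next
      case False
      then show False using crit ba ac_square_zero [OF f False] by (simp add: lead_def)
    qed
  qed
qed

end

section \<open>Lyndon words\<close>

lemma list_less_cases:
  fixes u v :: "'x :: linorder list"
  assumes "u < v"
  shows "(\<exists>z. z \<noteq> [] \<and> v = u @ z) \<or> (\<forall>x y. u @ x < v @ y)"
  using assms
proof (induction u arbitrary: v)
  case Nil
  then show ?case by (cases v) auto
next
  case (Cons a u)
  then obtain b v' where v: "v = b # v'" by (cases v) auto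
  show ?case
  proof (cases "a < b")
    case False
    then have "a = b" "u < v'" using Cons.prems v by auto
    then show ?thesis using Cons.IH [of v'] v by auto
  qed (use v in auto)
qed

lemma less_append_right: "z \<noteq> [] \<Longrightarrow> u < u @ (z :: 'x :: linorder list)"
  by (induction u) (cases z, auto)

lemma append_less_append_iff [simp]: "u @ x < u @ y \<longleftrightarrow> x < (y :: 'x :: linorder list)"
  by (induction u) auto

lemma less_append_same_length:
  fixes u v :: "'x :: linorder list"
  assumes "u < v" "length v \<le> length u"
  shows "u @ x < v @ y"
  using list_less_cases [OF assms(1)] assms(2) by auto

definition lyndon :: "'x :: linorder list \<Rightarrow> bool" where
  "lyndon w \<longleftrightarrow> w \<noteq> [] \<and> (\<forall>x y. w = x @ y \<longrightarrow> x \<noteq> [] \<longrightarrow> y \<noteq> [] \<longrightarrow> w < y)"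

lemma lyndonD: "\<lbrakk>lyndon (x @ y); x \<noteq> []; y \<noteq> []\<rbrakk> \<Longrightarrow> x @ y < y"
  by (auto simp: lyndon_def)

lemma lyndon_append_less:
  assumes u: "lyndon u" and v: "lyndon v" and uv: "u < v"
  shows "u @ v < v"
proof -
  have "u @ v < v" if z: "z \<noteq> []" "v = u @ z" for z
  proof -
    have "v < z" using lyndonD [of u z] u v z by (auto simp: lyndon_def)
    then show ?thesis using z by (metis append_less_append_iff)
  qed
  then show ?thesis using list_less_cases [OF uv] by (metis append_Nil2)
qed

lemma proper_suffix_append:
  assumes "u @ v = x @ y" "x \<noteq> []" "y \<noteq> []"
  obtains "y = v" | z where "v = z @ y" "z \<noteq> []" | z where "u = x @ z" "y = z @ v" "z \<noteq> []"
  using assms by (auto simp: append_eq_append_conv2)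

lemma lyndon_append:
  assumes u: "lyndon u" and v: "lyndon v" and uv: "u < v"
  shows "lyndon (u @ v)"
  unfolding lyndon_def
proof (intro conjI allI impI)
  show "u @ v \<noteq> []" using u by (simp add: lyndon_def)
  note uvv = lyndon_append_less [OF assms]
  fix x y assume xy: "u @ v = x @ y" "x \<noteq> []" "y \<noteq> []"
  then show "u @ v < y"
  proof (cases rule: proper_suffix_append)
    case 1
    then show ?thesis using uvv by simp
  next
    case (2 z)
    then have "v < y" using lyndonD [of z y] v xy by simp
    then show ?thesis using uvv by simp
  next
    case (3 z)
    then have "u < z" using lyndonD [of x z] u xy by simp
    then show ?thesis using 3 less_append_same_length [of u z] by simp
  qed
qed

text \<open>
  Otherwise the longer word would have the shorter one as a proper prefix, and the remaining factor
  both as a suffix and as a prefix, so that it is at once greater and smaller than the word.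
\<close>

lemma lyndon_commute:
  assumes "lyndon u" "lyndon v" "u @ v = v @ u"
  shows "u = v"
proof -
  have overlap: "u = v" if "lyndon u" "lyndon v" "v = u @ z" "v = z @ u" for u v z :: "'a list"
  proof (rule ccontr)
    assume "u \<noteq> v"
    then have z: "z \<noteq> []" "u \<noteq> []" using that by (auto simp: lyndon_def)
    have "v < z" using lyndonD [of u z] that z by simp
    moreover have "z < v" using less_append_right [of u z] that z by simp
    ultimately show False by simp
  qed
  obtain z where "u = v @ z \<and> z @ v = u \<or> u @ z = v \<and> v = z @ u"
    using append_eq_append_conv2 [THEN iffD1, OF assms(3)] by blast
  then show ?thesis
  proof (elim disjE conjE)
    assume "u = v @ z" "z @ v = u"
    then show ?thesis using overlap [OF assms(2,1), of z] by simp
  next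
    assume "u @ z = v" "v = z @ u"
    then show ?thesis by (intro overlap [OF assms(1,2), of z]) simp_all
  qed
qed

section \<open>Standard bracketings of Lyndon words\<close>

primrec foliage :: "'x na_monomial \<Rightarrow> 'x list" where
  "foliage (Sym x) = [x]"
| "foliage (Mul s t) = foliage s @ foliage t"

text \<open>
  The bracketings of Lyndon words in which the right factor is the least proper suffix (equivalently
  the longest proper Lyndon suffix) at every node.
\<close>

primrec hall :: "'x :: linorder na_monomial \<Rightarrow> bool" where
  "hall (Sym x) = True"
| "hall (Mul s t) = (hall s \<and> hall t \<and> foliage s < foliage t \<and>
     (case s of Sym x \<Rightarrow> True | Mul s1 s2 \<Rightarrow> foliage t \<le> foliage s2))"

lemma foliage_nonempty [simp]: "foliage t \<noteq> []"
  by (induction t) auto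

lemma hall_lyndon: "hall t \<Longrightarrow> lyndon (foliage t)"
proof (induction t)
  case (Sym x)
  then show ?case by (auto simp: lyndon_def Cons_eq_append_conv)
qed (auto intro: lyndon_append)

lemma hall_min_suffix:
  assumes "hall (Mul s t)" "foliage (Mul s t) = x @ y" "x \<noteq> []" "y \<noteq> []"
  shows "foliage t \<le> y"
  using assms
proof (induction s arbitrary: t x y)
  case (Sym a)
  then have "x = [a] \<and> y = foliage t \<or> (\<exists>z. z \<noteq> [] \<and> foliage t = z @ y)"
    by (auto simp: Cons_eq_append_conv)
  then show ?case using lyndonD hall_lyndon [of t] Sym by (metis hall.simps(2) order_less_imp_le order_refl)
next
  case (Mul s1 s2)
  then have h: "hall (Mul s1 s2)" "hall t" "foliage t \<le> foliage s2" by auto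
  have "foliage (Mul s1 s2) @ foliage t = x @ y" using Mul.prems by simp
  then show ?case
    using Mul.prems(3,4)
  proof (cases rule: proper_suffix_append)
    case (2 z)
    then show ?thesis using lyndonD [of z y] hall_lyndon [OF h(2)] Mul.prems by simp
  next
    case (3 z)
    have "foliage s2 \<le> z" using Mul.IH(1) [OF h(1)] 3 Mul.prems by simp
    also have "z < z @ foliage t" by (rule less_append_right) simp
    finally show ?thesis using 3 h by simp
  qed simp
qed

text \<open>
  The least proper suffix of the foliage determines where the tree splits.
\<close>

lemma foliage_inj_hall: "\<lbrakk>hall s; hall t; foliage s = foliage t\<rbrakk> \<Longrightarrow> s = t"
proof (induction s arbitrary: t)
  case (Sym x)
  then show ?case by (cases t) (auto simp: Cons_eq_append_conv)
next
  case (Mul s1 s2)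
  show ?case
  proof (cases t)
    case (Sym x)
    then show ?thesis using Mul.prems by (auto simp: append_eq_Cons_conv)
  next
    case (Mul t1 t2)
    have "foliage s2 \<le> foliage t2"
      using hall_min_suffix [OF Mul.prems(1), of "foliage t1" "foliage t2"] Mul.prems Mul by simp
    moreover have "foliage t2 \<le> foliage s2"
      using hall_min_suffix [of t1 t2 "foliage s1" "foliage s2"] Mul.prems Mul by simp
    ultimately have "foliage s2 = foliage t2" by simp
    then show ?thesis using Mul.prems Mul.IH Mul by auto
  qed
qed

lemma foliage_commute_hall:
  "\<lbrakk>hall s; hall t; foliage s @ foliage t = foliage t @ foliage s\<rbrakk> \<Longrightarrow> s = t"
  using foliage_inj_hall lyndon_commute hall_lyndon by blast

lemma degree_in_count: "degree_in x t = count (mset (foliage t)) x"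
  by (induction t) auto

lemma same_degrees_iff: "(\<forall>x. degree_in x s = degree_in x t) \<longleftrightarrow> mset (foliage s) = mset (foliage t)"
  by (simp add: degree_in_count multiset_eq_iff)

section \<open>Normal forms in Lie algebras\<close>

context
  fixes K :: "'k ring"
  assumes K: "field K"
begin

interpretation K: field K by (rule K)

lemma lie_defining: "defining_identities K (lie_identities K)"
  by (simp add: defining_identities_def lie_identities_def Let_def poly_closed [OF K])

lemma lie_iff:
  fixes A :: "('k, 'b) module"
  assumes "nonassoc_algebra K A"
  shows "in_variety K (lie_identities K) A \<longleftrightarrow>
    (\<forall>x\<in>carrier A. x \<otimes>\<^bsub>A\<^esub> x = \<zero>\<^bsub>A\<^esub>) \<and>
    (\<forall>x\<in>carrier A. \<forall>y\<in>carrier A. \<forall>z\<in>carrier A.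
       (x \<otimes>\<^bsub>A\<^esub> y) \<otimes>\<^bsub>A\<^esub> z \<oplus>\<^bsub>A\<^esub> (y \<otimes>\<^bsub>A\<^esub> z) \<otimes>\<^bsub>A\<^esub> x \<oplus>\<^bsub>A\<^esub> (z \<otimes>\<^bsub>A\<^esub> x) \<otimes>\<^bsub>A\<^esub> y = \<zero>\<^bsub>A\<^esub>)"
    (is "_ \<longleftrightarrow> ?sq \<and> ?jac")
proof -
  interpret nonassoc_algebra K A by fact
  let ?P = "free_nalg K" and ?x = "\<lambda>i :: nat. nvar K i"
  let ?f = "?x 1 \<otimes>\<^bsub>?P\<^esub> ?x 1"
  let ?g = "(?x 1 \<otimes>\<^bsub>?P\<^esub> ?x 2) \<otimes>\<^bsub>?P\<^esub> ?x 3 \<oplus>\<^bsub>?P\<^esub> (?x 2 \<otimes>\<^bsub>?P\<^esub> ?x 3) \<otimes>\<^bsub>?P\<^esub> ?x 1 \<oplus>\<^bsub>?P\<^esub> (?x 3 \<otimes>\<^bsub>?P\<^esub> ?x 1) \<otimes>\<^bsub>?P\<^esub> ?x 2"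
  have eval_f: "eval_na K A v ?f = v 1 \<otimes>\<^bsub>A\<^esub> v 1"
    and eval_g: "eval_na K A v ?g = (v 1 \<otimes>\<^bsub>A\<^esub> v 2) \<otimes>\<^bsub>A\<^esub> v 3 \<oplus>\<^bsub>A\<^esub> (v 2 \<otimes>\<^bsub>A\<^esub> v 3) \<otimes>\<^bsub>A\<^esub> v 1 \<oplus>\<^bsub>A\<^esub> (v 3 \<otimes>\<^bsub>A\<^esub> v 1) \<otimes>\<^bsub>A\<^esub> v 2"
    if "range v \<subseteq> carrier A" for v
    by (simp_all add: eval_na_add [OF _ _ that] eval_na_mult [OF _ _ that] free_nalg_closed eval_na_nvar [OF that])
  have "satisfies K A ?f \<longleftrightarrow> ?sq"
  proof
    assume f: "satisfies K A ?f"
    show ?sq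
    proof
      fix x assume x: "x \<in> carrier A"
      then have v: "range (\<lambda>_ :: nat. x) \<subseteq> carrier A" by auto
      show "x \<otimes>\<^bsub>A\<^esub> x = \<zero>\<^bsub>A\<^esub>" using f eval_f [OF v] v by (simp add: satisfies_def)
    qed
  next
    assume ?sq
    then show "satisfies K A ?f" by (auto simp: satisfies_def eval_f simp del: One_nat_def)
  qed
  moreover have "satisfies K A ?g \<longleftrightarrow> ?jac"
  proof
    assume g: "satisfies K A ?g"
    show ?jac
    proof (intro ballI)
      fix x y z assume "x \<in> carrier A" "y \<in> carrier A" "z \<in> carrier A"
      then have v: "range (\<lambda>i :: nat. if i = 1 then x else if i = 2 then y else z) \<subseteq> carrier A" by auto
      show "(x \<otimes>\<^bsub>A\<^esub> y) \<otimes>\<^bsub>A\<^esub> z \<oplus>\<^bsub>A\<^esub> (y \<otimes>\<^bsub>A\<^esub> z) \<otimes>\<^bsub>A\<^esub> x \<oplus>\<^bsub>A\<^esub> (z \<otimes>\<^bsub>A\<^esub> x) \<otimes>\<^bsub>A\<^esub> y = \<zero>\<^bsub>A\<^esub>"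
        using g eval_g [OF v] v by (simp add: satisfies_def)
    qed
  next
    assume jac: ?jac
    show "satisfies K A ?g"
      unfolding satisfies_def
    proof (intro allI impI)
      fix v :: "nat \<Rightarrow> 'b" assume v: "range v \<subseteq> carrier A"
      then have "v i \<in> carrier A" for i by auto
      then show "eval_na K A v ?g = \<zero>\<^bsub>A\<^esub>" using jac eval_g [OF v] by simp
    qed
  qed
  ultimately show ?thesis
    using assms by (simp add: in_variety_def lie_identities_def Let_def)
qed

text \<open>
  The last rule is the Jacobi identity as used for rewriting: right multiplication by \<open>z\<close> is a
  derivation.
\<close>

lemma lie_algebra_rules:
  assumes "in_variety K (lie_identities K) A" "x \<in> carrier A" "y \<in> carrier A" "z \<in> carrier A"
  shows "x \<otimes>\<^bsub>A\<^esub> x = \<zero>\<^bsub>A\<^esub>" and "x \<otimes>\<^bsub>A\<^esub> y = \<ominus>\<^bsub>A\<^esub> (y \<otimes>\<^bsub>A\<^esub> x)"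
    and "(x \<otimes>\<^bsub>A\<^esub> y) \<otimes>\<^bsub>A\<^esub> z = (x \<otimes>\<^bsub>A\<^esub> z) \<otimes>\<^bsub>A\<^esub> y \<oplus>\<^bsub>A\<^esub> x \<otimes>\<^bsub>A\<^esub> (y \<otimes>\<^bsub>A\<^esub> z)"
proof -
  have A: "nonassoc_algebra K A" using assms(1) by (simp add: in_variety_def)
  interpret nonassoc_algebra K A by fact
  have sq: "x \<otimes>\<^bsub>A\<^esub> x = \<zero>\<^bsub>A\<^esub>" if "x \<in> carrier A" for x
    using assms(1) that by (simp add: lie_iff [OF A])
  show "x \<otimes>\<^bsub>A\<^esub> x = \<zero>\<^bsub>A\<^esub>" by (rule sq) fact
  have anti: "x \<otimes>\<^bsub>A\<^esub> y = \<ominus>\<^bsub>A\<^esub> (y \<otimes>\<^bsub>A\<^esub> x)" if "x \<in> carrier A" "y \<in> carrier A" for x y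
  proof -
    have "x \<otimes>\<^bsub>A\<^esub> y \<oplus>\<^bsub>A\<^esub> y \<otimes>\<^bsub>A\<^esub> x = (x \<oplus>\<^bsub>A\<^esub> y) \<otimes>\<^bsub>A\<^esub> (x \<oplus>\<^bsub>A\<^esub> y)"
      using that by (simp add: mult_l_distr mult_r_distr sq [OF that(1)] sq [OF that(2)] M.a_comm)
    also have "\<dots> = \<zero>\<^bsub>A\<^esub>" using that by (simp add: sq)
    finally show ?thesis using that by (intro M.minus_equality [symmetric]) auto
  qed
  then show "x \<otimes>\<^bsub>A\<^esub> y = \<ominus>\<^bsub>A\<^esub> (y \<otimes>\<^bsub>A\<^esub> x)" using assms by blast
  have neg: "(\<ominus>\<^bsub>A\<^esub> a) \<otimes>\<^bsub>A\<^esub> b = \<ominus>\<^bsub>A\<^esub> (a \<otimes>\<^bsub>A\<^esub> b)" if "a \<in> carrier A" "b \<in> carrier A" for a b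
    using smult_mult_l [of "\<ominus>\<^bsub>K\<^esub> \<one>\<^bsub>K\<^esub>" a b] that by (simp add: smult_l_minus)
  have "(x \<otimes>\<^bsub>A\<^esub> y) \<otimes>\<^bsub>A\<^esub> z \<oplus>\<^bsub>A\<^esub> (y \<otimes>\<^bsub>A\<^esub> z) \<otimes>\<^bsub>A\<^esub> x \<oplus>\<^bsub>A\<^esub> (z \<otimes>\<^bsub>A\<^esub> x) \<otimes>\<^bsub>A\<^esub> y = \<zero>\<^bsub>A\<^esub>"
    using assms by (simp add: lie_iff [OF A])
  then have 0: "(x \<otimes>\<^bsub>A\<^esub> y) \<otimes>\<^bsub>A\<^esub> z \<oplus>\<^bsub>A\<^esub> ((y \<otimes>\<^bsub>A\<^esub> z) \<otimes>\<^bsub>A\<^esub> x \<oplus>\<^bsub>A\<^esub> (z \<otimes>\<^bsub>A\<^esub> x) \<otimes>\<^bsub>A\<^esub> y) = \<zero>\<^bsub>A\<^esub>"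
    using assms by (simp add: M.a_assoc)
  have "(y \<otimes>\<^bsub>A\<^esub> z) \<otimes>\<^bsub>A\<^esub> x \<oplus>\<^bsub>A\<^esub> (z \<otimes>\<^bsub>A\<^esub> x) \<otimes>\<^bsub>A\<^esub> y = \<ominus>\<^bsub>A\<^esub> ((x \<otimes>\<^bsub>A\<^esub> z) \<otimes>\<^bsub>A\<^esub> y \<oplus>\<^bsub>A\<^esub> x \<otimes>\<^bsub>A\<^esub> (y \<otimes>\<^bsub>A\<^esub> z))"
    using assms anti [of "y \<otimes>\<^bsub>A\<^esub> z" x] anti [of z x] by (simp add: neg M.minus_add M.a_comm)
  with 0 M.minus_equality [of "(x \<otimes>\<^bsub>A\<^esub> y) \<otimes>\<^bsub>A\<^esub> z" "\<ominus>\<^bsub>A\<^esub> ((x \<otimes>\<^bsub>A\<^esub> z) \<otimes>\<^bsub>A\<^esub> y \<oplus>\<^bsub>A\<^esub> x \<otimes>\<^bsub>A\<^esub> (y \<otimes>\<^bsub>A\<^esub> z))"] assms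
  show "(x \<otimes>\<^bsub>A\<^esub> y) \<otimes>\<^bsub>A\<^esub> z = (x \<otimes>\<^bsub>A\<^esub> z) \<otimes>\<^bsub>A\<^esub> y \<oplus>\<^bsub>A\<^esub> x \<otimes>\<^bsub>A\<^esub> (y \<otimes>\<^bsub>A\<^esub> z)"
    by simp
qed

lemma lie_cong:
  shows "id_cong K (lie_identities K) (nmono K (Mul a a)) \<zero>\<^bsub>free_nalg K\<^esub>"
    and "id_cong K (lie_identities K) (nmono K (Mul a b)) (\<ominus>\<^bsub>K\<^esub> \<one>\<^bsub>K\<^esub> \<odot>\<^bsub>free_nalg K\<^esub> nmono K (Mul b a))"
    and "id_cong K (lie_identities K) (nmono K (Mul (Mul a b) c))
      (nmono K (Mul a c) \<otimes>\<^bsub>free_nalg K\<^esub> nmono K b \<oplus>\<^bsub>free_nalg K\<^esub> nmono K a \<otimes>\<^bsub>free_nalg K\<^esub> nmono K (Mul b c))"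
proof -
  note closed = poly_closed [OF K]
  have "eval_na K A v (nmono K (Mul a a)) = eval_na K A v \<zero>\<^bsub>free_nalg K\<^esub> \<and>
    eval_na K A v (nmono K (Mul a b)) = eval_na K A v (\<ominus>\<^bsub>K\<^esub> \<one>\<^bsub>K\<^esub> \<odot>\<^bsub>free_nalg K\<^esub> nmono K (Mul b a)) \<and>
    eval_na K A v (nmono K (Mul (Mul a b) c)) = eval_na K A v
      (nmono K (Mul a c) \<otimes>\<^bsub>free_nalg K\<^esub> nmono K b \<oplus>\<^bsub>free_nalg K\<^esub> nmono K a \<otimes>\<^bsub>free_nalg K\<^esub> nmono K (Mul b c))"
    if A: "in_variety K (lie_identities K) A" and v: "range v \<subseteq> carrier A"
    for A :: "('k, (nat na_monomial \<Rightarrow> 'k) set) module" and v :: "nat \<Rightarrow> (nat na_monomial \<Rightarrow> 'k) set"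
  proof -
    have A': "nonassoc_algebra K A" using A by (simp add: in_variety_def)
    interpret A: nonassoc_algebra K A by fact
    note e = A.eval_monomial_closed [OF v]
    note rules = lie_algebra_rules [OF A e [of a] e [of b] e [of c]]
    show ?thesis
      using rules e by (simp add: A.eval_na_smult [OF _ _ v] A.eval_na_add [OF _ _ v]
          A.eval_na_mult [OF _ _ v] closed eval_na_nmono [OF K A' v] A.eval_na_zero A.smult_l_minus)
  qed
  then show "id_cong K (lie_identities K) (nmono K (Mul a a)) \<zero>\<^bsub>free_nalg K\<^esub>"
    "id_cong K (lie_identities K) (nmono K (Mul a b)) (\<ominus>\<^bsub>K\<^esub> \<one>\<^bsub>K\<^esub> \<odot>\<^bsub>free_nalg K\<^esub> nmono K (Mul b a))"
    "id_cong K (lie_identities K) (nmono K (Mul (Mul a b) c))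
      (nmono K (Mul a c) \<otimes>\<^bsub>free_nalg K\<^esub> nmono K b \<oplus>\<^bsub>free_nalg K\<^esub> nmono K a \<otimes>\<^bsub>free_nalg K\<^esub> nmono K (Mul b c))"
    unfolding id_cong_def by (simp_all add: closed)
qed

lemmas lie_reducible_zero = reducible_zero [OF K lie_defining]
lemmas lie_reducible_nmono = reducible_nmono [OF K lie_defining]
lemmas lie_reducible_cong = reducible_cong [OF K lie_defining]
lemmas lie_reducible_mono = reducible_mono [OF K lie_defining]
lemmas lie_reducible_add = reducible_add [OF K lie_defining]
lemmas lie_reducible_smult = reducible_smult [OF K lie_defining]
lemmas lie_reducible_mult = reducible_mult [OF K lie_defining]

lemma lie_reducible_swap:
  assumes "reducible K (lie_identities K) X (nmono K (Mul t s))"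
  shows "reducible K (lie_identities K) X (nmono K (Mul s t))"
  by (rule lie_reducible_cong [OF lie_cong(2) lie_reducible_smult [OF assms]]) simp

definition hall_below :: "nat list \<Rightarrow> nat multiset \<Rightarrow> nat na_monomial set" where
  "hall_below v M = {h. hall h \<and> foliage h < v \<and> mset (foliage h) = M}"

text \<open>
  Hall trees span. If \<open>s t\<close> itself is no Hall tree, then \<open>s = s\<^sub>1 s\<^sub>2\<close> with \<open>s\<^sub>2 < t\<close>, and the Jacobi identity
  gives \<open>(s\<^sub>1 s\<^sub>2) t = (s\<^sub>1 t) s\<^sub>2 + s\<^sub>1 (s\<^sub>2 t)\<close>. The inner brackets are shorter than \<open>s t\<close>, so by induction they
  are combinations of Hall trees below \<open>t\<close>. The outer brackets then involve two Hall trees below \<open>t\<close>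
  with the same letters in total; there are finitely many words in these letters, so a second
  induction on the greater factor applies.
\<close>

lemma hall_bracket_reducible:
  assumes "hall s" "hall t" "foliage s < foliage t"
  shows "reducible K (lie_identities K)
    (hall_below (foliage t) (mset (foliage s) + mset (foliage t))) (nmono K (Mul s t))"
  using assms
proof (induction "length (foliage s) + length (foliage t)" arbitrary: s t rule: less_induct)
  case less_length: less
  let ?I = "lie_identities K" and ?l = "\<lambda>t. length (foliage t)" and ?m = "\<lambda>t. mset (foliage t)"
  define M where "M = ?m s + ?m t"
  \<comment> \<open>all foliages occurring below for a fixed multiset of letters; finiteness makes the inner induction well-founded\<close>
  define words where "words = {w. mset w \<subseteq># M}"
  have "words \<subseteq> {w. set w \<subseteq> set_mset M \<and> length w \<le> size M}"
    using set_mset_mono size_mset_mono by (fastforce simp: words_def)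
  then have fin: "finite words" by (rule finite_subset) (simp add: finite_lists_length_le)
  have "reducible K ?I (hall_below (foliage t') M) (nmono K (Mul s' t'))"
    if "hall s'" "hall t'" "foliage s' < foliage t'" "?m s' + ?m t' = M" for s' t'
    using that
  proof (induction "card {w \<in> words. w < foliage t'}" arbitrary: s' t' rule: less_induct)
    case less
    let ?v = "foliage t'" and ?Z = "hall_below (foliage t') M"
    have size: "?l s' + ?l t' = ?l s + ?l t"
      using arg_cong [OF less.prems(4), of size] by (simp add: M_def)
    have smaller: "reducible K ?I ?Z (nmono K (Mul h k))"
      if "hall h" "hall k" "foliage h < foliage k" "?m h + ?m k = M" "foliage k < ?v" for h k
    proof -
      have "foliage k \<in> words" using that by (auto simp: words_def)
      then have "{w \<in> words. w < foliage k} \<subset> {w \<in> words. w < ?v}"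
        using that by (auto intro: less_trans)
      then have "card {w \<in> words. w < foliage k} < card {w \<in> words. w < ?v}"
        by (intro psubset_card_mono) (auto simp: fin)
      from less.hyps [OF this that(1-4)] show ?thesis
        by (rule lie_reducible_mono) (use that in \<open>auto simp: hall_below_def\<close>)
    qed
    have pair: "reducible K ?I ?Z (nmono K (Mul h k))"
      if "hall h" "hall k" "?m h + ?m k = M" "foliage h < ?v" "foliage k < ?v" for h k
    proof -
      have "h = k" if "foliage h = foliage k"
        using foliage_inj_hall \<open>hall h\<close> \<open>hall k\<close> that by blast
      then consider "foliage h < foliage k" | "foliage k < foliage h" | "h = k"
        by (cases "foliage h" "foliage k" rule: linorder_cases) auto
      then show ?thesis
      proof cases
        case 1
        then show ?thesis using smaller that by blast
      next
        case 2
        then show ?thesis using smaller [of k h] that by (simp add: lie_reducible_swap add.commute)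
      next
        case 3
        then show ?thesis using lie_reducible_cong [OF lie_cong(1) lie_reducible_zero] by simp
      qed
    qed
    show ?case
    proof (cases "hall (Mul s' t')")
      case True
      then have "Mul s' t' \<in> ?Z"
        using less.prems lyndon_append_less by (auto simp: hall_below_def intro: hall_lyndon)
      then show ?thesis by (rule lie_reducible_nmono)
    next
      case False
      then obtain s1 s2 where s': "s' = Mul s1 s2" and s2: "foliage s2 < ?v"
        using less.prems by (cases s') (auto simp: not_le)
      then have h: "hall s1" "hall s2" "foliage s1 < foliage s2" using less.prems by auto
      then have s1: "foliage s1 < ?v" using s2 by simp
      have len: "?l s1 + ?l t' < ?l s + ?l t" "?l s2 + ?l t' < ?l s + ?l t"
        unfolding size [symmetric] s' by simp_all
      have M: "M = ?m s1 + ?m s2 + ?m t'" using less.prems s' by simp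
      have "reducible K ?I ?Z (nmono K (Mul s1 t') \<otimes>\<^bsub>free_nalg K\<^esub> nmono K s2)"
      proof (rule lie_reducible_mult)
        show "reducible K ?I (hall_below ?v (?m s1 + ?m t')) (nmono K (Mul s1 t'))"
          by (rule less_length.hyps [OF len(1) h(1) less.prems(2) s1])
        show "reducible K ?I {s2} (nmono K s2)" by (rule lie_reducible_nmono) simp
        fix a b assume "a \<in> hall_below ?v (?m s1 + ?m t')" "b \<in> {s2}"
        then show "reducible K ?I ?Z (nmono K (Mul a b))"
          using h s2 by (intro pair) (auto simp: hall_below_def M)
      qed
      moreover have "reducible K ?I ?Z (nmono K s1 \<otimes>\<^bsub>free_nalg K\<^esub> nmono K (Mul s2 t'))"
      proof (rule lie_reducible_mult)
        show "reducible K ?I (hall_below ?v (?m s2 + ?m t')) (nmono K (Mul s2 t'))"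
          by (rule less_length.hyps [OF len(2) h(2) less.prems(2) s2])
        show "reducible K ?I {s1} (nmono K s1)" by (rule lie_reducible_nmono) simp
        fix a b assume "a \<in> {s1}" "b \<in> hall_below ?v (?m s2 + ?m t')"
        then show "reducible K ?I ?Z (nmono K (Mul a b))"
          using h s1 by (intro pair) (auto simp: hall_below_def M)
      qed
      ultimately show ?thesis
        unfolding s' by (intro lie_reducible_cong [OF lie_cong(3)] lie_reducible_add)
    qed
  qed
  then show ?case using less_length.prems by (simp add: M_def)
qed

lemma lie_reduction:
  "reducible K (lie_identities K) {t. hall t \<and> (\<forall>x. degree_in x t = degree_in x m)} (nmono K m)"
  unfolding same_degrees_iff
proof (induction m)
  case (Sym x)
  show ?case by (rule lie_reducible_nmono) simp
next
  case (Mul s t)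
  let ?I = "lie_identities K" and ?Z = "{u. hall u \<and> mset (foliage u) = mset (foliage (Mul s t))}"
  have "reducible K ?I ?Z (nmono K s \<otimes>\<^bsub>free_nalg K\<^esub> nmono K t)"
  proof (rule lie_reducible_mult [OF Mul.IH])
    fix a b
    assume a: "a \<in> {u. hall u \<and> mset (foliage u) = mset (foliage s)}"
      and b: "b \<in> {u. hall u \<and> mset (foliage u) = mset (foliage t)}"
    consider "foliage a < foliage b" | "foliage b < foliage a" | "a = b"
      using foliage_inj_hall [of a b] a b by (cases "foliage a" "foliage b" rule: linorder_cases) auto
    then show "reducible K ?I ?Z (nmono K (Mul a b))"
    proof cases
      case 1
      then show ?thesis
        using a b by (intro lie_reducible_mono [OF hall_bracket_reducible]) (auto simp: hall_below_def)
    next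
      case 2
      then have "reducible K ?I ?Z (nmono K (Mul b a))"
        using a b by (intro lie_reducible_mono [OF hall_bracket_reducible]) (auto simp: hall_below_def)
      then show ?thesis by (rule lie_reducible_swap)
    next
      case 3
      then show ?thesis using lie_reducible_cong [OF lie_cong(1) lie_reducible_zero] by simp
    qed
  qed
  then show ?case by (simp only: nmono_mult [OF K])
qed

end

section \<open>Leading words in the Magnus algebra\<close>

text \<open>
  The coefficient at a word of the product of two noncommutative power series. Recursion on the word
  peels off one splitting at a time, which replaces sums over all splittings by induction.
\<close>

primrec conv :: "'k ring \<Rightarrow> nat list \<Rightarrow> (nat list \<Rightarrow> 'k) \<Rightarrow> (nat list \<Rightarrow> 'k) \<Rightarrow> 'k" where
  "conv K [] f g = f [] \<otimes>\<^bsub>K\<^esub> g []"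
| "conv K (x # w) f g = f [] \<otimes>\<^bsub>K\<^esub> g (x # w) \<oplus>\<^bsub>K\<^esub> conv K w (\<lambda>z. f (x # z)) g"

definition commutator :: "'k ring \<Rightarrow> (nat list \<Rightarrow> 'k) \<Rightarrow> (nat list \<Rightarrow> 'k) \<Rightarrow> nat list \<Rightarrow> 'k" where
  "commutator K f g w = conv K w f g \<ominus>\<^bsub>K\<^esub> conv K w g f"

abbreviation word_order :: "(nat list \<times> nat list) set" where
  "word_order \<equiv> lenlex less_than"

lemma word_order_iff: "(u, v) \<in> word_order \<longleftrightarrow> length u < length v \<or> length u = length v \<and> u < v"
proof -
  have "less_than = {(u, v :: nat). u < v}" by auto
  then show ?thesis by (auto simp: lenlex_conv lexord_lex list_less_def)
qed

lemma total_word_order: "total word_order"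
  by (auto simp: total_on_def word_order_iff)

context
  fixes K :: "'k ring"
  assumes K: "field K"
begin

interpretation K: field K by (rule K)

lemma conv_closed [simp]:
  "\<lbrakk>\<And>w. f w \<in> carrier K; \<And>w. g w \<in> carrier K\<rbrakk> \<Longrightarrow> conv K w f g \<in> carrier K"
  by (induction w arbitrary: f) auto

lemma conv_add_left:
  assumes "\<And>w. f w \<in> carrier K" "\<And>w. g w \<in> carrier K" "\<And>w. h w \<in> carrier K"
  shows "conv K w (\<lambda>z. f z \<oplus>\<^bsub>K\<^esub> g z) h = conv K w f h \<oplus>\<^bsub>K\<^esub> conv K w g h"
  using assms by (induction w arbitrary: f g) (auto simp: K.l_distr K.a_ac)

lemma conv_add_right:
  assumes "\<And>w. f w \<in> carrier K" "\<And>w. g w \<in> carrier K" "\<And>w. h w \<in> carrier K"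
  shows "conv K w h (\<lambda>z. f z \<oplus>\<^bsub>K\<^esub> g z) = conv K w h f \<oplus>\<^bsub>K\<^esub> conv K w h g"
  using assms by (induction w arbitrary: h) (auto simp: K.r_distr K.a_ac)

lemma conv_smult_left:
  assumes "c \<in> carrier K" "\<And>w. f w \<in> carrier K" "\<And>w. g w \<in> carrier K"
  shows "conv K w (\<lambda>z. c \<otimes>\<^bsub>K\<^esub> f z) g = c \<otimes>\<^bsub>K\<^esub> conv K w f g"
  using assms by (induction w arbitrary: f) (auto simp: K.r_distr K.m_assoc)

lemma conv_smult_right:
  assumes "c \<in> carrier K" "\<And>w. f w \<in> carrier K" "\<And>w. g w \<in> carrier K"
  shows "conv K w f (\<lambda>z. c \<otimes>\<^bsub>K\<^esub> g z) = c \<otimes>\<^bsub>K\<^esub> conv K w f g"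
  using assms by (induction w arbitrary: f) (auto simp: K.r_distr K.m_lcomm)

lemma conv_diff_left:
  assumes "\<And>w. f w \<in> carrier K" "\<And>w. g w \<in> carrier K" "\<And>w. h w \<in> carrier K"
  shows "conv K w (\<lambda>z. f z \<ominus>\<^bsub>K\<^esub> g z) h = conv K w f h \<ominus>\<^bsub>K\<^esub> conv K w g h"
proof -
  have "conv K w (\<lambda>z. f z \<ominus>\<^bsub>K\<^esub> g z) h = conv K w (\<lambda>z. f z \<oplus>\<^bsub>K\<^esub> (\<ominus>\<^bsub>K\<^esub> \<one>\<^bsub>K\<^esub>) \<otimes>\<^bsub>K\<^esub> g z) h"
    using assms by (simp add: K.minus_eq K.l_minus)
  also have "\<dots> = conv K w f h \<oplus>\<^bsub>K\<^esub> (\<ominus>\<^bsub>K\<^esub> \<one>\<^bsub>K\<^esub>) \<otimes>\<^bsub>K\<^esub> conv K w g h"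
    using assms by (simp add: conv_add_left conv_smult_left)
  finally show ?thesis using assms by (simp add: K.minus_eq K.l_minus)
qed

lemma conv_diff_right:
  assumes "\<And>w. f w \<in> carrier K" "\<And>w. g w \<in> carrier K" "\<And>w. h w \<in> carrier K"
  shows "conv K w h (\<lambda>z. f z \<ominus>\<^bsub>K\<^esub> g z) = conv K w h f \<ominus>\<^bsub>K\<^esub> conv K w h g"
proof -
  have "conv K w h (\<lambda>z. f z \<ominus>\<^bsub>K\<^esub> g z) = conv K w h (\<lambda>z. f z \<oplus>\<^bsub>K\<^esub> (\<ominus>\<^bsub>K\<^esub> \<one>\<^bsub>K\<^esub>) \<otimes>\<^bsub>K\<^esub> g z)"
    using assms by (simp add: K.minus_eq K.l_minus)
  also have "\<dots> = conv K w h f \<oplus>\<^bsub>K\<^esub> (\<ominus>\<^bsub>K\<^esub> \<one>\<^bsub>K\<^esub>) \<otimes>\<^bsub>K\<^esub> conv K w h g"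
    using assms by (simp add: conv_add_right conv_smult_right)
  finally show ?thesis using assms by (simp add: K.minus_eq K.l_minus)
qed

lemma conv_assoc:
  assumes "\<And>w. f w \<in> carrier K" "\<And>w. g w \<in> carrier K" "\<And>w. h w \<in> carrier K"
  shows "conv K w (\<lambda>z. conv K z f g) h = conv K w f (\<lambda>z. conv K z g h)"
  using assms
proof (induction w arbitrary: f)
  case Nil
  then show ?case by (simp add: K.m_assoc)
next
  case (Cons x w)
  then have IH: "conv K w (\<lambda>z. conv K z (\<lambda>z. f (x # z)) g) h = conv K w (\<lambda>z. f (x # z)) (\<lambda>z. conv K z g h)"
    by auto
  have "conv K w (\<lambda>z. f [] \<otimes>\<^bsub>K\<^esub> g (x # z) \<oplus>\<^bsub>K\<^esub> conv K z (\<lambda>z. f (x # z)) g) h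
      = f [] \<otimes>\<^bsub>K\<^esub> conv K w (\<lambda>z. g (x # z)) h \<oplus>\<^bsub>K\<^esub> conv K w (\<lambda>z. f (x # z)) (\<lambda>z. conv K z g h)"
    using Cons.prems by (simp add: conv_add_left conv_smult_left IH)
  then show ?case
    using Cons.prems by (simp add: K.r_distr K.m_assoc K.a_assoc)
qed

lemma commutator_algebra: "nonassoc_algebra K (fun_algebra K (commutator K))"
  by (rule nonassoc_algebra_fun_algebra [OF K])
    (auto simp: commutator_def conv_add_left conv_add_right conv_smult_left conv_smult_right
      K.minus_eq K.minus_add K.a_ac K.r_distr K.r_minus)

lemma commutator_lie: "in_variety K (lie_identities K) (fun_algebra K (commutator K))"
proof -
  have jacobi: "commutator K (commutator K f g) h w \<oplus>\<^bsub>K\<^esub> commutator K (commutator K g h) f w \<oplus>\<^bsub>K\<^esub>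
      commutator K (commutator K h f) g w = \<zero>\<^bsub>K\<^esub>"
    if f: "\<And>w. f w \<in> carrier K" and g: "\<And>w. g w \<in> carrier K" and h: "\<And>w. h w \<in> carrier K" for f g h w
  proof -
    have expand: "commutator K (commutator K a b) c w =
        (conv K w a (\<lambda>z. conv K z b c) \<ominus>\<^bsub>K\<^esub> conv K w b (\<lambda>z. conv K z a c)) \<ominus>\<^bsub>K\<^esub>
        (conv K w c (\<lambda>z. conv K z a b) \<ominus>\<^bsub>K\<^esub> conv K w c (\<lambda>z. conv K z b a))"
      if "\<And>w. a w \<in> carrier K" "\<And>w. b w \<in> carrier K" "\<And>w. c w \<in> carrier K" for a b c
    proof -
      have "commutator K a b = (\<lambda>w. conv K w a b \<ominus>\<^bsub>K\<^esub> conv K w b a)"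
        by (simp add: fun_eq_iff commutator_def)
      then show ?thesis
        using that by (simp add: commutator_def [of K _ c] conv_diff_left conv_diff_right conv_assoc)
    qed
    define p1 where "p1 = conv K w f (\<lambda>z. conv K z g h)"
    define p2 where "p2 = conv K w g (\<lambda>z. conv K z f h)"
    define p3 where "p3 = conv K w h (\<lambda>z. conv K z f g)"
    define p4 where "p4 = conv K w h (\<lambda>z. conv K z g f)"
    define p5 where "p5 = conv K w g (\<lambda>z. conv K z h f)"
    define p6 where "p6 = conv K w f (\<lambda>z. conv K z h g)"
    note p_defs = p1_def p2_def p3_def p4_def p5_def p6_def
    have p: "p1 \<in> carrier K" "p2 \<in> carrier K" "p3 \<in> carrier K" "p4 \<in> carrier K" "p5 \<in> carrier K" "p6 \<in> carrier K"
      using f g h by (auto simp: p_defs)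
    have "((p1 \<ominus>\<^bsub>K\<^esub> p2) \<ominus>\<^bsub>K\<^esub> (p3 \<ominus>\<^bsub>K\<^esub> p4)) \<oplus>\<^bsub>K\<^esub> ((p5 \<ominus>\<^bsub>K\<^esub> p4) \<ominus>\<^bsub>K\<^esub> (p1 \<ominus>\<^bsub>K\<^esub> p6)) \<oplus>\<^bsub>K\<^esub>
        ((p3 \<ominus>\<^bsub>K\<^esub> p6) \<ominus>\<^bsub>K\<^esub> (p5 \<ominus>\<^bsub>K\<^esub> p2)) = \<zero>\<^bsub>K\<^esub>"
      using p by algebra
    then show ?thesis
      by (simp only: expand [OF f g h] expand [OF g h f] expand [OF h f g] p_defs)
  qed
  have "commutator K f f w = \<zero>\<^bsub>K\<^esub>" if "\<And>w. f w \<in> carrier K" for f w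
    using that by (simp add: commutator_def K.minus_eq K.r_neg)
  then show ?thesis
    using jacobi by (simp add: lie_iff [OF K commutator_algebra] fun_eq_iff)
qed

lemma conv_nonzero_split:
  assumes "\<And>w. f w \<in> carrier K" "\<And>w. g w \<in> carrier K" "conv K w f g \<noteq> \<zero>\<^bsub>K\<^esub>"
  shows "\<exists>x y. w = x @ y \<and> f x \<noteq> \<zero>\<^bsub>K\<^esub> \<and> g y \<noteq> \<zero>\<^bsub>K\<^esub>"
  using assms
proof (induction w arbitrary: f)
  case Nil
  then have "f [] \<noteq> \<zero>\<^bsub>K\<^esub>" "g [] \<noteq> \<zero>\<^bsub>K\<^esub>" by auto
  then show ?case by auto
next
  case (Cons a w)
  show ?case
  proof (cases "conv K w (\<lambda>z. f (a # z)) g = \<zero>\<^bsub>K\<^esub>")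
    case True
    then have "f [] \<noteq> \<zero>\<^bsub>K\<^esub>" "g (a # w) \<noteq> \<zero>\<^bsub>K\<^esub>" using Cons.prems by auto
    then show ?thesis by (intro exI [of _ "[]"] exI [of _ "a # w"]) simp
  next
    case False
    then obtain x y where "w = x @ y" "f (a # x) \<noteq> \<zero>\<^bsub>K\<^esub>" "g y \<noteq> \<zero>\<^bsub>K\<^esub>"
      using Cons.IH [of "\<lambda>z. f (a # z)"] Cons.prems by auto
    then show ?thesis by (intro exI [of _ "a # x"] exI [of _ y]) simp
  qed
qed

lemma conv_single_split:
  assumes "\<And>w. f w \<in> carrier K" "\<And>w. g w \<in> carrier K"
    and "\<And>x y. \<lbrakk>x @ y = u @ v; x \<noteq> u\<rbrakk> \<Longrightarrow> f x = \<zero>\<^bsub>K\<^esub> \<or> g y = \<zero>\<^bsub>K\<^esub>"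
  shows "conv K (u @ v) f g = f u \<otimes>\<^bsub>K\<^esub> g v"
  using assms
proof (induction u arbitrary: f)
  case Nil
  show ?case
  proof (cases v)
    case (Cons a w)
    have "conv K w (\<lambda>z. f (a # z)) g = \<zero>\<^bsub>K\<^esub>"
    proof (rule ccontr)
      assume "conv K w (\<lambda>z. f (a # z)) g \<noteq> \<zero>\<^bsub>K\<^esub>"
      then obtain x y where "w = x @ y" "f (a # x) \<noteq> \<zero>\<^bsub>K\<^esub>" "g y \<noteq> \<zero>\<^bsub>K\<^esub>"
        using conv_nonzero_split [of "\<lambda>z. f (a # z)" g w] Nil.prems(1,2) by auto
      then show False using Nil.prems(3) [of "a # x" y] Cons by simp
    qed
    then show ?thesis using Cons Nil.prems by simp
  qed simp
next
  case (Cons a u)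
  have "f [] \<otimes>\<^bsub>K\<^esub> g (a # u @ v) = \<zero>\<^bsub>K\<^esub>"
    using Cons.prems(3) [of "[]" "a # u @ v"] Cons.prems(1,2) by auto
  moreover have "conv K (u @ v) (\<lambda>z. f (a # z)) g = f (a # u) \<otimes>\<^bsub>K\<^esub> g v"
    by (rule Cons.IH) (use Cons.prems(1,2) Cons.prems(3) [of "a # _"] in auto)
  ultimately show ?case using Cons.prems(1,2) by simp
qed

text \<open>
  The lowest word of a product of power series is the product of the lowest words: lengths force any
  other splitting, or a smaller word, to use a factor below one of the lowest words.
\<close>

lemma conv_lead:
  assumes f: "\<And>w. f w \<in> carrier K" and g: "\<And>w. g w \<in> carrier K"
    and u: "lead K word_order f u" and v: "lead K word_order g v"
  shows "lead K word_order (\<lambda>w. conv K w f g) (u @ v)"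
proof -
  have u0: "f u \<noteq> \<zero>\<^bsub>K\<^esub>" "\<And>x. f x \<noteq> \<zero>\<^bsub>K\<^esub> \<Longrightarrow> (x, u) \<notin> word_order"
    and v0: "g v \<noteq> \<zero>\<^bsub>K\<^esub>" "\<And>y. g y \<noteq> \<zero>\<^bsub>K\<^esub> \<Longrightarrow> (y, v) \<notin> word_order"
    using u v by (auto simp: lead_def)
  have "conv K (u @ v) f g = f u \<otimes>\<^bsub>K\<^esub> g v"
  proof (rule conv_single_split [OF f g], rule ccontr)
    fix x y assume xy: "x @ y = u @ v" "x \<noteq> u" "\<not> (f x = \<zero>\<^bsub>K\<^esub> \<or> g y = \<zero>\<^bsub>K\<^esub>)"
    then have "length u \<le> length x" "length v \<le> length y"
      using u0(2) [of x] v0(2) [of y] by (auto simp: word_order_iff)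
    moreover have "length x + length y = length u + length v"
      using arg_cong [OF xy(1), of length] by simp
    ultimately have "length x = length u" by simp
    then show False using xy by simp
  qed
  then have "conv K (u @ v) f g \<noteq> \<zero>\<^bsub>K\<^esub>" using u0 v0 f g by (simp add: K.integral_iff)
  moreover have "conv K w f g = \<zero>\<^bsub>K\<^esub>" if w: "(w, u @ v) \<in> word_order" for w
  proof (rule ccontr)
    assume "conv K w f g \<noteq> \<zero>\<^bsub>K\<^esub>"
    from conv_nonzero_split [OF f g this]
    obtain x y where xy: "w = x @ y" "f x \<noteq> \<zero>\<^bsub>K\<^esub>" "g y \<noteq> \<zero>\<^bsub>K\<^esub>" by blast
    note xu = u0(2) [OF xy(2)] and yv = v0(2) [OF xy(3)]
    have "length u \<le> length x" "length v \<le> length y" "length x + length y \<le> length u + length v"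
      using xu yv w unfolding word_order_iff xy(1) length_append by linarith+
    then have len: "length x = length u" "length y = length v" by linarith+
    then have "u \<le> x" "v \<le> y" using xu yv by (auto simp: word_order_iff not_less)
    then have "u @ v \<le> x @ y"
    proof (cases "u = x")
      case False
      then have "u < x" using \<open>u \<le> x\<close> by (simp add: order_less_le)
      then show ?thesis using less_append_same_length [of u x v y] len by (simp add: order_less_imp_le)
    qed (auto simp: le_less)
    then show False using w xy(1) len by (auto simp: word_order_iff)
  qed
  ultimately show ?thesis by (auto simp: lead_def)
qed

lemma commutator_lead:
  assumes f: "\<And>w. f w \<in> carrier K" and g: "\<And>w. g w \<in> carrier K"
    and u: "lead K word_order f u" and v: "lead K word_order g v" and uv: "u @ v \<noteq> v @ u"
  shows "lead K word_order (commutator K f g) (if u @ v < v @ u then u @ v else v @ u)"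
proof -
  note lead1 = conv_lead [OF f g u v] and lead2 = conv_lead [OF g f v u]
  have "trans word_order" by (simp add: lenlex_transI)
  consider "(u @ v, v @ u) \<in> word_order" "u @ v < v @ u" | "(v @ u, u @ v) \<in> word_order" "\<not> u @ v < v @ u"
    using uv by (cases "u @ v" "v @ u" rule: linorder_cases) (auto simp: word_order_iff)
  then show ?thesis
  proof cases
    case 1
    have "conv K w g f = \<zero>\<^bsub>K\<^esub>" if "w = u @ v \<or> (w, u @ v) \<in> word_order" for w
      using lead2 1 that \<open>trans word_order\<close> by (auto simp: lead_def dest: transD)
    then show ?thesis
      using lead1 1 f g by (auto simp: lead_def commutator_def K.minus_eq)
  next
    case 2
    have "conv K w f g = \<zero>\<^bsub>K\<^esub>" if "w = v @ u \<or> (w, v @ u) \<in> word_order" for w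
      using lead1 2 that \<open>trans word_order\<close> by (auto simp: lead_def dest: transD)
    then show ?thesis
      using lead2 2 f g by (auto simp: lead_def commutator_def K.minus_eq)
  qed
qed

definition letter :: "nat \<Rightarrow> nat list \<Rightarrow> 'k" where
  "letter x = (\<lambda>w. if w = [x] then \<one>\<^bsub>K\<^esub> else \<zero>\<^bsub>K\<^esub>)"

text \<open>
  The two terms of the commutator have the lowest words \<open>u v\<close> and \<open>v u\<close>, and \<open>u v < v < v u\<close> for Lyndon
  words \<open>u < v\<close>.
\<close>

lemma hall_lead:
  assumes "hall t"
  shows "lead K word_order (eval_monomial (fun_algebra K (commutator K)) letter t) (foliage t)"
  using assms
proof (induction t)
  case (Sym x)
  then show ?case by (auto simp: lead_def letter_def word_order_iff)
next
  case (Mul s t)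
  interpret nonassoc_algebra K "fun_algebra K (commutator K)" by (rule commutator_algebra)
  have "range letter \<subseteq> carrier (fun_algebra K (commutator K))" by (auto simp: letter_def)
  from eval_monomial_closed [OF this]
  have closed: "eval_monomial (fun_algebra K (commutator K)) letter m w \<in> carrier K" for m w by simp
  have "foliage s @ foliage t < foliage t"
    using Mul.prems by (intro lyndon_append_less hall_lyndon) auto
  also have "foliage t < foliage t @ foliage s" by (rule less_append_right) simp
  finally have less: "foliage s @ foliage t < foliage t @ foliage s" .
  let ?e = "eval_monomial (fun_algebra K (commutator K)) letter"
  have "lead K word_order (commutator K (?e s) (?e t)) (foliage s @ foliage t)"
    using commutator_lead [of "?e s" "?e t" "foliage s" "foliage t"] closed less Mul by simp
  then show ?case by simp
qed

text \<open>
  Elements with different leading words do not commute, since distinct Lyndon words do not commute.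
\<close>

lemma lie_MLM: "MLM_variety TYPE('f) TYPE('a) K (lie_identities K)"
proof -
  interpret normal_forms K "lie_identities K" "commutator K" letter "{t. hall t}" word_order foliage
  proof (unfold_locales)
    show "inj_on foliage {t :: nat na_monomial. hall t}"
      by (auto intro: inj_onI foliage_inj_hall)
    show "lead K word_order (eval_monomial (fun_algebra K (commutator K)) letter t) (foliage t)"
      if "t \<in> {t. hall t}" for t using that hall_lead by simp
    show "reducible K (lie_identities K) {t \<in> {t. hall t}. \<forall>x. degree_in x t = degree_in x m} (nmono K m)" for m
      using lie_reduction [OF K] by simp
  qed (use lie_defining [OF K] commutator_lie total_word_order
      in \<open>auto simp: letter_def lenlex_transI\<close>)
  show ?thesis
  proof (rule MLM)
    fix f g :: "nat list \<Rightarrow> 'k" and s t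
    assume fg: "f \<in> carrier W" "g \<in> carrier W" and st: "s \<in> {t. hall t}" "t \<in> {t. hall t}" "s \<noteq> t"
      and s: "lead K word_order f (foliage s)" and t: "lead K word_order g (foliage t)"
      and crit: "if f \<otimes>\<^bsub>W\<^esub> f = \<zero>\<^bsub>W\<^esub> then g \<otimes>\<^bsub>W\<^esub> f = \<zero>\<^bsub>W\<^esub> else (f \<otimes>\<^bsub>W\<^esub> f) \<otimes>\<^bsub>W\<^esub> g = (g \<otimes>\<^bsub>W\<^esub> f) \<otimes>\<^bsub>W\<^esub> f"
    have f: "f i \<in> carrier K" and g: "g i \<in> carrier K" for i using fg by auto
    have "f \<otimes>\<^bsub>W\<^esub> f = \<zero>\<^bsub>W\<^esub>"
      using lie_algebra_rules(1) [OF K commutator_lie fg(1) fg(1) fg(1)] .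
    then have "g \<otimes>\<^bsub>W\<^esub> f = \<zero>\<^bsub>W\<^esub>" using crit by simp
    moreover have "foliage t @ foliage s \<noteq> foliage s @ foliage t"
      using foliage_commute_hall [of t s] st by auto
    from commutator_lead [OF g f t s this] have "commutator K g f \<noteq> (\<lambda>i. \<zero>\<^bsub>K\<^esub>)"
      by (auto simp: lead_def)
    ultimately show False by simp
  qed
qed

end

section \<open>The MLM theorem\<close>

theorem theorem2p5:
  fixes K :: "'k ring"
  assumes "field K"
  shows "(\<forall>I. defining_identities K I \<and>
              homogeneous_variety K I \<and>
              schreier_variety TYPE('g::infinite) K I \<and>
              variety_identity K I (nvar K 1 \<otimes>\<^bsub>free_nalg K\<^esub> nvar K 1) \<and>
              \<not> variety_identity K I (nvar K 1 \<otimes>\<^bsub>free_nalg K\<^esub> nvar K 2)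
              \<longrightarrow> MLM_variety TYPE('f) TYPE('a) K I) \<and>
         MLM_variety TYPE('f) TYPE('a) K (lie_identities K) \<and>
         MLM_variety TYPE('f) TYPE('a) K (anticommutative_identities K)"
  using schreier_MLM [OF assms, where ?'g = 'g] lie_MLM [OF assms] anticommutative_MLM [OF assms]
  by blast

end
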